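(* Let $f,\tilde f\in L^1(\mathbb{R}^N)\cap L^\infty(\mathbb{R}^N)$ and let $u,\tilde u\in L^\infty(\mathbb{R}^N)$ be entropy solutions to $$b(u)+\operatorname{div}(F(u))+(-\Delta)^{\frac s2}u=f\quad\text{and}\quad b(\tilde u)+\operatorname{div}(F(\tilde u))+(-\Delta)^{\frac s2}\tilde u=\tilde f\quad\text{in }\mathbb{R}^N,$$ respectively, such that $b(u),b(\tilde u)\in L^1(\mathbb{R}^N)$. Then $$\int_{\mathbb{R}^N}|b(u(x))-b(\tilde u(x))|\,dx\leq\int_{\mathbb{R}^N}|f(x)-\tilde f(x)|\,dx.$$
   Context: Standing assumptions: $N\in\mathbb{N}$, $s\in(0,1]$; $b:\mathbb{R}\to\mathbb{R}$ is Lipschitz continuous and nondecreasing with $b(0)=0$ and $b(r)r\geq\lambda|r|^2$ for all $r\in\mathbb{R}$, for some $\lambda>0$; $F=(F_1,\dots,F_N):\mathbb{R}\to\mathbb{R}^N$ is locally Lipschitz continuous with $F(0)=0$. The constant is $C(N,s)=\frac{s\,\Gamma(\frac{N+s}{2})}{2\pi^{\frac N2+s}\Gamma(1-\frac s2)}$. $\mathcal{D}(\mathbb{R}^N)=C_c^\infty(\mathbb{R}^N)$. Entropy solution: a function $u\in L^\infty(\mathbb{R}^N)$ is called an entropy solution to $b(u)+\operatorname{div}(F(u))+(-\Delta)^{s/2}u=f$ if for all $r>0$, all $\varphi\in\mathcal{D}(\mathbb{R}^N)$ with $\varphi\geq0$, all convex $\eta\in C^2(\mathbb{R})$ and all $\phi=(\phi_1,\dots,\phi_N):\mathbb{R}\to\mathbb{R}^N$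 locally Lipschitz with $\phi_i'=\eta'F_i'$ (a.e.) for $i=1,\dots,N$, it holds $$\int_{\mathbb{R}^N}(f(x)-b(u(x)))\eta'(u(x))\varphi(x)+\phi(u(x))\cdot\nabla\varphi(x)\,dx$$ $$+C(N,s)\int_{\mathbb{R}^N}\int_{\{|z|\geq r\}}\eta'(u(x))\frac{u(x+z)-u(x)}{|z|^{N+s}}\varphi(x)\,dz\,dx$$ $$+C(N,s)\int_{\mathbb{R}^N}\int_{\{|z|\leq r\}}\eta(u(x))\frac{\varphi(x+z)-\varphi(x)-\nabla\varphi(x)\cdot z}{|z|^{N+s}}\,dz\,dx\geq0.$$ *)

theory Defs
  imports "HOL-Analysis.Analysis"
begin

text \<open>
  The dimension \<open>N\<close> is \<open>CARD('n)\<close>, and \<open>\<real>\<^sup>N\<close> is the type \<open>real ^ 'n\<close>.  All integrals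
  over \<open>\<real>\<^sup>N\<close> are Lebesgue (Bochner) integrals with respect to \<^term>\<open>lebesgue\<close>, and
  elements of \<open>L\<^sup>1\<close> and \<open>L\<^sup>\<infinity>\<close> are represented by Lebesgue measurable functions.
\<close>

definition L_one :: "('a::euclidean_space \<Rightarrow> real) \<Rightarrow> bool" where
  "L_one u \<longleftrightarrow> integrable lebesgue u"

definition L_infty :: "('a::euclidean_space \<Rightarrow> real) \<Rightarrow> bool" where
  "L_infty u \<longleftrightarrow> u \<in> borel_measurable lebesgue \<and> (\<exists>M. AE x in lebesgue. \<bar>u x\<bar> \<le> M)"

text \<open>
  A function is \<open>C\<^sup>k\<^sup>+\<^sup>1\<close> iff it is (Frechet) differentiable everywhere and all its directional
  derivatives are \<open>C\<^sup>k\<close>.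
\<close>

primrec C_k :: "nat \<Rightarrow> ('a::euclidean_space \<Rightarrow> real) \<Rightarrow> bool" where
  "C_k 0 f \<longleftrightarrow> continuous_on UNIV f"
| "C_k (Suc k) f \<longleftrightarrow>
     (\<forall>x. f differentiable (at x)) \<and> (\<forall>v. C_k k (\<lambda>x. frechet_derivative f (at x) v))"

definition test_function :: "('a::euclidean_space \<Rightarrow> real) \<Rightarrow> bool" where
  "test_function \<phi> \<longleftrightarrow> (\<forall>k. C_k k \<phi>) \<and> compact (closure {x. \<phi> x \<noteq> 0})"

definition grad :: "(real ^ 'n \<Rightarrow> real) \<Rightarrow> real ^ 'n \<Rightarrow> real ^ 'n" where
  "grad \<phi> x = (\<chi> i. frechet_derivative \<phi> (at x) (axis i 1))"

text \<open>
  The library's \<^const>\<open>local_lipschitz\<close> is for functions with an additional parameter, which is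
  a dummy here.
\<close>

definition locally_lipschitz :: "(real \<Rightarrow> real ^ 'n) \<Rightarrow> bool" where
  "locally_lipschitz F \<longleftrightarrow> local_lipschitz (UNIV :: real set) UNIV (\<lambda>_. F)"

definition frac_const :: "nat \<Rightarrow> real \<Rightarrow> real" where
  "frac_const N s =
     s * Gamma ((real N + s) / 2) / (2 * pi powr (real N / 2 + s) * Gamma (1 - s / 2))"

text \<open>
  \<open>entropy_flux F \<eta> \<Phi>\<close>: \<open>\<Phi>\<^sub>i' = \<eta>' F\<^sub>i'\<close> almost everywhere, for every component.  At almost
  every point both derivatives exist, since \<open>F\<close> and \<open>\<Phi>\<close> are locally Lipschitz.
\<close>

definition entropy_flux ::
  "(real \<Rightarrow> real ^ 'n) \<Rightarrow> (real \<Rightarrow> real) \<Rightarrow> (real \<Rightarrow> real ^ 'n) \<Rightarrow> bool" where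
  "entropy_flux F \<eta> \<Phi> \<longleftrightarrow> locally_lipschitz \<Phi> \<and>
     (\<forall>i. AE t in lebesgue. \<exists>D.
        ((\<lambda>r. F r $ i) has_real_derivative D) (at t) \<and>
        ((\<lambda>r. \<Phi> r $ i) has_real_derivative deriv \<eta> t * D) (at t))"

text \<open>
  Entropy solutions of \<open>b(u) + div (F(u)) + (-\<Delta>)\<^sup>s\<^sup>/\<^sup>2 u = f\<close> in \<open>\<real>\<^sup>N\<close>.  The singular kernel
  takes the value 0 at \<open>z = 0\<close>, which is immaterial for the integrals.
\<close>

definition entropy_solution ::
  "real \<Rightarrow> (real \<Rightarrow> real) \<Rightarrow> (real \<Rightarrow> real ^ 'n) \<Rightarrow> (real ^ 'n \<Rightarrow> real) \<Rightarrow> (real ^ 'n \<Rightarrow> real) \<Rightarrow> bool"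
  where
  "entropy_solution s b F f u \<longleftrightarrow> L_infty u \<and>
     (\<forall>r > 0. \<forall>\<phi> \<eta> \<Phi>.
        test_function \<phi> \<and> (\<forall>x. \<phi> x \<ge> 0) \<and>
        convex_on UNIV \<eta> \<and> C_k 2 \<eta> \<and> entropy_flux F \<eta> \<Phi> \<longrightarrow>
        (LINT x|lebesgue. (f x - b (u x)) * deriv \<eta> (u x) * \<phi> x + \<Phi> (u x) \<bullet> grad \<phi> x)
        + frac_const CARD('n) s *
          (LINT x|lebesgue. (LINT z:{z. norm z \<ge> r}|lebesgue.
             deriv \<eta> (u x) * ((u (x + z) - u x) / norm z powr (real CARD('n) + s)) * \<phi> x))
        + frac_const CARD('n) s *
          (LINT x|lebesgue. (LINT z:{z. norm z \<le> r}|lebesgue.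
             \<eta> (u x) * ((\<phi> (x + z) - \<phi> x - grad \<phi> x \<bullet> z) / norm z powr (real CARD('n) + s))))
        \<ge> 0)"

end

theory Submission
  imports Defs
begin

text \<open>
  The proof is Kruzhkov's doubling of variables, organised so that only one small parameter has
  to be removed at each stage.

  Smooth convex approximations of \<open>\<bar>t - k\<bar>\<close> are admissible entropies.  Letting them converge
  turns the entropy inequality into one with \<open>sgn (u - k)\<close> in front of the equation
  (\<open>kruzhkov_inequality\<close>).  An entropy flux exists only if \<open>F\<close> is differentiable almost
  everywhere, so the one-dimensional Rademacher theorem is needed first
  (\<open>locally_lipschitz_AE_derivative\<close>); the flux itself is then obtained by integrating
  \<open>\<eta>' F'\<close> by parts (\<open>kruzhkov_flux_exists\<close>).

  Write \<open>v\<close>, \<open>g\<close> for the second solution and its datum.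
  The inequality for \<open>u\<close> is used with \<open>k = v y\<close>, the one for \<open>v\<close> with \<open>k = u x\<close>, both with a
  bump \<open>\<rho> (x - y)\<close> of radius \<open>e\<close> as test function.  Coercivity of \<open>b\<close> and integrability of
  \<open>b (u)\<close>, \<open>b (v)\<close> give \<open>u, v \<in> L\<^sup>1\<close>; hence every term is integrable over
  \<open>(x, y)\<close>, and \<open>\<rho> (x - y)\<close> may be used without a cut-off at infinity.  As
  \<open>(\<nabla>\<^sub>x + \<nabla>\<^sub>y) \<rho> (x - y) = 0\<close>, the two flux terms cancel in the sum.  The jumps of length at least
  \<open>r\<close> contribute a nonpositive amount: along a line \<open>x - y = w\<close> they form a bounded jump operator
  applied to \<open>d x = u x - v (x - w)\<close>, tested with \<open>sgn d\<close>, and such operators are accretive in \<open>L\<^sup>1\<close>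
  (\<open>jump_accretive\<close>, \<open>doubled_jump_nonpos\<close>).  The short jumps act on the smooth bump and are of
  size \<open>\<integral>\<^bsub>\<bar>z\<bar> \<le> r\<^esub> \<bar>z\<bar>\<^sup>2 / \<bar>z\<bar>\<^bsup>N+s\<^esup> dz\<close>, which vanishes as \<open>r \<rightarrow> 0\<close>
  (\<open>near_op_bound\<close>, \<open>near_kernel_mass_tendsto_0\<close>).  Monotonicity of \<open>b\<close> then leaves
  \<open>\<integral>\<integral> \<bar>b (u x) - b (v y)\<bar> \<rho> (x - y) \<le> \<integral>\<integral> \<bar>f x - g y\<bar> \<rho> (x - y)\<close> (\<open>doubled_comparison\<close>), and
  continuity of translations in \<open>L\<^sup>1\<close> yields the claim as \<open>e \<rightarrow> 0\<close> (\<open>borel_L1_contraction\<close>).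
\<close>

section \<open>Differentiability of Lipschitz functions of one variable\<close>

text \<open>
  In dimension one the balls of the Vitali covering theorem are compact intervals, indexed here by
  centre and radius.  A fine cover stays fine after discarding the intervals that leave \<open>G\<close>.
\<close>

lemma vitali_intervals:
  fixes S G :: "real set" and R :: "real \<Rightarrow> real \<Rightarrow> bool"
  assumes "open G" "S \<subseteq> G"
    and fine: "\<And>x d. x \<in> S \<Longrightarrow> 0 < d \<Longrightarrow> \<exists>c r. 0 < r \<and> r < d \<and> x \<in> cball c r \<and> R c r"
  shows "\<exists>C. countable C \<and>
    (\<forall>i\<in>C. 0 < snd i \<and> cball (fst i) (snd i) \<subseteq> G \<and> R (fst i) (snd i)) \<and>
    disjoint_family_on (\<lambda>i. cball (fst i) (snd i)) C \<and>
    negligible (S - (\<Union>i\<in>C. cball (fst i) (snd i)))"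
proof -
  define K where "K = {i. 0 < snd i \<and> cball (fst i) (snd i) \<subseteq> G \<and> R (fst i) (snd i)}"
  have cov: "\<exists>i. i \<in> K \<and> x \<in> cball (fst i) (snd i) \<and> snd i < d" if x: "x \<in> S" and d: "0 < d" for x d
  proof -
    obtain e where e: "e > 0" "ball x e \<subseteq> G"
      using x assms(1,2) open_contains_ball by blast
    obtain c r where cr: "0 < r" "r < min d (e / 2)" "x \<in> cball c r" "R c r"
      using fine[OF x, of "min d (e / 2)"] d e by auto
    have "cball c r \<subseteq> ball x e"
    proof
      fix y assume "y \<in> cball c r"
      then show "y \<in> ball x e"
        using cr dist_triangle[of x y c] by (auto simp: dist_commute)
    qed
    then show ?thesis
      using cr e by (intro exI[of _ "(c, r)"]) (auto simp: K_def)
  qed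
  obtain C where C: "countable C" "C \<subseteq> K"
     "pairwise (\<lambda>i j. disjnt (cball (fst i) (snd i)) (cball (fst j) (snd j))) C"
     "negligible (S - (\<Union>i\<in>C. cball (fst i) (snd i)))"
    by (rule Vitali_covering_theorem_cballs[of K snd S fst]) (use cov in \<open>auto simp: K_def\<close>)
  show ?thesis
    by (rule exI[of _ C])
      (use C in \<open>auto simp: K_def disjoint_family_on_def pairwise_def disjnt_def\<close>)
qed

lemma cball_of_increment:
  fixes x h :: real and g :: "real \<Rightarrow> real"
  assumes "h \<noteq> 0"
  shows "x \<in> cball (x + h / 2) (\<bar>h\<bar> / 2)"
    "(g (x + h / 2 + \<bar>h\<bar> / 2) - g (x + h / 2 - \<bar>h\<bar> / 2)) = sgn h * (g (x + h) - g x)"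
proof -
  show "x \<in> cball (x + h / 2) (\<bar>h\<bar> / 2)"
    by (simp add: dist_real_def)
  have "h > 0 \<Longrightarrow> x + h / 2 + \<bar>h\<bar> / 2 = x + h" "h > 0 \<Longrightarrow> x + h / 2 - \<bar>h\<bar> / 2 = x"
    "h < 0 \<Longrightarrow> x + h / 2 + \<bar>h\<bar> / 2 = x" "h < 0 \<Longrightarrow> x + h / 2 - \<bar>h\<bar> / 2 = x + h"
    by (simp_all add: field_simps)
  then show "g (x + h / 2 + \<bar>h\<bar> / 2) - g (x + h / 2 - \<bar>h\<bar> / 2) = sgn h * (g (x + h) - g x)"
    using assms by (cases "h > 0") (simp_all add: sgn_if del: add.commute, simp_all add: add.commute)
qed

text \<open>
  Let \<open>\<mu>\<close> be the Stieltjes measure of \<open>g\<close> and \<open>G\<close> an open set around \<open>E\<close>.  Cover \<open>E\<close> by disjoint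
  intervals in \<open>G\<close> on which \<open>g\<close> has slope less than \<open>p\<close>, and then again by disjoint intervals inside
  the interiors of the first ones, on which the slope exceeds \<open>q\<close>.  Comparing the \<open>\<mu>\<close>-measures of the two
  unions gives \<open>q |E| \<le> p |G|\<close>, and \<open>|G|\<close> can be taken arbitrarily close to \<open>|E|\<close>.
\<close>

lemma derivate_gap_negligible:
  fixes g :: "real \<Rightarrow> real"
  assumes mono: "mono g" and cont: "continuous_on UNIV g"
    and E: "E \<in> lmeasurable" and pq: "0 \<le> p" "p < q"
    and low: "\<And>x d. x \<in> E \<Longrightarrow> 0 < d \<Longrightarrow> \<exists>h. h \<noteq> 0 \<and> \<bar>h\<bar> < d \<and> (g (x + h) - g x) / h < p"
    and up: "\<And>x d. x \<in> E \<Longrightarrow> 0 < d \<Longrightarrow> \<exists>h. h \<noteq> 0 \<and> \<bar>h\<bar> < d \<and> q < (g (x + h) - g x) / h"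
  shows "negligible E"
proof -
  have "0 \<le> q" using pq by simp
  define \<mu> where "\<mu> = interval_measure g"
  have sets_mu: "sets \<mu> = sets borel" by (simp add: \<mu>_def)
  have mu_cball: "emeasure \<mu> (cball c r) = ennreal (g (c + r) - g (c - r))" if "r > 0" for c r
    unfolding \<mu>_def cball_eq_atLeastAtMost using that monoD[OF mono] cont
    by (intro emeasure_interval_measure_Icc) auto
  have leb_cball: "emeasure lborel (cball c r) = ennreal (2 * r)" if "r > 0" for c r :: real
    using that by (simp add: cball_eq_atLeastAtMost)
  have main: "ennreal q * emeasure lebesgue E \<le> ennreal p * emeasure lebesgue G"
    if G: "open G" "E \<subseteq> G" for G
  proof -
    have "\<exists>c r. 0 < r \<and> r < d \<and> x \<in> cball c r \<and> g (c + r) - g (c - r) < p * (2 * r)"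
      if x: "x \<in> E" "0 < d" for x d
    proof -
      obtain h where h: "h \<noteq> 0" "\<bar>h\<bar> < d" "(g (x + h) - g x) / h < p"
        using low[OF x] by blast
      then have "sgn h * (g (x + h) - g x) < p * (2 * (\<bar>h\<bar> / 2))"
        by (cases "h > 0") (auto simp: sgn_if field_simps abs_if)
      then show ?thesis
        using h cball_of_increment[OF h(1)]
        by (intro exI[of _ "x + h / 2"] exI[of _ "\<bar>h\<bar> / 2"]) auto
    qed
    then obtain C where C: "countable C"
      "\<forall>i\<in>C. 0 < snd i \<and> cball (fst i) (snd i) \<subseteq> G \<and>
          g (fst i + snd i) - g (fst i - snd i) < p * (2 * snd i)"
      "disjoint_family_on (\<lambda>i. cball (fst i) (snd i)) C"
      "negligible (E - (\<Union>i\<in>C. cball (fst i) (snd i)))"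
      using vitali_intervals[OF G, of "\<lambda>c r. g (c + r) - g (c - r) < p * (2 * r)"] by blast
    define H where "H = (\<Union>i\<in>C. ball (fst i) (snd i))"
    have "open H" by (auto simp: H_def)
    have "\<exists>c r. 0 < r \<and> r < d \<and> x \<in> cball c r \<and> q * (2 * r) < g (c + r) - g (c - r)"
      if x: "x \<in> E \<inter> H" "0 < d" for x d
    proof -
      obtain h where h: "h \<noteq> 0" "\<bar>h\<bar> < d" "q < (g (x + h) - g x) / h"
        using up[of x d] x by blast
      then have "q * (2 * (\<bar>h\<bar> / 2)) < sgn h * (g (x + h) - g x)"
        by (cases "h > 0") (auto simp: sgn_if field_simps abs_if)
      then show ?thesis
        using h cball_of_increment[OF h(1)]
        by (intro exI[of _ "x + h / 2"] exI[of _ "\<bar>h\<bar> / 2"]) auto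
    qed
    then obtain D where D: "countable D"
      "\<forall>i\<in>D. 0 < snd i \<and> cball (fst i) (snd i) \<subseteq> H \<and>
          q * (2 * snd i) < g (fst i + snd i) - g (fst i - snd i)"
      "disjoint_family_on (\<lambda>i. cball (fst i) (snd i)) D"
      "negligible (E \<inter> H - (\<Union>i\<in>D. cball (fst i) (snd i)))"
      using vitali_intervals[OF \<open>open H\<close> Int_lower2,
          of E "\<lambda>c r. q * (2 * r) < g (c + r) - g (c - r)"] by blast
    let ?C = "\<Union>i\<in>C. cball (fst i) (snd i)" and ?D = "\<Union>i\<in>D. cball (fst i) (snd i)"
    have bC: "?C \<in> sets borel" "?D \<in> sets borel"
      using C(1) D(1) by (auto intro!: sets.countable_UN')
    \<comment> \<open>The second cover must lie in open intervals; the endpoints lost in this way are countably many.\<close>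
    have "negligible (\<Union>i\<in>C. {fst i - snd i, fst i + snd i})"
      using C(1) by (auto intro!: countable_imp_null_set_lborel null_sets_completionI
          simp: negligible_iff_null_sets)
    moreover have "E - ?D \<subseteq> (E - ?C) \<union> (\<Union>i\<in>C. {fst i - snd i, fst i + snd i}) \<union> (E \<inter> H - ?D)"
    proof
      fix x assume x: "x \<in> E - ?D"
      show "x \<in> (E - ?C) \<union> (\<Union>i\<in>C. {fst i - snd i, fst i + snd i}) \<union> (E \<inter> H - ?D)"
      proof (cases "x \<in> ?C")
        case True
        then obtain i where i: "i \<in> C" "x \<in> cball (fst i) (snd i)" by blast
        then have "x \<in> ball (fst i) (snd i) \<or> x = fst i - snd i \<or> x = fst i + snd i"
          by (auto simp: dist_real_def abs_if split: if_splits)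
        then show ?thesis using i x by (auto simp: H_def)
      qed (use x in auto)
    qed
    ultimately have "negligible (E - ?D)"
      using C(4) D(4) negligible_subset by (meson negligible_Un)
    then have "emeasure lebesgue (E - ?D) = 0"
      using negligible_iff_emeasure0[OF negligible_imp_sets] by blast
    have "emeasure lebesgue E \<le> emeasure lebesgue ((E - ?D) \<union> ?D)"
      using E bC \<open>negligible (E - ?D)\<close> by (intro emeasure_mono) (auto simp: negligible_imp_sets fmeasurableD)
    also have "\<dots> \<le> emeasure lebesgue (E - ?D) + emeasure lebesgue ?D"
      using bC \<open>negligible (E - ?D)\<close> by (intro emeasure_subadditive) (auto simp: negligible_imp_sets)
    finally have "emeasure lebesgue E \<le> emeasure lborel ?D"
      using \<open>emeasure lebesgue (E - ?D) = 0\<close> bC by simp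
    then have "ennreal q * emeasure lebesgue E \<le> ennreal q * emeasure lborel ?D"
      by (rule mult_left_mono) simp
    also have "\<dots> = (\<integral>\<^sup>+i. ennreal q * emeasure lborel (cball (fst i) (snd i)) \<partial>count_space D)"
      using D(1,3) by (subst emeasure_UN_countable) (auto simp: nn_integral_cmult)
    also have "\<dots> \<le> (\<integral>\<^sup>+i. emeasure \<mu> (cball (fst i) (snd i)) \<partial>count_space D)"
    proof (intro nn_integral_mono)
      fix i assume "i \<in> space (count_space D)"
      then have i: "i \<in> D" by simp
      then have r: "0 < snd i" using D(2) by blast
      have "q * (2 * snd i) \<le> g (fst i + snd i) - g (fst i - snd i)" using D(2) i by auto
      then show "ennreal q * emeasure lborel (cball (fst i) (snd i)) \<le> emeasure \<mu> (cball (fst i) (snd i))"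
        using r pq \<open>0 \<le> q\<close> by (simp add: mu_cball leb_cball ennreal_mult[symmetric] ennreal_leI)
    qed
    also have "\<dots> = emeasure \<mu> ?D"
      using D(1,3) sets_mu by (subst emeasure_UN_countable) auto
    also have "\<dots> \<le> emeasure \<mu> ?C"
    proof (rule emeasure_mono)
      have "?D \<subseteq> H" using D(2) by blast
      also have "H \<subseteq> ?C" unfolding H_def by (intro UN_mono ball_subset_cball order_refl)
      finally show "?D \<subseteq> ?C" .
    qed (use bC sets_mu in simp)
    also have "\<dots> = (\<integral>\<^sup>+i. emeasure \<mu> (cball (fst i) (snd i)) \<partial>count_space C)"
      using C(1,3) sets_mu by (subst emeasure_UN_countable) auto
    also have "\<dots> \<le> (\<integral>\<^sup>+i. ennreal p * emeasure lborel (cball (fst i) (snd i)) \<partial>count_space C)"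
    proof (intro nn_integral_mono)
      fix i assume "i \<in> space (count_space C)"
      then have i: "i \<in> C" by simp
      then have r: "0 < snd i" using C(2) by blast
      have "p * (2 * snd i) \<ge> g (fst i + snd i) - g (fst i - snd i)" using C(2) i by auto
      then show "emeasure \<mu> (cball (fst i) (snd i)) \<le> ennreal p * emeasure lborel (cball (fst i) (snd i))"
        using r pq by (simp add: mu_cball leb_cball ennreal_mult[symmetric] ennreal_leI)
    qed
    also have "\<dots> = ennreal p * emeasure lborel ?C"
      using C(1,3) by (subst emeasure_UN_countable) (auto simp: nn_integral_cmult)
    also have "\<dots> \<le> ennreal p * emeasure lborel G"
      using C(2) G by (intro mult_left_mono emeasure_mono) auto
    finally show ?thesis using G by simp
  qed
  define m where "m = measure lebesgue E"
  have "0 \<le> m" by (simp add: m_def)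
  have em: "emeasure lebesgue E = ennreal m"
    unfolding m_def by (rule emeasure_eq_measure2[OF E])
  have less: "q * m \<le> p * (m + e)" if e: "e > 0" for e
  proof -
    obtain G where G: "open G" "E \<subseteq> G" "emeasure lebesgue (G - E) < ennreal e"
      using sets_lebesgue_outer_open[OF fmeasurableD[OF E] e] by metis
    have "emeasure lebesgue G = emeasure lebesgue (E \<union> (G - E))"
      using G by (metis Un_Diff_cancel sup.absorb_iff2)
    also have "\<dots> \<le> emeasure lebesgue E + emeasure lebesgue (G - E)"
      using E G by (intro emeasure_subadditive) (auto simp: fmeasurableD)
    also have "\<dots> \<le> ennreal m + ennreal e"
      using G em by (intro add_mono) auto
    finally have "emeasure lebesgue G \<le> ennreal (m + e)"
      using e \<open>0 \<le> m\<close> by simp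
    then have "ennreal p * emeasure lebesgue G \<le> ennreal p * ennreal (m + e)"
      by (rule mult_left_mono) simp
    from order_trans[OF main[OF G(1,2)] this] show ?thesis
      using e pq \<open>0 \<le> m\<close> \<open>0 \<le> q\<close>
      by (simp add: em ennreal_mult[symmetric] ennreal_le_iff del: ennreal_plus)
  qed
  have "q * m \<le> p * m + e" if "e > 0" for e
    using less[of "e / p"] less[of e] pq that by (cases "p = 0") (auto simp: distrib_left)
  then have "q * m \<le> p * m" by (rule field_le_epsilon)
  then have "m \<le> 0" using pq by (simp add: mult_le_cancel_right)
  then show ?thesis
    using em E by (simp add: negligible_iff_emeasure0 fmeasurableD ennreal_neg)
qed

text \<open>
  If a bounded real quantity has no limit, its lower and upper limits differ and can be separated by
  rationals.  There are only countably many such pairs, hence countably many exceptional sets below.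
\<close>

lemma not_convergent_gap:
  fixes Q :: "real \<Rightarrow> real"
  assumes F: "F \<noteq> bot" and bd: "\<forall>\<^sub>F h in F. \<bar>Q h\<bar> \<le> B" and no: "\<nexists>D. (Q \<longlongrightarrow> D) F"
  obtains p q :: rat where "p < q"
    "\<exists>\<^sub>F h in F. Q h < of_rat p" "\<exists>\<^sub>F h in F. of_rat q < Q h"
proof -
  define l where "l = Liminf F (\<lambda>h. ereal (Q h))"
  define u where "u = Limsup F (\<lambda>h. ereal (Q h))"
  have "l \<le> u" unfolding l_def u_def by (rule Liminf_le_Limsup[OF F])
  have "- ereal B \<le> l" unfolding l_def
    by (rule Liminf_bounded) (use bd in \<open>auto elim!: eventually_mono\<close>)
  moreover have "u \<le> ereal B" unfolding u_def
    by (rule Limsup_bounded) (use bd in \<open>auto elim!: eventually_mono\<close>)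
  ultimately have "\<bar>l\<bar> \<noteq> \<infinity>" using \<open>l \<le> u\<close> by auto
  then obtain L where L: "l = ereal L" by (cases l) auto
  have "l \<noteq> u"
  proof
    assume "l = u"
    then have "((\<lambda>h. ereal (Q h)) \<longlongrightarrow> ereal L) F"
      using tendsto_iff_Liminf_eq_Limsup[OF F] L l_def u_def by metis
    then show False using no by auto
  qed
  then have "l < u" using \<open>l \<le> u\<close> by auto
  then obtain p where p: "l < ereal (real_of_rat p)" "ereal (real_of_rat p) < u"
    using ereal_dense3 by blast
  obtain q where q: "ereal (real_of_rat p) < ereal (real_of_rat q)" "ereal (real_of_rat q) < u"
    using ereal_dense3[OF p(2)] by blast
  have "\<exists>\<^sub>F h in F. Q h < of_rat p"
  proof (rule ccontr)
    assume "\<not> ?thesis"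
    then have "\<forall>\<^sub>F h in F. ereal (real_of_rat p) \<le> ereal (Q h)"
      by (simp add: frequently_def not_less)
    then have "ereal (real_of_rat p) \<le> l" unfolding l_def by (rule Liminf_bounded)
    with p show False by simp
  qed
  moreover have "\<exists>\<^sub>F h in F. of_rat q < Q h"
  proof (rule ccontr)
    assume "\<not> ?thesis"
    then have "\<forall>\<^sub>F h in F. ereal (Q h) \<le> ereal (real_of_rat q)"
      by (simp add: frequently_def not_less)
    then have "u \<le> ereal (real_of_rat q)" unfolding u_def by (rule Limsup_bounded)
    with q show False by simp
  qed
  ultimately show thesis using that q(1) by (simp add: of_rat_less)
qed

text \<open>
  The points without derivative are covered by the countably many sets \<open>E n p q\<close> of points in a bounded
  interval at which difference quotients below \<open>p\<close> and above \<open>q\<close> occur at every scale.  These are Borel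
  sets because, for a fixed increment, the difference quotient is continuous in the point.
\<close>

lemma mono_lipschitz_AE_derivative:
  fixes g :: "real \<Rightarrow> real"
  assumes mono: "mono g" and lip: "L-lipschitz_on UNIV g"
  shows "AE x in lebesgue. \<exists>D. (g has_real_derivative D) (at x)"
proof -
  have cont: "continuous_on UNIV g" using lip by (rule lipschitz_on_continuous_on)
  define Q where "Q x h = (g (x + h) - g x) / h" for x h
  define E where "E n p q = {x. \<bar>x\<bar> < real n \<and>
      (\<forall>k::nat. \<exists>h. h \<noteq> 0 \<and> \<bar>h\<bar> < 1 / real (Suc k) \<and> Q x h < of_rat p) \<and>
      (\<forall>k::nat. \<exists>h. h \<noteq> 0 \<and> \<bar>h\<bar> < 1 / real (Suc k) \<and> of_rat q < Q x h)}" for n and p q :: rat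
  have contQ: "continuous_on UNIV (\<lambda>x. Q x h)" for h
    unfolding Q_def
    by (cases "h = 0") (auto intro!: continuous_intros continuous_on_compose2[OF cont] cont)
  have "negligible (E n p q)" if "p < q" for n p q
  proof (cases "p \<le> 0")
    case True
    have "0 \<le> Q x h" for x h
      using monoD[OF mono, of x "x + h"] monoD[OF mono, of "x + h" x]
      by (cases "h > 0") (auto simp: Q_def divide_nonpos_nonpos)
    then have "E n p q = {}"
      using True unfolding E_def by (auto simp: not_less intro!: exI[of _ 0])
        (meson of_rat_le_0_iff not_less order_trans)
    then show ?thesis by simp
  next
    case False
    have "E n p q = {-real n<..<real n} \<inter>
        (\<Inter>k. \<Union>h\<in>{h. h \<noteq> 0 \<and> \<bar>h\<bar> < 1 / real (Suc k)}. {x. Q x h < of_rat p}) \<inter>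
        (\<Inter>k. \<Union>h\<in>{h. h \<noteq> 0 \<and> \<bar>h\<bar> < 1 / real (Suc k)}. {x. of_rat q < Q x h})"
      unfolding E_def by (auto simp: abs_less_iff)
    also have "\<dots> \<in> sets borel"
      by (intro sets.Int sets.countable_INT'' borel_open open_UN ballI open_greaterThanLessThan
          open_Collect_less contQ continuous_on_const) auto
    finally have "E n p q \<in> sets borel" .
    then have "E n p q \<in> lmeasurable"
      by (intro bounded_set_imp_lmeasurable)
        (auto simp: E_def bounded_real sets_completionI_sets intro!: exI[of _ "real n"])
    moreover have step: "\<exists>k. 1 / real (Suc k) < d" if "0 < d" for d :: real
      using nat_approx_posE[OF that] by metis
    show ?thesis
    proof (rule derivate_gap_negligible[OF mono cont calculation, of "of_rat p" "of_rat q"])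
      show "0 \<le> real_of_rat p" "real_of_rat p < real_of_rat q"
        using False that by (auto simp: of_rat_less)
      show "\<exists>h. h \<noteq> 0 \<and> \<bar>h\<bar> < d \<and> (g (x + h) - g x) / h < real_of_rat p"
        if "x \<in> E n p q" "0 < d" for x d
        using that step[OF that(2)] unfolding E_def Q_def by (auto; meson order.strict_trans)
      show "\<exists>h. h \<noteq> 0 \<and> \<bar>h\<bar> < d \<and> real_of_rat q < (g (x + h) - g x) / h"
        if "x \<in> E n p q" "0 < d" for x d
        using that step[OF that(2)] unfolding E_def Q_def by (auto; meson order.strict_trans)
    qed
  qed
  then have "negligible (\<Union>i\<in>{(n, p, q). p < q}. case i of (n, p, q) \<Rightarrow> E n p q)"
    by (intro negligible_countable_Union) auto
  moreover have "{x. \<nexists>D. (g has_real_derivative D) (at x)}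
      \<subseteq> (\<Union>i\<in>{(n, p, q). p < q}. case i of (n, p, q) \<Rightarrow> E n p q)"
  proof
    fix x assume "x \<in> {x. \<nexists>D. (g has_real_derivative D) (at x)}"
    then have no: "\<nexists>D. ((\<lambda>h. Q x h) \<longlongrightarrow> D) (at 0)"
      by (simp add: DERIV_def Q_def)
    have "\<bar>Q x h\<bar> \<le> L" if "h \<noteq> 0" for h
      using lipschitz_onD[OF lip, of "x + h" x] that
      by (simp add: Q_def dist_real_def field_simps abs_divide)
    then have "\<forall>\<^sub>F h in at 0. \<bar>Q x h\<bar> \<le> L"
      by (auto simp: eventually_at intro!: exI[of _ 1])
    then obtain p q :: rat where pq: "p < q"
      "\<exists>\<^sub>F h in at 0. Q x h < of_rat p" "\<exists>\<^sub>F h in at 0. of_rat q < Q x h"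
      using not_convergent_gap[OF _ _ no, of L] by auto
    obtain n where "\<bar>x\<bar> < real n" using reals_Archimedean2 by blast
    have "x \<in> E n p q"
      using pq(2,3) \<open>\<bar>x\<bar> < real n\<close> unfolding E_def
      by (auto simp: frequently_at)
    then show "x \<in> (\<Union>i\<in>{(n, p, q). p < q}. case i of (n, p, q) \<Rightarrow> E n p q)"
      using pq(1) by blast
  qed
  ultimately have "negligible {x. \<nexists>D. (g has_real_derivative D) (at x)}"
    using negligible_subset by blast
  then show ?thesis
    by (auto simp: negligible_iff_null_sets intro!: AE_I')
qed

lemma locally_lipschitz_bounded_lipschitz:
  assumes "locally_lipschitz F" "compact K"
  obtains L where "L-lipschitz_on K F"
proof -
  have "local_lipschitz {0::real} K (\<lambda>_. F)"
    using assms(1) unfolding locally_lipschitz_def by (rule local_lipschitz_subset) auto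
  from local_lipschitz_compact_implies_lipschitz[OF this assms(2)] show thesis
    using that by auto
qed

text \<open>
  Clamping the argument to a bounded interval makes a component globally Lipschitz, and adding a linear
  function of slope \<open>L\<close> makes it monotone.
\<close>

lemma locally_lipschitz_AE_derivative:
  fixes F :: "real \<Rightarrow> real ^ 'n"
  assumes "locally_lipschitz F"
  shows "AE t in lebesgue. \<exists>D. ((\<lambda>r. F r $ i) has_real_derivative D) (at t)"
proof -
  have "AE t in lebesgue. \<bar>t\<bar> < real n \<longrightarrow> (\<exists>D. ((\<lambda>r. F r $ i) has_real_derivative D) (at t))" for n
  proof -
    let ?c = "\<lambda>t. max (- real n) (min (real n) t)"
    obtain L where L: "L-lipschitz_on {- real n..real n} F"
      using locally_lipschitz_bounded_lipschitz[OF assms] by blast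
    define h where "h t = F (?c t) $ i" for t
    have hL: "\<bar>h x - h y\<bar> \<le> L * \<bar>x - y\<bar>" for x y
    proof -
      have "\<bar>h x - h y\<bar> \<le> norm (F (?c x) - F (?c y))"
        unfolding h_def using component_le_norm_cart[of "F (?c x) - F (?c y)" i] by simp
      also have "\<dots> \<le> L * \<bar>?c x - ?c y\<bar>"
        using lipschitz_onD[OF L, of "?c x" "?c y"] by (simp add: dist_norm)
      also have "\<dots> \<le> L * \<bar>x - y\<bar>"
        by (intro mult_left_mono lipschitz_on_nonneg[OF L]) (auto simp: max_def min_def)
      finally show ?thesis .
    qed
    have "L \<ge> 0" by (rule lipschitz_on_nonneg[OF L])
    define g where "g t = h t + L * t" for t
    have "mono g"
    proof (rule monoI)
      fix x y :: real assume "x \<le> y"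
      then show "g x \<le> g y" using hL[of x y] by (simp add: g_def abs_le_iff algebra_simps)
    qed
    moreover have "(2 * L)-lipschitz_on UNIV g"
    proof (rule lipschitz_onI)
      fix x y :: real
      have "\<bar>g x - g y\<bar> \<le> \<bar>h x - h y\<bar> + \<bar>L * (x - y)\<bar>"
        unfolding g_def by (simp add: algebra_simps)
      also have "\<dots> \<le> L * \<bar>x - y\<bar> + L * \<bar>x - y\<bar>"
        using hL[of x y] \<open>L \<ge> 0\<close> by (simp add: abs_mult)
      finally show "dist (g x) (g y) \<le> 2 * L * dist x y"
        by (simp add: dist_real_def algebra_simps)
    qed (use \<open>L \<ge> 0\<close> in simp)
    ultimately have "AE t in lebesgue. \<exists>D. (g has_real_derivative D) (at t)"
      by (rule mono_lipschitz_AE_derivative)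
    then show ?thesis
    proof (rule AE_mp, intro AE_I2 impI)
      fix t assume "\<exists>D. (g has_real_derivative D) (at t)" and t: "\<bar>t\<bar> < real n"
      then obtain D where "(g has_real_derivative D) (at t)" by blast
      then have "((\<lambda>r. g r - L * r) has_real_derivative D - L) (at t)"
        by (auto intro!: derivative_eq_intros)
      moreover have "\<forall>\<^sub>F r in nhds t. g r - L * r = F r $ i"
      proof -
        have "\<forall>\<^sub>F r in nhds t. r \<in> {- real n<..<real n}"
          using t by (intro eventually_nhds_in_open) auto
        then show ?thesis by eventually_elim (simp add: g_def h_def)
      qed
      ultimately have "((\<lambda>r. F r $ i) has_real_derivative D - L) (at t)"
        by (rule DERIV_cong_ev[OF refl _ refl, THEN iffD1, rotated])
      then show "\<exists>D. ((\<lambda>r. F r $ i) has_real_derivative D) (at t)" by blast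
    qed
  qed
  then have "AE t in lebesgue. \<forall>n. \<bar>t\<bar> < real n \<longrightarrow> (\<exists>D. ((\<lambda>r. F r $ i) has_real_derivative D) (at t))"
    by (intro AE_all_countable[THEN iffD2] allI)
  then show ?thesis
    by (rule AE_mp) (intro AE_I2 impI, meson reals_Archimedean2)
qed

section \<open>A smooth bump function with a second-order Taylor bound\<close>

text \<open>
  \<open>flat 0\<close> is the classical smooth function \<open>exp (- 1 / t)\<close> that is flat at the origin; the extra powers
  of \<open>1 / t\<close> make the family closed under differentiation up to linear combinations.
\<close>

definition flat :: "nat \<Rightarrow> real \<Rightarrow> real" where
  "flat j t = (if t \<le> 0 then 0 else exp (- inverse t) * inverse t ^ j)"

lemma flat_nonneg: "0 \<le> flat j t"
  by (simp add: flat_def)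

lemma flat_has_derivative:
  "(flat j has_real_derivative (flat (j + 2) t - real j * flat (j + 1) t)) (at t)"
proof -
  consider "t < 0" | "t = 0" | "t > 0" by linarith
  then show ?thesis
  proof cases
    case 1
    then have "\<forall>\<^sub>F s in nhds t. 0 = flat j s"
      using eventually_nhds_in_open[of "{..<0}" t]
      by (auto elim!: eventually_mono simp: flat_def)
    from DERIV_cong_ev[OF refl this refl, of 0] have "(flat j has_real_derivative 0) (at t)"
      by simp
    with 1 show ?thesis by (simp add: flat_def)
  next
    case 2
    have "((\<lambda>h::real. (inverse h) ^ (j + 1) / exp (inverse h)) \<longlongrightarrow> 0) (at_right 0)"
      using filterlim_compose[OF tendsto_power_div_exp_0[of "j + 1"] filterlim_inverse_at_top_right] .
    moreover have "\<forall>\<^sub>F h in at_right 0. (inverse h) ^ (j + 1) / exp (inverse h) = flat j h / h"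
      using eventually_at_right_less[of 0]
      by eventually_elim (simp add: flat_def exp_minus divide_inverse mult_ac)
    ultimately have R: "((\<lambda>h. flat j h / h) \<longlongrightarrow> 0) (at_right 0)"
      by (rule Lim_transform_eventually)
    have "((\<lambda>h. flat j h / h) \<longlongrightarrow> 0) (at_left 0)"
      by (rule tendsto_eventually) (auto simp: eventually_at_filter flat_def intro!: always_eventually)
    with R have "((\<lambda>h. flat j h / h) \<longlongrightarrow> 0) (at 0)"
      by (simp add: filterlim_split_at)
    then show ?thesis
      using 2 by (simp add: DERIV_def flat_def)
  next
    case 3
    then have ev: "\<forall>\<^sub>F s in nhds t. exp (- inverse s) * inverse s ^ j = flat j s"
      using eventually_nhds_in_open[of "{0<..}" t]
      by (auto elim!: eventually_mono simp: flat_def)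
    have "((\<lambda>s. exp (- inverse s) * inverse s ^ j) has_real_derivative
        exp (- inverse t) * (inverse t * inverse t) * inverse t ^ j +
        real j * inverse t ^ (j - 1) * (- (inverse t * inverse t)) * exp (- inverse t)) (at t)"
      using 3 by (auto intro!: derivative_eq_intros simp: mult_ac)
    also have "exp (- inverse t) * (inverse t * inverse t) * inverse t ^ j +
        real j * inverse t ^ (j - 1) * (- (inverse t * inverse t)) * exp (- inverse t) =
        flat (j + 2) t - real j * flat (j + 1) t"
      using 3 by (cases j) (simp_all add: flat_def algebra_simps)
    finally have "((\<lambda>s. exp (- inverse s) * inverse s ^ j) has_real_derivative
        (flat (j + 2) t - real j * flat (j + 1) t)) (at t)" .
    then show ?thesis
      by (rule DERIV_cong_ev[OF refl ev refl, THEN iffD1])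
  qed
qed

lemma continuous_flat: "continuous_on UNIV (flat j)"
  using flat_has_derivative by (intro continuous_at_imp_continuous_on) (blast intro: DERIV_isCont)

lemma flat_bounded: obtains B where "0 \<le> B" "\<And>t. t \<le> T \<Longrightarrow> flat j t \<le> B"
proof -
  have "bounded (flat j ` {0..T})"
    by (intro compact_imp_bounded compact_continuous_image continuous_on_subset[OF continuous_flat]) auto
  then obtain B where B: "\<forall>t\<in>{0..T}. \<bar>flat j t\<bar> \<le> B"
    unfolding bounded_iff by auto
  have "flat j t \<le> max B 0" if "t \<le> T" for t
    using B[rule_format, of t] that by (cases "0 \<le> t") (auto simp: flat_def)
  then show thesis using that[of "max B 0"] by auto
qed

text \<open>
  A set of functions that is closed under directional derivatives consists of functions of class \<open>C\<^sup>k\<close> for every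
  \<open>k\<close>.  The algebra generated below is such a set and contains the translates of the bump.
\<close>

inductive_set bump_algebra :: "('a::euclidean_space \<Rightarrow> real) set" where
  const: "(\<lambda>_. c) \<in> bump_algebra"
| coord: "(\<lambda>x. x \<bullet> v) \<in> bump_algebra"
| add: "f \<in> bump_algebra \<Longrightarrow> g \<in> bump_algebra \<Longrightarrow> (\<lambda>x. f x + g x) \<in> bump_algebra"
| mult: "f \<in> bump_algebra \<Longrightarrow> g \<in> bump_algebra \<Longrightarrow> (\<lambda>x. f x * g x) \<in> bump_algebra"
| flat: "(\<lambda>x. flat j (T - (x - y) \<bullet> (x - y))) \<in> bump_algebra"

text \<open>
  The only case beyond the sum and product rules is the last generator, whose derivative involves the next two members of the family \<open>flat\<close>.
\<close>

lemma bump_algebra_derivative: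
  assumes "f \<in> bump_algebra"
  shows "\<exists>D. (\<forall>x. (f has_derivative (\<lambda>v. D v x)) (at x)) \<and> (\<forall>v. D v \<in> bump_algebra)"
  using assms
proof induction
  case (const c)
  then show ?case
    by (intro exI[of _ "\<lambda>v x. 0"]) (auto intro!: bump_algebra.intros derivative_eq_intros)
next
  case (coord v)
  then show ?case
    by (intro exI[of _ "\<lambda>w x. w \<bullet> v"]) (auto intro!: bump_algebra.intros derivative_eq_intros)
next
  case (add f g)
  then obtain D D' where
    "\<And>x. (f has_derivative (\<lambda>v. D v x)) (at x)" "\<And>v. D v \<in> bump_algebra"
    "\<And>x. (g has_derivative (\<lambda>v. D' v x)) (at x)" "\<And>v. D' v \<in> bump_algebra"
    by blast
  then show ?case
    by (intro exI[of _ "\<lambda>v x. D v x + D' v x"])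
      (auto intro!: bump_algebra.add derivative_eq_intros)
next
  case (mult f g)
  then obtain D D' where
    D: "\<And>x. (f has_derivative (\<lambda>v. D v x)) (at x)" "\<And>v. D v \<in> bump_algebra"
    "\<And>x. (g has_derivative (\<lambda>v. D' v x)) (at x)" "\<And>v. D' v \<in> bump_algebra"
    by blast
  have "((\<lambda>x. f x * g x) has_derivative (\<lambda>v. f x * D' v x + D v x * g x)) (at x)" for x
    using D by (auto intro!: has_derivative_mult)
  moreover have "(\<lambda>x. f x * D' v x + D v x * g x) \<in> bump_algebra" for v
    using D mult.hyps by (intro bump_algebra.add bump_algebra.mult)
  ultimately show ?case
    by (intro exI[of _ "\<lambda>v x. f x * D' v x + D v x * g x"]) auto
next
  case (flat j T y)
  let ?q = "\<lambda>x. T - (x - y) \<bullet> (x - y)"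
  let ?D = "\<lambda>v x. (flat (j + 2) (?q x) + (- real j) * flat (j + 1) (?q x)) *
    ((- 2) * (x \<bullet> v) + 2 * (y \<bullet> v))"
  have "((\<lambda>x. flat j (?q x)) has_derivative (\<lambda>v. ?D v x)) (at x)" for x
  proof -
    have "(?q has_derivative (\<lambda>v. (- 2) * (x \<bullet> v) + 2 * (y \<bullet> v))) (at x)"
      by (auto intro!: derivative_eq_intros simp: fun_eq_iff inner_diff inner_commute algebra_simps)
    from has_derivative_compose[OF this flat_has_derivative[of j "?q x", unfolded has_field_derivative_def]]
    show ?thesis by simp
  qed
  moreover have "?D v \<in> bump_algebra" for v
    by (intro bump_algebra.add bump_algebra.mult bump_algebra.const bump_algebra.flat bump_algebra.coord)
  ultimately show ?case
    by (intro exI[of _ ?D]) blast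
qed

lemma bump_algebra_C_k: "f \<in> bump_algebra \<Longrightarrow> C_k k f"
proof (induction k arbitrary: f)
  case 0
  then obtain D where "\<And>x. (f has_derivative (\<lambda>v. D v x)) (at x)"
    using bump_algebra_derivative by blast
  then show ?case
    by (auto intro!: continuous_at_imp_continuous_on has_derivative_continuous)
next
  case (Suc k)
  obtain D where D: "\<And>x. (f has_derivative (\<lambda>v. D v x)) (at x)" "\<And>v. D v \<in> bump_algebra"
    using bump_algebra_derivative[OF Suc.prems] by blast
  have "(\<lambda>x. frechet_derivative f (at x) v) = D v" for v
    by (rule ext) (simp flip: frechet_derivative_at[OF D(1)])
  then show ?case
    using D Suc.IH by (auto simp: differentiable_def)
qed

text \<open>
  The integral of the bump is not scaled to one: it enters all estimates as a common positive factor.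
\<close>

definition mollifier :: "real \<Rightarrow> 'a::euclidean_space \<Rightarrow> real" where
  "mollifier e x = flat 0 (e\<^sup>2 - x \<bullet> x)"

definition mollifier_grad :: "real \<Rightarrow> 'a::euclidean_space \<Rightarrow> 'a" where
  "mollifier_grad e x = (- 2 * flat 2 (e\<^sup>2 - x \<bullet> x)) *\<^sub>R x"

lemma mollifier_nonneg: "0 \<le> mollifier e x"
  by (simp add: mollifier_def flat_nonneg)

lemma mollifier_minus: "mollifier e (- x) = mollifier e x"
  by (simp add: mollifier_def)

lemma mollifier_grad_minus: "mollifier_grad e (- x) = - mollifier_grad e x"
  by (simp add: mollifier_grad_def)

lemma outside_ball_iff: "0 \<le> e \<Longrightarrow> e \<le> norm x \<longleftrightarrow> e\<^sup>2 - x \<bullet> x \<le> 0"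
  using abs_le_square_iff[of e "norm x"] by (simp add: dot_square_norm)

lemma mollifier_eq_0_iff: "0 \<le> e \<Longrightarrow> mollifier e x = 0 \<longleftrightarrow> e \<le> norm x"
  by (simp add: outside_ball_iff mollifier_def flat_def)

lemma mollifier_grad_eq_0: "0 \<le> e \<Longrightarrow> e \<le> norm x \<Longrightarrow> mollifier_grad e x = 0"
  by (simp add: outside_ball_iff mollifier_grad_def flat_def)

lemma mollifier_has_derivative:
  "(mollifier e has_derivative (\<lambda>v. mollifier_grad e x \<bullet> v)) (at x)"
proof -
  have "((\<lambda>x. e\<^sup>2 - x \<bullet> x) has_derivative (\<lambda>v. - 2 * (x \<bullet> v))) (at x)"
    by (auto intro!: derivative_eq_intros simp: fun_eq_iff inner_commute)
  from has_derivative_compose[OF this flat_has_derivative[of 0, unfolded has_field_derivative_def]]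
  show ?thesis by (simp add: mollifier_def[abs_def] mollifier_grad_def mult_ac numeral_2_eq_2)
qed

lemma mollifier_shift_has_derivative:
  "((\<lambda>x. mollifier e (x - y)) has_derivative (\<lambda>v. mollifier_grad e (x - y) \<bullet> v)) (at x)"
proof -
  have "((\<lambda>x. x - y) has_derivative (\<lambda>v. v)) (at x)"
    by (auto intro!: derivative_eq_intros)
  from has_derivative_compose[OF this mollifier_has_derivative] show ?thesis by simp
qed

lemma grad_mollifier_shift:
  fixes y :: "real ^ 'n"
  shows "grad (\<lambda>x. mollifier e (x - y)) x = mollifier_grad e (x - y)"
  unfolding grad_def
  by (simp add: vec_eq_iff inner_axis flip: frechet_derivative_at[OF mollifier_shift_has_derivative])

lemma test_function_mollifier_shift:
  assumes "0 \<le> e"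
  shows "test_function (\<lambda>x. mollifier e (x - y))"
proof -
  have "(\<lambda>x. mollifier e (x - y)) \<in> bump_algebra"
    unfolding mollifier_def by (rule bump_algebra.flat)
  moreover have "{x. mollifier e (x - y) \<noteq> 0} \<subseteq> cball y e"
    using assms by (auto simp: mollifier_eq_0_iff dist_norm norm_minus_commute)
  then have "bounded {x. mollifier e (x - y) \<noteq> 0}"
    using bounded_cball bounded_subset by blast
  ultimately show ?thesis
    unfolding test_function_def by (auto intro: bump_algebra_C_k)
qed

lemma continuous_mollifier: "continuous_on UNIV (mollifier e)"
  by (intro continuous_at_imp_continuous_on ballI has_derivative_continuous[OF mollifier_has_derivative])

lemma continuous_mollifier_grad: "continuous_on UNIV (mollifier_grad e)"
  unfolding mollifier_grad_def[abs_def]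
  by (intro continuous_intros continuous_on_compose2[OF continuous_flat]) auto

lemma integrable_continuous_support:
  fixes m :: "'a::euclidean_space \<Rightarrow> 'b::{banach, second_countable_topology}"
  assumes "continuous_on UNIV m" and supp: "\<And>x. e \<le> norm x \<Longrightarrow> m x = 0"
  shows "integrable lborel m"
proof -
  have "integrable lborel (\<lambda>x. indicator (cball 0 e) x *\<^sub>R m x)"
    by (intro borel_integrable_compact continuous_on_subset[OF assms(1)]) auto
  also have "(\<lambda>x. indicator (cball 0 e) x *\<^sub>R m x) = m"
    using supp by (auto simp: fun_eq_iff indicator_def)
  finally show ?thesis .
qed

lemma integrable_mollifier: "0 \<le> e \<Longrightarrow> integrable lborel (mollifier e)"
  by (rule integrable_continuous_support[OF continuous_mollifier, of e]) (simp add: mollifier_eq_0_iff)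

lemma integrable_mollifier_grad: "0 \<le> e \<Longrightarrow> integrable lborel (mollifier_grad e)"
  by (rule integrable_continuous_support[OF continuous_mollifier_grad, of e]) (simp add: mollifier_grad_eq_0)

lemma integral_mollifier_pos:
  assumes "0 < e"
  shows "0 < (LINT x|lborel. mollifier e (x :: 'a::euclidean_space))"
proof (rule ccontr)
  assume "\<not> ?thesis"
  moreover have "0 \<le> (LINT x|lborel. mollifier e (x :: 'a))"
    by (intro integral_nonneg_AE AE_I2 mollifier_nonneg)
  ultimately have "(LINT x|lborel. mollifier e (x :: 'a)) = 0" by linarith
  then have "AE x in lborel. mollifier e (x :: 'a) = 0"
    using integral_nonneg_eq_0_iff_AE[OF integrable_mollifier, of e] assms mollifier_nonneg
    by (auto simp: less_imp_le)
  moreover have "{x::'a. mollifier e x \<noteq> 0} = ball 0 e"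
    using assms by (auto simp: mollifier_eq_0_iff)
  ultimately have "emeasure lborel (ball (0::'a) e) = 0"
    by (subst (asm) AE_iff_measurable[OF _ refl]) auto
  then have "measure lborel (ball (0::'a) e) = 0" by (simp add: measure_def)
  then show False using content_ball_pos[OF assms, of "0::'a"] by simp
qed

lemma mollifier_bounded:
  fixes e :: real
  obtains B where "0 \<le> B" "\<And>x::'a::euclidean_space. mollifier e x \<le> B"
proof -
  obtain B where "0 \<le> B" "\<And>t. t \<le> e\<^sup>2 \<Longrightarrow> flat 0 t \<le> B" using flat_bounded by blast
  then show thesis using that[of B] by (auto simp: mollifier_def)
qed

lemma mollifier_grad_lipschitz:
  fixes e :: real
  assumes "0 \<le> e"
  obtains M where "0 \<le> M"
    "\<And>x y :: 'a::euclidean_space. norm (mollifier_grad e x - mollifier_grad e y) \<le> M * norm (x - y)"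
proof -
  obtain A where A: "0 \<le> A" "\<And>t. t \<le> e\<^sup>2 \<Longrightarrow> flat 2 t \<le> A" using flat_bounded by blast
  obtain B where B: "0 \<le> B" "\<And>t. t \<le> e\<^sup>2 \<Longrightarrow> flat 3 t \<le> B" using flat_bounded by blast
  obtain C where C: "0 \<le> C" "\<And>t. t \<le> e\<^sup>2 \<Longrightarrow> flat 4 t \<le> C" using flat_bounded by blast
  define M where "M = 4 * (C + 2 * B) * e\<^sup>2 + 2 * A"
  let ?q = "\<lambda>x::'a. e\<^sup>2 - x \<bullet> x"
  let ?D = "\<lambda>x v. (- 2 * flat 2 (?q x)) *\<^sub>R v +
      (- 2 * ((flat 4 (?q x) - 2 * flat 3 (?q x)) * (- 2 * (x \<bullet> v)))) *\<^sub>R x"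
  have der: "(mollifier_grad e has_derivative ?D x) (at x)" for x
  proof -
    have "(?q has_derivative (\<lambda>v. - 2 * (x \<bullet> v))) (at x)"
      by (auto intro!: derivative_eq_intros simp: fun_eq_iff inner_commute)
    from has_derivative_compose[OF this flat_has_derivative[of 2, unfolded has_field_derivative_def]]
    have "((\<lambda>x. flat 2 (?q x)) has_derivative
        (\<lambda>v. (flat 4 (?q x) - 2 * flat 3 (?q x)) * (- 2 * (x \<bullet> v)))) (at x)"
      by (simp add: eval_nat_numeral)
    from has_derivative_scaleR[OF has_derivative_mult_right[OF this, of "- 2"] has_derivative_ident]
    show ?thesis by (simp add: mollifier_grad_def[abs_def])
  qed
  have bound: "norm (?D x v) \<le> M * norm v" for x v
  proof (cases "e \<le> norm x")
    case True
    then have "?D x v = 0"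
      using outside_ball_iff[OF assms, of x] by (simp add: flat_def)
    then show ?thesis using A B C by (simp add: M_def)
  next
    case False
    have q: "?q x \<le> e\<^sup>2" by simp
    have 1: "\<bar>flat 4 (?q x) - 2 * flat 3 (?q x)\<bar> \<le> C + 2 * B"
      using B(2)[OF q] C(2)[OF q] flat_nonneg[of 3 "?q x"] flat_nonneg[of 4 "?q x"] by linarith
    \<comment> \<open>Inside the ball the two factors of \<open>x\<close> in the second derivative cost at most \<open>e\<^sup>2\<close>.\<close>
    have 2: "\<bar>x \<bullet> v\<bar> * norm x \<le> e\<^sup>2 * norm v"
    proof -
      have "\<bar>x \<bullet> v\<bar> * norm x \<le> (norm x * norm v) * norm x"
        by (intro mult_right_mono Cauchy_Schwarz_ineq2) auto
      also have "\<dots> = (norm x)\<^sup>2 * norm v" by (simp add: power2_eq_square)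
      also have "\<dots> \<le> e\<^sup>2 * norm v"
        using False by (intro mult_right_mono power_mono) auto
      finally show ?thesis .
    qed
    have "norm (?D x v) \<le> 2 * flat 2 (?q x) * norm v +
        4 * (\<bar>flat 4 (?q x) - 2 * flat 3 (?q x)\<bar> * (\<bar>x \<bullet> v\<bar> * norm x))"
      by (rule order_trans[OF norm_triangle_ineq]) (simp add: abs_mult flat_nonneg)
    also have "\<dots> \<le> 2 * A * norm v + 4 * ((C + 2 * B) * (e\<^sup>2 * norm v))"
      by (intro add_mono mult_left_mono mult_right_mono mult_mono[OF 1 2] A(2) q) (use B C in auto)
    finally show ?thesis by (simp add: M_def algebra_simps)
  qed
  have "norm (mollifier_grad e x - mollifier_grad e y) \<le> M * norm (x - y)" for x y :: 'a
    by (rule differentiable_bound[of UNIV _ "?D"])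
      (rule convex_UNIV der onorm_le bound UNIV_I)+
  moreover have "0 \<le> M" using A B C by (simp add: M_def)
  ultimately show thesis using that by blast
qed

text \<open>
  Subtracting the linear part of the bump leaves a function whose derivative at distance \<open>t\<close> is at most
  \<open>M t\<close>.  The resulting factor \<open>\<bar>z\<bar>\<^sup>2\<close> is what makes the singular kernel integrable at the origin.
\<close>

lemma mollifier_taylor:
  fixes e :: real
  assumes "0 \<le> e"
  obtains M where "0 \<le> M"
    "\<And>w z :: 'a::euclidean_space.
      \<bar>mollifier e (w + z) - mollifier e w - mollifier_grad e w \<bullet> z\<bar> \<le> M * (norm z)\<^sup>2"
proof -
  obtain M where M: "0 \<le> M"
    "\<And>x y :: 'a. norm (mollifier_grad e x - mollifier_grad e y) \<le> M * norm (x - y)"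
    using mollifier_grad_lipschitz[OF assms] by blast
  have "\<bar>mollifier e (w + z) - mollifier e w - mollifier_grad e w \<bullet> z\<bar> \<le> M * (norm z)\<^sup>2" for w z :: 'a
  proof -
    note [derivative_intros] = mollifier_shift_has_derivative[of e "- w", simplified]
    let ?h = "\<lambda>y. mollifier e (y + w) - mollifier_grad e w \<bullet> y"
    let ?D = "\<lambda>y v. (mollifier_grad e (y + w) - mollifier_grad e w) \<bullet> v"
    have "norm (?h z - ?h 0) \<le> (M * norm z) * norm (z - 0)"
    proof (rule differentiable_bound[of "cball 0 (norm z)" _ ?D])
      fix y :: 'a assume y: "y \<in> cball 0 (norm z)"
      show "(?h has_derivative ?D y) (at y within cball 0 (norm z))"
        by (rule has_derivative_at_withinI)
          (auto intro!: derivative_eq_intros simp: inner_diff_left)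
      have "norm (mollifier_grad e (y + w) - mollifier_grad e w) \<le> M * norm z"
        using M(2)[of "y + w" w] y mult_left_mono[OF _ M(1), of "norm y" "norm z"] by simp
      then show "onorm (?D y) \<le> M * norm z"
        by (intro onorm_le order_trans[OF Cauchy_Schwarz_ineq2[folded real_norm_def]]
            mult_right_mono) auto
    qed auto
    then show ?thesis
      by (simp add: power2_eq_square add.commute algebra_simps)
  qed
  with M(1) show thesis by (rule that)
qed

section \<open>Integrability of the fractional kernel\<close>

text \<open>
  The set \<open>S\<close> is covered by shells of outer radius \<open>R \<theta>\<^sup>k\<close> and half that inner radius.  On each shell the
  power is comparable to its value at the outer radius, so the integrals over the shells are dominated by a
  geometric series of ratio \<open>\<theta>\<^bsup>q+N\<^esup>\<close>.  Taking \<open>\<theta> = 2\<close> covers neighbourhoods of infinity,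
  \<open>\<theta> = 1/2\<close> neighbourhoods of the origin.
\<close>

lemma integrable_radial_powr:
  fixes R \<theta> q :: real
  assumes R: "0 < R" "0 < \<theta>" and ratio: "\<theta> powr (q + DIM('a)) < 1"
    and S: "S \<in> sets borel" "\<And>z::'a::euclidean_space. z \<in> S \<Longrightarrow> \<exists>k. R * \<theta> ^ k / 2 \<le> norm z \<and> norm z \<le> R * \<theta> ^ k"
  shows "integrable lborel (\<lambda>z::'a. indicator S z * norm z powr q)"
proof (rule integrableI_bounded)
  define A where "A k = {z::'a. R * \<theta> ^ k / 2 \<le> norm z \<and> norm z \<le> R * \<theta> ^ k}" for k
  define C where "C = max 1 (2 powr (- q))"
  define V where "V = unit_ball_vol (DIM('a))"
  have [measurable]: "S \<in> sets borel" by fact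
  have [measurable]: "A k \<in> sets borel" for k
    unfolding A_def by measurable
  have "V \<ge> 0" by (simp add: V_def)
  have "C \<ge> 0" by (simp add: C_def)
  have bnd: "norm z powr q \<le> C * (R * \<theta> ^ k) powr q" if "z \<in> A k" for z k
  proof (cases "q \<ge> 0")
    case True
    then have "norm z powr q \<le> (R * \<theta> ^ k) powr q"
      using that by (intro powr_mono2) (auto simp: A_def)
    also have "\<dots> \<le> C * (R * \<theta> ^ k) powr q"
      by (simp add: C_def mult_le_cancel_right1)
    finally show ?thesis .
  next
    case False
    then have "norm z powr q \<le> (R * \<theta> ^ k / 2) powr q"
      using that R by (intro powr_mono2') (auto simp: A_def)
    also have "\<dots> = 2 powr (- q) * (R * \<theta> ^ k) powr q"
      using R by (simp add: powr_divide powr_minus_divide)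
    also have "\<dots> \<le> C * (R * \<theta> ^ k) powr q"
      by (intro mult_right_mono) (auto simp: C_def)
    finally show ?thesis .
  qed
  define t where "t = \<theta> powr (q + DIM('a))"
  have shell: "(\<integral>\<^sup>+z. ennreal (indicator (A k) z * norm z powr q) \<partial>lborel)
      \<le> ennreal (C * V * R powr (q + DIM('a)) * t ^ k)" for k
  proof -
    have "(\<integral>\<^sup>+z. ennreal (indicator (A k) z * norm z powr q) \<partial>lborel)
        \<le> (\<integral>\<^sup>+z. ennreal (C * (R * \<theta> ^ k) powr q) * indicator (cball 0 (R * \<theta> ^ k)) (z::'a) \<partial>lborel)"
      using bnd by (intro nn_integral_mono) (auto simp: indicator_def A_def intro!: ennreal_leI)
    also have "\<dots> = ennreal (C * (R * \<theta> ^ k) powr q) * ennreal (V * (R * \<theta> ^ k) ^ DIM('a))"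
      using R by (simp add: nn_integral_cmult_indicator emeasure_cball V_def)
    also have "\<dots> = ennreal (C * V * ((R * \<theta> ^ k) powr q * (R * \<theta> ^ k) powr DIM('a)))"
      using R \<open>C \<ge> 0\<close> \<open>V \<ge> 0\<close> by (simp add: ennreal_mult[symmetric] powr_realpow mult_ac)
    also have "(R * \<theta> ^ k) powr q * (R * \<theta> ^ k) powr DIM('a) = R powr (q + DIM('a)) * t ^ k"
    proof -
      have "(R * \<theta> ^ k) powr q * (R * \<theta> ^ k) powr DIM('a) = (R * \<theta> ^ k) powr (q + DIM('a))"
        by (rule powr_add[symmetric])
      also have "\<dots> = R powr (q + DIM('a)) * (\<theta> powr real k) powr (q + DIM('a))"
        using R by (simp add: powr_mult powr_realpow)
      also have "(\<theta> powr real k) powr (q + DIM('a)) = t ^ k"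
        using R by (simp add: t_def powr_powr powr_power mult.commute)
      finally show ?thesis .
    qed
    finally show ?thesis by (simp add: mult_ac)
  qed
  have "(\<integral>\<^sup>+z. ennreal (norm (indicator S z * norm z powr q)) \<partial>lborel)
      \<le> (\<integral>\<^sup>+z. (\<Sum>k. ennreal (indicator (A k) z * norm z powr q)) \<partial>lborel)"
  proof (rule nn_integral_mono)
    fix z :: 'a
    show "ennreal (norm (indicator S z * norm z powr q))
        \<le> (\<Sum>k. ennreal (indicator (A k) z * norm z powr q))"
    proof (cases "z \<in> S")
      case True
      then obtain k where "z \<in> A k" using S(2) by (auto simp: A_def)
      then have "ennreal (norm (indicator S z * norm z powr q)) = (\<Sum>k\<in>{k}. ennreal (indicator (A k) z * norm z powr q))"
        using True by simp
      also have "\<dots> \<le> (\<Sum>k. ennreal (indicator (A k) z * norm z powr q))"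
        by (rule sum_le_suminf) auto
      finally show ?thesis .
    qed simp
  qed
  also have "\<dots> = (\<Sum>k. \<integral>\<^sup>+z. ennreal (indicator (A k) z * norm z powr q) \<partial>lborel)"
    by (rule nn_integral_suminf) measurable
  also have "\<dots> \<le> (\<Sum>k. ennreal (C * V * R powr (q + DIM('a)) * t ^ k))"
    by (intro suminf_le shell summableI)
  also have "\<dots> = ennreal (\<Sum>k. C * V * R powr (q + DIM('a)) * t ^ k)"
    using ratio \<open>C \<ge> 0\<close> \<open>V \<ge> 0\<close>
    by (intro suminf_ennreal2 summable_mult summable_geometric) (auto simp: t_def)
  also have "\<dots> < \<infinity>" by simp
  finally show "(\<integral>\<^sup>+z. ennreal (norm (indicator S z * norm z powr q)) \<partial>lborel) < \<infinity>" .
qed (use S in measurable)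

definition far_kernel :: "real \<Rightarrow> real \<Rightarrow> 'a::euclidean_space \<Rightarrow> real" where
  "far_kernel s r z = indicator {z. r \<le> norm z} z * norm z powr (- (real DIM('a) + s))"

text \<open>
  The near kernel carries the factor \<open>\<bar>z\<bar>\<^sup>2\<close> that the Taylor remainder of a test function contributes.
\<close>

definition near_kernel :: "real \<Rightarrow> real \<Rightarrow> 'a::euclidean_space \<Rightarrow> real" where
  "near_kernel s r z = indicator {z. norm z \<le> r} z * norm z powr (2 - (real DIM('a) + s))"

lemma dyadic_shell_above:
  assumes "1 \<le> (t::real)"
  shows "\<exists>k. 2 ^ k \<le> t \<and> t \<le> 2 * 2 ^ k"
proof -
  define n where "n = nat \<lfloor>log 2 t\<rfloor>"
  have "0 \<le> log 2 t" using assms by simp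
  then have n: "real n \<le> log 2 t" "log 2 t \<le> real n + 1"
    by (auto simp: n_def of_nat_nat)
  have "2 powr real n \<le> 2 powr log 2 t" "2 powr log 2 t \<le> 2 powr (real n + 1)"
    using n by (auto intro: powr_mono)
  then have "2 ^ n \<le> t" "t \<le> 2 * 2 ^ n"
    using assms by (auto simp: powr_realpow powr_add)
  then show ?thesis by blast
qed

lemma integrable_far_kernel:
  assumes "0 < s" "0 < r"
  shows "integrable lborel (far_kernel s r :: 'a::euclidean_space \<Rightarrow> real)"
  unfolding far_kernel_def[abs_def]
proof (rule integrable_radial_powr[of "2 * r" 2])
  have "2 powr (- s) < (2::real) powr 0"
    using assms by (intro powr_less_mono) auto
  then show "2 powr (- (real DIM('a) + s) + real DIM('a)) < 1"
    by simp
  show "\<exists>k. 2 * r * 2 ^ k / 2 \<le> norm z \<and> norm z \<le> 2 * r * 2 ^ k" if "z \<in> {z. r \<le> norm z}" for z :: 'a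
    using dyadic_shell_above[of "norm z / r"] that assms by (auto simp: field_simps)
qed (use assms in auto)

lemma integrable_near_kernel:
  assumes "s < 2" "0 < r"
  shows "integrable lborel (near_kernel s r :: 'a::euclidean_space \<Rightarrow> real)"
proof -
  have "integrable lborel (\<lambda>z::'a. indicator ({z. norm z \<le> r} - {0}) z * norm z powr (2 - (real DIM('a) + s)))"
  proof (rule integrable_radial_powr[of r "1 / 2"])
    show "(1 / 2) powr (2 - (real DIM('a) + s) + real DIM('a)) < (1::real)"
      using assms by (simp add: powr01_less_one)
    show "\<exists>k. r * (1 / 2) ^ k / 2 \<le> norm z \<and> norm z \<le> r * (1 / 2) ^ k"
      if z: "z \<in> {z. norm z \<le> r} - {0}" for z :: 'a
    proof -
      obtain k where "2 ^ k \<le> r / norm z" "r / norm z \<le> 2 * 2 ^ k"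
        using dyadic_shell_above[of "r / norm z"] z by auto
      then show ?thesis
        using z assms by (intro exI[of _ k]) (simp add: divide_simps power_one_over mult_ac)
    qed
  qed (use assms in auto)
  also have "(\<lambda>z::'a. indicator ({z. norm z \<le> r} - {0}) z * norm z powr (2 - (real DIM('a) + s))) = near_kernel s r"
    by (auto simp: near_kernel_def indicator_def fun_eq_iff)
  finally show ?thesis .
qed

lemma near_kernel_mass_tendsto_0:
  assumes "s < 2"
  shows "(\<lambda>n. LINT z::'a::euclidean_space|lborel. near_kernel s (1 / real (Suc n)) z) \<longlonglongrightarrow> 0"
proof -
  have [measurable]: "near_kernel s r \<in> borel_measurable borel" for r
    unfolding near_kernel_def[abs_def] by measurable
  have "(\<lambda>n. LINT z::'a|lborel. near_kernel s (1 / real (Suc n)) z) \<longlonglongrightarrow> (LINT z::'a|lborel. 0)"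
  proof (rule integral_dominated_convergence[where w = "near_kernel s 1"])
    show "AE z in lborel. (\<lambda>n. near_kernel s (1 / real (Suc n)) (z::'a)) \<longlonglongrightarrow> 0"
    proof (rule AE_I2)
      fix z :: 'a
      show "(\<lambda>n. near_kernel s (1 / real (Suc n)) z) \<longlonglongrightarrow> 0"
      proof (cases "z = 0")
        case False
        then have "\<forall>\<^sub>F n in sequentially. 1 / real (Suc n) < norm z"
          using order_tendstoD(2)[OF LIMSEQ_Suc[OF lim_1_over_n], of "norm z"] by simp
        then show ?thesis
          by (intro tendsto_eventually) (auto elim!: eventually_mono simp: near_kernel_def)
      qed (simp add: near_kernel_def)
    qed
    show "AE z in lborel. norm (near_kernel s (1 / real (Suc n)) (z::'a)) \<le> near_kernel s 1 z" for n
    proof (rule AE_I2)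
      fix z :: 'a
      have "1 / real (Suc n) \<le> 1" by simp
      then have "norm z \<le> 1 / real (Suc n) \<Longrightarrow> norm z \<le> 1" by linarith
      then show "norm (near_kernel s (1 / real (Suc n)) z) \<le> near_kernel s 1 z"
        by (auto simp: near_kernel_def indicator_def)
    qed
    show "integrable lborel (near_kernel s 1 :: 'a \<Rightarrow> real)"
      by (rule integrable_near_kernel) (use assms in auto)
  qed simp_all
  then show ?thesis by simp
qed

section \<open>Shifts, convolutions and accretivity in \<open>L\<^sup>1\<close>\<close>

lemma lborel_distr_shift: "distr lborel borel (\<lambda>x::'a::euclidean_space. x + c) = lborel"
proof -
  have "(\<lambda>x. x + c) = (+) c" by (simp add: fun_eq_iff add.commute)
  then show ?thesis by (simp add: lborel_distr_plus)
qed

lemma lborel_distr_reflect: "distr lborel borel (\<lambda>x::'a::euclidean_space. c - x) = lborel"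
  using lborel_affine[of "- 1" c] by (simp add: density_1)

lemma
  fixes h :: "'a::euclidean_space \<Rightarrow> 'b::{banach, second_countable_topology}"
  assumes [measurable]: "h \<in> borel_measurable borel"
  shows integral_shift: "(LINT x|lborel. h (x + c)) = (LINT x|lborel. h x)"
    and integrable_shift_iff: "integrable lborel (\<lambda>x. h (x + c)) \<longleftrightarrow> integrable lborel h"
    and integral_reflect: "(LINT x|lborel. h (c - x)) = (LINT x|lborel. h x)"
    and integrable_reflect_iff: "integrable lborel (\<lambda>x. h (c - x)) \<longleftrightarrow> integrable lborel h"
  using integral_distr[of "\<lambda>x. x + c" lborel borel h] integrable_distr_eq[of "\<lambda>x. x + c" lborel borel h]
    integral_distr[of "\<lambda>x. c - x" lborel borel h] integrable_distr_eq[of "\<lambda>x. c - x" lborel borel h]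
  by (simp_all add: lborel_distr_shift lborel_distr_reflect)

lemma
  fixes h :: "'a::euclidean_space \<Rightarrow> 'b::{banach, second_countable_topology}"
  assumes [measurable]: "h \<in> borel_measurable borel"
  shows integral_shift_diff: "(LINT x|lborel. h (x - c)) = (LINT x|lborel. h x)"
    and integrable_shift_diff_iff: "integrable lborel (\<lambda>x. h (x - c)) \<longleftrightarrow> integrable lborel h"
  using integral_shift[OF assms, of "- c"] integrable_shift_iff[OF assms, of "- c"] by simp_all

text \<open>
  Integrability of the building blocks of convolutions, by Fubini and the invariance of Lebesgue measure
  under reflections and shifts.
\<close>

lemma integrable_product_fst_diff:
  fixes a m :: "'a::euclidean_space \<Rightarrow> real"
  assumes a: "integrable lborel a" and m: "integrable lborel m"
  shows "integrable (lborel \<Otimes>\<^sub>M lborel) (\<lambda>(x, y). a x * m (x - y))"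
proof (rule lborel_pair.Fubini_integrable)
  have [measurable]: "a \<in> borel_measurable borel" "m \<in> borel_measurable borel"
    using a m by auto
  show "(\<lambda>(x, y). a x * m (x - y)) \<in> borel_measurable (lborel \<Otimes>\<^sub>M lborel)"
    by measurable
  have "(LINT y|lborel. norm (case (x, y) of (x, y) \<Rightarrow> a x * m (x - y))) = \<bar>a x\<bar> * (LINT y|lborel. \<bar>m y\<bar>)" for x
    using integral_reflect[of "\<lambda>y. \<bar>m y\<bar>" x] by (simp add: abs_mult)
  then show "integrable lborel (\<lambda>x. LINT y|lborel. norm (case (x, y) of (x, y) \<Rightarrow> a x * m (x - y)))"
    using a by simp
  show "AE x in lborel. integrable lborel (\<lambda>y. case (x, y) of (x, y) \<Rightarrow> a x * m (x - y))"
    using m integrable_reflect_iff[of m] by (intro AE_I2) simp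
qed

lemma integrable_product_snd_diff:
  fixes a m :: "'a::euclidean_space \<Rightarrow> real"
  assumes a: "integrable lborel a" and m: "integrable lborel m"
  shows "integrable (lborel \<Otimes>\<^sub>M lborel) (\<lambda>(x, y). a y * m (x - y))"
proof -
  have [measurable]: "m \<in> borel_measurable borel" using m by simp
  have "integrable lborel (\<lambda>y. m (0 - y))"
    using m by (subst integrable_reflect_iff) auto
  from lborel_pair.integrable_product_swap[OF integrable_product_fst_diff[OF a this]]
  show ?thesis by (simp add: case_prod_beta)
qed

lemma integrable_product_tensor:
  fixes a m :: "'a::euclidean_space \<Rightarrow> real"
  assumes a: "integrable lborel a" and m: "integrable lborel m"
  shows "integrable (lborel \<Otimes>\<^sub>M lborel) (\<lambda>(x, y). a x * m y)"
proof (rule lborel_pair.Fubini_integrable)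
  have [measurable]: "a \<in> borel_measurable borel" "m \<in> borel_measurable borel"
    using a m by auto
  show "(\<lambda>(x, y). a x * m y) \<in> borel_measurable (lborel \<Otimes>\<^sub>M lborel)"
    by measurable
  show "integrable lborel (\<lambda>x. LINT y|lborel. norm (case (x, y) of (x, y) \<Rightarrow> a x * m y))"
    using a by (simp add: abs_mult)
  show "AE x in lborel. integrable lborel (\<lambda>y. case (x, y) of (x, y) \<Rightarrow> a x * m y)"
    using m by (intro AE_I2) simp
qed

lemma integrable_product_shift:
  fixes a m :: "'a::euclidean_space \<Rightarrow> real"
  assumes a: "integrable lborel a" and m: "integrable lborel m"
  shows "integrable (lborel \<Otimes>\<^sub>M lborel) (\<lambda>(x, z). a (x + z) * m z)"
proof -
  show ?thesis
  proof (rule lborel_pair.integrable_product_swap_iff[THEN iffD1], rule lborel_pair.Fubini_integrable)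
    have [measurable]: "a \<in> borel_measurable borel" "m \<in> borel_measurable borel" using a m by auto
    show "(\<lambda>(x, y). case (y, x) of (x, z) \<Rightarrow> a (x + z) * m z) \<in> borel_measurable (lborel \<Otimes>\<^sub>M lborel)"
      by measurable
    show "integrable lborel (\<lambda>z. LINT x|lborel. norm (case (z, x) of (x, y) \<Rightarrow> case (y, x) of (x, z) \<Rightarrow> a (x + z) * m z))"
      using m integral_shift[of "\<lambda>x. \<bar>a x\<bar>"] by (simp add: abs_mult)
    show "AE z in lborel. integrable lborel (\<lambda>x. case (z, x) of (x, y) \<Rightarrow> case (y, x) of (x, z) \<Rightarrow> a (x + z) * m z)"
      using a integrable_shift_iff[of a] by (intro AE_I2) simp
  qed
qed

text \<open>
  Pointwise \<open>sgn (d x) (d (x + z) - d x) \<le> \<bar>d (x + z)\<bar> - \<bar>d x\<bar>\<close>, and for every fixed \<open>z\<close> the right-hand side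
  integrates to zero over \<open>x\<close>.
\<close>

lemma jump_accretive:
  fixes d K :: "'a::euclidean_space \<Rightarrow> real"
  assumes d: "integrable lborel d" and K: "integrable lborel K" and "\<And>z. 0 \<le> K z"
  shows "integrable lborel (\<lambda>x. LINT z|lborel. (d (x + z) - d x) * K z)" (is ?int)
    and "(LINT x|lborel. sgn (d x) * (LINT z|lborel. (d (x + z) - d x) * K z)) \<le> 0" (is ?neg)
proof -
  have [measurable]: "d \<in> borel_measurable borel" using d by simp
  have abs_d: "integrable lborel (\<lambda>x. \<bar>d x\<bar>)" using d by simp
  have P: "integrable (lborel \<Otimes>\<^sub>M lborel) (\<lambda>(x, z). (d (x + z) - d x) * K z)"
    using Bochner_Integration.integrable_diff[OF integrable_product_shift[OF d K] integrable_product_tensor[OF d K]]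
    by (simp add: split_def left_diff_distrib)
  have Q: "integrable (lborel \<Otimes>\<^sub>M lborel) (\<lambda>(x, z). (\<bar>d (x + z)\<bar> - \<bar>d x\<bar>) * K z)"
    using Bochner_Integration.integrable_diff[OF integrable_product_shift[OF abs_d K] integrable_product_tensor[OF abs_d K]]
    by (simp add: split_def left_diff_distrib)
  show int: ?int
    by (rule lborel_pair.integrable_fst[OF P])
  have "(LINT x|lborel. sgn (d x) * (LINT z|lborel. (d (x + z) - d x) * K z))
      \<le> (LINT x|lborel. LINT z|lborel. (\<bar>d (x + z)\<bar> - \<bar>d x\<bar>) * K z)"
  proof (rule integral_mono_AE)
    show "integrable lborel (\<lambda>x. sgn (d x) * (LINT z|lborel. (d (x + z) - d x) * K z))"
    proof (rule Bochner_Integration.integrable_bound[OF int])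
      have [measurable]: "(\<lambda>x. LINT z|lborel. (d (x + z) - d x) * K z) \<in> borel_measurable borel"
        using int by simp
      show "(\<lambda>x. sgn (d x) * (LINT z|lborel. (d (x + z) - d x) * K z)) \<in> borel_measurable lborel"
        by measurable
      show "AE x in lborel. norm (sgn (d x) * (LINT z|lborel. (d (x + z) - d x) * K z))
          \<le> norm (LINT z|lborel. (d (x + z) - d x) * K z)"
        by (intro AE_I2) (simp add: abs_mult abs_sgn_eq)
    qed
    show "integrable lborel (\<lambda>x. LINT z|lborel. (\<bar>d (x + z)\<bar> - \<bar>d x\<bar>) * K z)"
      by (rule lborel_pair.integrable_fst[OF Q])
    show "AE x in lborel. sgn (d x) * (LINT z|lborel. (d (x + z) - d x) * K z)
        \<le> (LINT z|lborel. (\<bar>d (x + z)\<bar> - \<bar>d x\<bar>) * K z)"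
      using lborel_pair.AE_integrable_fst[OF P] lborel_pair.AE_integrable_fst[OF Q]
    proof eventually_elim
      case (elim x)
      have "sgn (d x) * (LINT z|lborel. (d (x + z) - d x) * K z)
          = (LINT z|lborel. sgn (d x) * ((d (x + z) - d x) * K z))" by simp
      also have "\<dots> \<le> (LINT z|lborel. (\<bar>d (x + z)\<bar> - \<bar>d x\<bar>) * K z)"
      proof (rule integral_mono[OF _ elim(2)])
        fix z
        have "sgn (d x) * (d (x + z) - d x) \<le> \<bar>d (x + z)\<bar> - \<bar>d x\<bar>"
          by (auto simp: sgn_if)
        from mult_right_mono[OF this assms(3)[of z]]
        show "sgn (d x) * ((d (x + z) - d x) * K z) \<le> (\<bar>d (x + z)\<bar> - \<bar>d x\<bar>) * K z"
          by (simp add: mult.assoc)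
      qed (use elim in auto)
      finally show ?case .
    qed
  qed
  also have "\<dots> = (LINT z|lborel. LINT x|lborel. (\<bar>d (x + z)\<bar> - \<bar>d x\<bar>) * K z)"
    by (rule lborel_pair.Fubini_integral[OF Q, symmetric])
  also have "\<dots> = (LINT z::'a|lborel. 0)"
  proof (rule Bochner_Integration.integral_cong[OF refl])
    fix z
    have "integrable lborel (\<lambda>x. \<bar>d (x + z)\<bar>)"
      using abs_d integrable_shift_iff[of "\<lambda>x. \<bar>d x\<bar>"] by simp
    then show "(LINT x|lborel. (\<bar>d (x + z)\<bar> - \<bar>d x\<bar>) * K z) = 0"
      using abs_d integral_shift[of "\<lambda>x. \<bar>d x\<bar>" z] by simp
  qed
  finally show ?neg by simp
qed

text \<open>
  Both indicators have the same integral, so the \<open>L\<^sup>1\<close> distance is twice the integral of the positive part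
  of their difference.  That part is dominated by the indicator of \<open>U\<close> and tends to zero pointwise because
  \<open>U\<close> is open.
\<close>

lemma L1_translation_open:
  fixes U :: "'a::euclidean_space set" and w :: "nat \<Rightarrow> 'a"
  assumes U: "open U" "emeasure lborel U < \<infinity>" and w: "w \<longlonglongrightarrow> 0"
  shows "(\<lambda>n. LINT x|lborel. \<bar>indicator U x - indicator U (x - w n) :: real\<bar>) \<longlonglongrightarrow> 0"
proof -
  let ?I = "indicator U :: 'a \<Rightarrow> real"
  have [measurable]: "U \<in> sets borel" using U by simp
  have intI: "integrable lborel ?I" using U by simp
  have intS: "integrable lborel (\<lambda>x. ?I (x - c))" for c
    using intI integrable_shift_diff_iff[of ?I c] by simp
  have eq: "(LINT x|lborel. \<bar>?I x - ?I (x - w n)\<bar>) = 2 * (LINT x|lborel. max 0 (?I x - ?I (x - w n)))" for n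
  proof -
    have "(LINT x|lborel. \<bar>?I x - ?I (x - w n)\<bar>)
        = (LINT x|lborel. 2 * max 0 (?I x - ?I (x - w n)) - (?I x - ?I (x - w n)))"
      by (rule Bochner_Integration.integral_cong) (auto simp: max_def abs_if)
    also have "\<dots> = 2 * (LINT x|lborel. max 0 (?I x - ?I (x - w n))) - ((LINT x|lborel. ?I x) - (LINT x|lborel. ?I (x - w n)))"
      using intI intS by (subst Bochner_Integration.integral_diff) auto
    also have "(LINT x|lborel. ?I (x - w n)) = (LINT x|lborel. ?I x)"
      by (rule integral_shift_diff) simp
    finally show ?thesis by simp
  qed
  have "(\<lambda>n. LINT x|lborel. max 0 (?I x - ?I (x - w n))) \<longlonglongrightarrow> (LINT x::'a|lborel. (0::real))"
  proof (rule integral_dominated_convergence[where w = ?I and f = "\<lambda>_. 0"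
        and s = "\<lambda>n x. max 0 (?I x - ?I (x - w n))"])
    show "AE x in lborel. (\<lambda>n. max 0 (?I x - ?I (x - w n))) \<longlonglongrightarrow> 0"
    proof (rule AE_I2)
      fix x
      show "(\<lambda>n. max 0 (?I x - ?I (x - w n))) \<longlonglongrightarrow> 0"
      proof (cases "x \<in> U")
        case True
        have "(\<lambda>n. x - w n) \<longlonglongrightarrow> x - 0" by (intro tendsto_intros w)
        then have "\<forall>\<^sub>F n in sequentially. x - w n \<in> U"
          using topological_tendstoD[OF _ U(1)] True by simp
        then show ?thesis by (intro tendsto_eventually) (auto elim!: eventually_mono)
      next
        case False
        then have "max 0 (?I x - ?I (x - w n)) = 0" for n by (auto simp: indicator_def)
        then show ?thesis by simp
      qed
    qed
  qed (use intI in \<open>auto simp: indicator_def\<close>)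
  then show ?thesis
    using tendsto_mult_left[of "\<lambda>n. LINT x|lborel. max 0 (?I x - ?I (x - w n))" 0 sequentially 2]
    by (simp add: eq)
qed

lemma L1_translation_triangle:
  fixes f g :: "'a::euclidean_space \<Rightarrow> real"
  assumes f: "integrable lborel f" and g: "integrable lborel g"
  shows "(LINT x|lborel. \<bar>f x - f (x - c)\<bar>)
    \<le> 2 * (LINT x|lborel. \<bar>f x - g x\<bar>) + (LINT x|lborel. \<bar>g x - g (x - c)\<bar>)"
proof -
  have [measurable]: "f \<in> borel_measurable borel" "g \<in> borel_measurable borel" using f g by auto
  have sh: "integrable lborel (\<lambda>x. f (x - c))" "integrable lborel (\<lambda>x. g (x - c))"
    using f g integrable_shift_diff_iff[of f c] integrable_shift_diff_iff[of g c] by auto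
  have "(LINT x|lborel. \<bar>f x - f (x - c)\<bar>)
      \<le> (LINT x|lborel. \<bar>f x - g x\<bar> + \<bar>g x - g (x - c)\<bar> + \<bar>f (x - c) - g (x - c)\<bar>)"
    using f g sh by (intro integral_mono) auto
  also have "\<dots> = (LINT x|lborel. \<bar>f x - g x\<bar>) + (LINT x|lborel. \<bar>g x - g (x - c)\<bar>)
      + (LINT x|lborel. \<bar>f (x - c) - g (x - c)\<bar>)"
    using f g sh by simp
  also have "(LINT x|lborel. \<bar>f (x - c) - g (x - c)\<bar>) = (LINT x|lborel. \<bar>f x - g x\<bar>)"
    using integral_shift_diff[of "\<lambda>x. \<bar>f x - g x\<bar>" c] by simp
  finally show ?thesis by simp
qed

text \<open>
  Functions whose translations are continuous form a closed subset of \<open>L\<^sup>1\<close>.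
\<close>

lemma L1_translation_approx:
  fixes f :: "'a::euclidean_space \<Rightarrow> real"
  assumes f: "integrable lborel f"
    and approx: "\<And>e. 0 < e \<Longrightarrow> \<exists>g. integrable lborel g \<and> (LINT x|lborel. \<bar>f x - g x\<bar>) < e \<and>
      (\<lambda>n. LINT x|lborel. \<bar>g x - g (x - w n)\<bar>) \<longlonglongrightarrow> 0"
  shows "(\<lambda>n. LINT x|lborel. \<bar>f x - f (x - w n)\<bar>) \<longlonglongrightarrow> 0"
proof (rule LIMSEQ_I)
  fix e :: real assume "0 < e"
  then obtain g where g: "integrable lborel g" "(LINT x|lborel. \<bar>f x - g x\<bar>) < e / 4"
    "(\<lambda>n. LINT x|lborel. \<bar>g x - g (x - w n)\<bar>) \<longlonglongrightarrow> 0"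
    using approx[of "e / 4"] by auto
  then have "\<forall>\<^sub>F n in sequentially. (LINT x|lborel. \<bar>g x - g (x - w n)\<bar>) < e / 2"
    using \<open>0 < e\<close> by (intro order_tendstoD(2)) auto
  then have "\<forall>\<^sub>F n in sequentially. norm ((LINT x|lborel. \<bar>f x - f (x - w n)\<bar>) - 0) < e"
  proof eventually_elim
    case (elim n)
    have "0 \<le> (LINT x|lborel. \<bar>f x - f (x - w n)\<bar>)" by simp
    then show ?case using L1_translation_triangle[OF f g(1), of "w n"] g(2) elim by simp
  qed
  then show "\<exists>no. \<forall>n\<ge>no. norm ((LINT x|lborel. \<bar>f x - f (x - w n)\<bar>) - 0) < e"
    by (simp add: eventually_sequentially)
qed

text \<open>
  Sets of finite measure are approximated by open sets, simple functions are combinations of their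
  indicators, and simple functions are dense.
\<close>

lemma L1_translation_sequence:
  fixes f :: "'a::euclidean_space \<Rightarrow> real"
  assumes f: "integrable lborel f" and w: "w \<longlonglongrightarrow> 0"
  shows "(\<lambda>n. LINT x|lborel. \<bar>f x - f (x - w n)\<bar>) \<longlonglongrightarrow> 0"
  using f
proof (induction rule: integrable_induct)
  case (base A c)
  then have A: "A \<in> sets borel" "emeasure lborel A < \<infinity>" by auto
  have "(\<lambda>n. LINT x|lborel. \<bar>indicator A x - indicator A (x - w n) :: real\<bar>) \<longlonglongrightarrow> 0"
  proof (rule L1_translation_approx)
    show "integrable lborel (indicator A :: 'a \<Rightarrow> real)" using A by simp
    fix e :: real assume "0 < e"
    obtain U where U: "open U" "A \<subseteq> U" "emeasure lborel (U - A) < ennreal e"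
      using outer_regular_lborel[OF A(1) \<open>0 < e\<close>] by blast
    have "emeasure lborel U = emeasure lborel (A \<union> (U - A))"
      using U by (simp add: Un_absorb1)
    also have "\<dots> \<le> emeasure lborel A + emeasure lborel (U - A)"
      using U A by (intro emeasure_subadditive) auto
    also have "\<dots> < \<infinity>"
      using U(3) A(2) by (auto simp: ennreal_add_less_top intro: order.strict_trans)
    finally have fin: "emeasure lborel U < \<infinity>" .
    have "(LINT x|lborel. \<bar>indicator A x - indicator U x :: real\<bar>) = (LINT x|lborel. indicator (U - A) x)"
      using U by (intro Bochner_Integration.integral_cong) (auto simp: indicator_def)
    also have "\<dots> = measure lborel (U - A)" using U A by simp
    also have "\<dots> < e"
    proof -
      have "emeasure lborel (U - A) \<noteq> top" using U(3) by (auto simp: top_unique)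
      from emeasure_eq_ennreal_measure[OF this] show ?thesis
        using U(3) by (simp add: ennreal_less_iff)
    qed
    finally show "\<exists>g. integrable lborel g \<and> (LINT x|lborel. \<bar>indicator A x - g x\<bar>) < e \<and>
        (\<lambda>n. LINT x|lborel. \<bar>g x - g (x - w n)\<bar>) \<longlonglongrightarrow> (0::real)"
      using L1_translation_open[OF U(1) fin w] U(1) fin
      by (intro exI[of _ "indicator U"]) auto
  qed
  moreover have "(LINT x|lborel. \<bar>indicator A x *\<^sub>R c - indicator A (x - w n) *\<^sub>R c\<bar>)
      = \<bar>c\<bar> * (LINT x|lborel. \<bar>indicator A x - indicator A (x - w n) :: real\<bar>)" for n
  proof -
    have "\<bar>indicator A x *\<^sub>R c - indicator A (x - w n) *\<^sub>R c\<bar>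
        = \<bar>c\<bar> * \<bar>indicator A x - indicator A (x - w n) :: real\<bar>" for x
      by (simp add: abs_mult[symmetric] right_diff_distrib mult.commute)
    then show ?thesis by simp
  qed
  ultimately show ?case
    using tendsto_mult_left[of _ 0 sequentially "\<bar>c\<bar>"] by simp
next
  case (add f g)
  then have int: "integrable lborel f" "integrable lborel g" by auto
  then have [measurable]: "f \<in> borel_measurable borel" "g \<in> borel_measurable borel" by auto
  have sh: "integrable lborel (\<lambda>x. f (x - c))" "integrable lborel (\<lambda>x. g (x - c))" for c
    using int integrable_shift_diff_iff[of f c] integrable_shift_diff_iff[of g c] by auto
  have le: "(LINT x|lborel. \<bar>f x + g x - (f (x - w n) + g (x - w n))\<bar>)
    \<le> (LINT x|lborel. \<bar>f x - f (x - w n)\<bar>) + (LINT x|lborel. \<bar>g x - g (x - w n)\<bar>)" for n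
  proof -
    have "(LINT x|lborel. \<bar>f x + g x - (f (x - w n) + g (x - w n))\<bar>)
      \<le> (LINT x|lborel. \<bar>f x - f (x - w n)\<bar> + \<bar>g x - g (x - w n)\<bar>)"
      using int sh by (intro integral_mono) auto
    also have "\<dots> = (LINT x|lborel. \<bar>f x - f (x - w n)\<bar>) + (LINT x|lborel. \<bar>g x - g (x - w n)\<bar>)"
      using int sh by (intro Bochner_Integration.integral_add) auto
    finally show ?thesis .
  qed
  have "(\<lambda>n. (LINT x|lborel. \<bar>f x - f (x - w n)\<bar>) + (LINT x|lborel. \<bar>g x - g (x - w n)\<bar>)) \<longlonglongrightarrow> 0 + 0"
    using add by (intro tendsto_add) auto
  then have "(\<lambda>n. (LINT x|lborel. \<bar>f x - f (x - w n)\<bar>) + (LINT x|lborel. \<bar>g x - g (x - w n)\<bar>)) \<longlonglongrightarrow> 0"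
    by simp
  moreover have "norm (LINT x|lborel. \<bar>f x + g x - (f (x - w n) + g (x - w n))\<bar>)
    \<le> (LINT x|lborel. \<bar>f x - f (x - w n)\<bar>) + (LINT x|lborel. \<bar>g x - g (x - w n)\<bar>)" for n
    using le[of n] by simp
  ultimately show ?case
    by (rule Lim_null_comparison[OF always_eventually[OF allI], rotated])
next
  case (lim f s)
  have s: "\<And>i. integrable lborel (s i)" and f: "integrable lborel f"
    and IH: "\<And>i. (\<lambda>n. LINT x|lborel. \<bar>s i x - s i (x - w n)\<bar>) \<longlonglongrightarrow> 0"
    by (fact lim)+
  have conv: "\<And>x. (\<lambda>i. s i x) \<longlonglongrightarrow> f x" by (rule lim) simp
  have dom: "\<bar>s i x\<bar> \<le> 2 * \<bar>f x\<bar>" for i x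
    by (rule lim[unfolded real_norm_def]) simp
  show ?case
  proof (rule L1_translation_approx[OF f])
    fix e :: real assume "0 < e"
    have "(\<lambda>i. LINT x|lborel. \<bar>f x - s i x\<bar>) \<longlonglongrightarrow> (LINT x::'a|lborel. (0::real))"
    proof (rule integral_dominated_convergence[where w = "\<lambda>x. 3 * \<bar>f x\<bar>"])
      show "AE x in lborel. (\<lambda>i. \<bar>f x - s i x\<bar>) \<longlonglongrightarrow> 0"
      proof (rule AE_I2)
        fix x
        have "(\<lambda>i. \<bar>f x - s i x\<bar>) \<longlonglongrightarrow> \<bar>f x - f x\<bar>"
          by (intro tendsto_intros conv)
        then show "(\<lambda>i. \<bar>f x - s i x\<bar>) \<longlonglongrightarrow> 0" by simp
      qed
      show "AE x in lborel. norm \<bar>f x - s i x\<bar> \<le> 3 * \<bar>f x\<bar>" for i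
      proof (rule AE_I2)
        fix x
        show "norm \<bar>f x - s i x\<bar> \<le> 3 * \<bar>f x\<bar>" using dom[of i x] by simp
      qed
    qed (use s f in auto)
    then have "\<forall>\<^sub>F i in sequentially. (LINT x|lborel. \<bar>f x - s i x\<bar>) < e"
      using \<open>0 < e\<close> by (intro order_tendstoD(2)) auto
    then obtain i where "(LINT x|lborel. \<bar>f x - s i x\<bar>) < e"
      by (auto simp: eventually_sequentially)
    then show "\<exists>g. integrable lborel g \<and> (LINT x|lborel. \<bar>f x - g x\<bar>) < e \<and>
        (\<lambda>n. LINT x|lborel. \<bar>g x - g (x - w n)\<bar>) \<longlonglongrightarrow> 0"
      using s IH by blast
  qed
qed

lemma L1_translation_continuous:
  fixes f :: "'a::euclidean_space \<Rightarrow> real"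
  assumes f: "integrable lborel f" and "0 < e"
  obtains d where "0 < d" "\<And>c. norm c \<le> d \<Longrightarrow> (LINT x|lborel. \<bar>f x - f (x - c)\<bar>) \<le> e"
proof -
  have "((\<lambda>c. LINT x|lborel. \<bar>f x - f (x - c)\<bar>) \<longlongrightarrow> 0) (at 0)"
    unfolding tendsto_at_iff_sequentially comp_def
    using L1_translation_sequence[OF f] by blast
  then have "\<forall>\<^sub>F c in at 0. (LINT x|lborel. \<bar>f x - f (x - c)\<bar>) < e"
    using \<open>0 < e\<close> by (rule order_tendstoD(2))
  then obtain d where d: "d > 0" "\<And>c. c \<noteq> 0 \<Longrightarrow> norm c < d \<Longrightarrow> (LINT x|lborel. \<bar>f x - f (x - c)\<bar>) < e"
    unfolding eventually_at by (auto simp: dist_norm)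
  show thesis
  proof (rule that[of "d / 2"])
    show "(LINT x|lborel. \<bar>f x - f (x - c)\<bar>) \<le> e" if "norm c \<le> d / 2" for c
      using d(2)[of c] that d(1) \<open>0 < e\<close> by (cases "c = 0") auto
  qed (use d in simp)
qed

section \<open>Smooth approximations of the Kruzhkov entropies\<close>

definition smooth_abs :: "real \<Rightarrow> real \<Rightarrow> real" where
  "smooth_abs d t = sqrt (t\<^sup>2 + d\<^sup>2)"

lemma smooth_abs_pos: "d \<noteq> 0 \<Longrightarrow> 0 < smooth_abs d t"
  by (simp add: smooth_abs_def add_nonneg_pos)

lemma smooth_abs_square: "(smooth_abs d t)\<^sup>2 = t\<^sup>2 + d\<^sup>2"
  by (simp add: smooth_abs_def)

lemma abs_le_smooth_abs: "\<bar>t\<bar> \<le> smooth_abs d t"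
  by (simp add: smooth_abs_def real_le_rsqrt)

lemma smooth_abs_le: "smooth_abs d t \<le> \<bar>t\<bar> + \<bar>d\<bar>"
  unfolding smooth_abs_def using sqrt_sum_squares_le_sum_abs[of t d] by simp

lemma smooth_abs_has_derivative:
  "d \<noteq> 0 \<Longrightarrow> (smooth_abs d has_real_derivative t / smooth_abs d t) (at t)"
  using smooth_abs_pos[of d t] unfolding smooth_abs_def[abs_def]
  by (auto intro!: derivative_eq_intros simp: field_simps)

lemma smooth_sgn_has_derivative:
  assumes "d \<noteq> 0"
  shows "((\<lambda>t. t / smooth_abs d t) has_real_derivative d\<^sup>2 / (smooth_abs d t) ^ 3) (at t)"
proof -
  let ?s = "smooth_abs d t"
  have s: "?s > 0" by (rule smooth_abs_pos[OF assms])
  have "((\<lambda>t. t / smooth_abs d t) has_real_derivative (1 * ?s - t * (t / ?s)) / (?s * ?s)) (at t)"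
    by (rule DERIV_divide[OF DERIV_ident smooth_abs_has_derivative[OF assms]]) (use s in simp)
  also have "(1 * ?s - t * (t / ?s)) / (?s * ?s) = (?s\<^sup>2 - t\<^sup>2) / ?s ^ 3"
    using s by (simp add: field_simps power2_eq_square power3_eq_cube)
  also have "\<dots> = d\<^sup>2 / ?s ^ 3" by (simp add: smooth_abs_square)
  finally show ?thesis .
qed

lemma continuous_smooth_abs: "continuous_on UNIV (smooth_abs d)"
  unfolding smooth_abs_def[abs_def] by (intro continuous_intros)

lemma C_k_2_realI:
  fixes g :: "real \<Rightarrow> real"
  assumes "\<And>t. (g has_real_derivative g' t) (at t)" "\<And>t. (g' has_real_derivative g'' t) (at t)"
    and "continuous_on UNIV g''"
  shows "C_k 2 g"
proof -
  have 1: "frechet_derivative g (at t) = (\<lambda>v. g' t * v)" for t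
    using assms(1)[of t] unfolding has_field_derivative_def by (rule frechet_derivative_at[symmetric])
  have 2: "((\<lambda>t. g' t * v) has_derivative (\<lambda>w. g'' t * v * w)) (at t)" for t v
    using DERIV_cmult_right[OF assms(2)[of t], of v] unfolding has_field_derivative_def .
  have 3: "frechet_derivative (\<lambda>t. g' t * v) (at t) = (\<lambda>w. g'' t * v * w)" for t v
    by (rule frechet_derivative_at[OF 2, symmetric])
  have "g differentiable (at t)" for t
    using assms(1)[of t] unfolding has_field_derivative_def differentiable_def by blast
  moreover have "(\<lambda>t. g' t * v) differentiable (at t)" for t v
    using 2 unfolding differentiable_def by blast
  ultimately show ?thesis
    using assms(3) by (auto simp: numeral_2_eq_2 1 3 intro!: continuous_intros)
qed

definition kruzhkov_entropy :: "real \<Rightarrow> real \<Rightarrow> real \<Rightarrow> real" where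
  "kruzhkov_entropy d k t = smooth_abs d (t - k)"

definition kruzhkov_sign :: "real \<Rightarrow> real \<Rightarrow> real \<Rightarrow> real" where
  "kruzhkov_sign d k t = (t - k) / smooth_abs d (t - k)"

lemma kruzhkov_entropy_derivative:
  "d \<noteq> 0 \<Longrightarrow> (kruzhkov_entropy d k has_real_derivative kruzhkov_sign d k t) (at t)"
  using DERIV_shift[of "smooth_abs d" _ t "- k"] smooth_abs_has_derivative[of d "t - k"]
  unfolding kruzhkov_entropy_def[abs_def] kruzhkov_sign_def by simp

lemma kruzhkov_sign_derivative:
  "d \<noteq> 0 \<Longrightarrow> (kruzhkov_sign d k has_real_derivative d\<^sup>2 / (smooth_abs d (t - k)) ^ 3) (at t)"
  using DERIV_shift[of "\<lambda>t. t / smooth_abs d t" _ t "- k"] smooth_sgn_has_derivative[of d "t - k"]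
  unfolding kruzhkov_sign_def[abs_def] by simp

lemma deriv_kruzhkov_entropy: "d \<noteq> 0 \<Longrightarrow> deriv (kruzhkov_entropy d k) = kruzhkov_sign d k"
  using kruzhkov_entropy_derivative by (auto simp: fun_eq_iff intro!: DERIV_imp_deriv)

lemma continuous_kruzhkov_entropy: "continuous_on UNIV (kruzhkov_entropy d k)"
  unfolding kruzhkov_entropy_def[abs_def]
  by (intro continuous_on_compose2[OF continuous_smooth_abs] continuous_intros) auto

lemma continuous_kruzhkov_sign: "d \<noteq> 0 \<Longrightarrow> continuous_on UNIV (kruzhkov_sign d k)"
  by (intro continuous_at_imp_continuous_on ballI DERIV_isCont[OF kruzhkov_sign_derivative])

lemma continuous_kruzhkov_sign_derivative:
  "d \<noteq> 0 \<Longrightarrow> continuous_on UNIV (\<lambda>t. d\<^sup>2 / (smooth_abs d (t - k)) ^ 3)"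
  using smooth_abs_pos[of d]
  by (intro continuous_intros continuous_on_compose2[OF continuous_smooth_abs])
    (auto simp: less_imp_neq[symmetric])

lemma abs_kruzhkov_sign_le: "\<bar>kruzhkov_sign d k t\<bar> \<le> 1"
  using abs_le_smooth_abs[of "t - k" d] order_trans[OF abs_ge_zero abs_le_smooth_abs[of "t - k" d]]
  by (cases "smooth_abs d (t - k) = 0") (auto simp: kruzhkov_sign_def divide_le_eq_1)

lemma C_2_kruzhkov_entropy: "d \<noteq> 0 \<Longrightarrow> C_k 2 (kruzhkov_entropy d k)"
  by (rule C_k_2_realI[OF kruzhkov_entropy_derivative kruzhkov_sign_derivative
        continuous_kruzhkov_sign_derivative])

lemma convex_kruzhkov_entropy: "d \<noteq> 0 \<Longrightarrow> convex_on UNIV (kruzhkov_entropy d k)"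
  by (rule f''_ge0_imp_convex[OF _ kruzhkov_entropy_derivative kruzhkov_sign_derivative])
    (auto simp: smooth_abs_pos less_imp_le)

lemma kruzhkov_entropy_tendsto:
  "(\<lambda>n. kruzhkov_entropy (1 / real (Suc n)) k t) \<longlonglongrightarrow> \<bar>t - k\<bar>"
proof -
  have "(\<lambda>n. sqrt ((t - k)\<^sup>2 + (1 / real (Suc n))\<^sup>2)) \<longlonglongrightarrow> sqrt ((t - k)\<^sup>2 + 0\<^sup>2)"
    by (intro tendsto_intros LIMSEQ_Suc[OF lim_1_over_n])
  then show ?thesis by (simp add: kruzhkov_entropy_def smooth_abs_def)
qed

lemma kruzhkov_sign_tendsto:
  "(\<lambda>n. kruzhkov_sign (1 / real (Suc n)) k t) \<longlonglongrightarrow> sgn (t - k)"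
proof (cases "t = k")
  case False
  then have "(\<lambda>n. (t - k) / kruzhkov_entropy (1 / real (Suc n)) k t) \<longlonglongrightarrow> (t - k) / \<bar>t - k\<bar>"
    by (intro tendsto_intros kruzhkov_entropy_tendsto) auto
  moreover have "(t - k) / \<bar>t - k\<bar> = sgn (t - k)"
    using False by (simp add: sgn_if abs_if divide_eq_minus_1_iff)
  ultimately show ?thesis
    by (simp add: kruzhkov_sign_def kruzhkov_entropy_def)
qed (simp add: kruzhkov_sign_def)

lemma continuous_locally_lipschitz:
  assumes "locally_lipschitz F"
  shows "continuous_on UNIV F"
  using local_lipschitz_continuous_on[OF assms[unfolded locally_lipschitz_def], of 0] by simp

lemma locally_lipschitzI:
  fixes F :: "real \<Rightarrow> real ^ 'n"
  assumes "\<And>a. \<exists>L. L-lipschitz_on {a - 1..a + 1} F"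
  shows "locally_lipschitz F"
  unfolding locally_lipschitz_def
proof (rule local_lipschitzI)
  fix a t :: real
  obtain L where "L-lipschitz_on {a - 1..a + 1} F" using assms by blast
  then show "\<exists>u>0. \<exists>L. \<forall>t\<in>cball t u \<inter> UNIV. L-lipschitz_on (cball a u \<inter> UNIV) F"
    by (intro exI[of _ 1] conjI exI[of _ L]) (auto simp: cball_eq_atLeastAtMost)
qed

lemma lipschitz_of_continuous_derivative:
  fixes g :: "real \<Rightarrow> 'a::real_normed_vector"
  assumes "\<And>t. (g has_vector_derivative g' t) (at t)" "continuous_on UNIV g'"
  obtains L where "L-lipschitz_on {a..b} g"
proof -
  have "bounded (g' ` {a..b})"
    by (intro compact_imp_bounded compact_continuous_image continuous_on_subset[OF assms(2)]) auto
  then obtain B where B: "\<forall>t\<in>{a..b}. norm (g' t) \<le> B"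
    unfolding bounded_iff by blast
  have "(max B 0)-lipschitz_on {a..b} g"
  proof (rule bounded_derivative_imp_lipschitz)
    show "(g has_derivative (\<lambda>h. h *\<^sub>R g' t)) (at t within {a..b})" if "t \<in> {a..b}" for t
      using assms(1)[of t] unfolding has_vector_derivative_def by (rule has_derivative_at_withinI)
    show "onorm (\<lambda>h. h *\<^sub>R g' t) \<le> max B 0" if "t \<in> {a..b}" for t
    proof (rule onorm_le)
      fix h
      have "norm (h *\<^sub>R g' t) = norm (g' t) * norm h" by simp
      also have "\<dots> \<le> max B 0 * norm h"
        using bspec[OF B that] by (intro mult_right_mono) auto
      finally show "norm (h *\<^sub>R g' t) \<le> max B 0 * norm h" .
    qed
  qed auto
  then show thesis by (rule that)
qed

lemma locally_lipschitz_scaleR: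
  fixes F :: "real \<Rightarrow> real ^ 'n"
  assumes a: "\<And>t. (a has_real_derivative a' t) (at t)" "continuous_on UNIV a'"
    and F: "locally_lipschitz F"
  shows "locally_lipschitz (\<lambda>t. a t *\<^sub>R F t)"
proof (rule locally_lipschitzI)
  fix c :: real
  let ?I = "{c - 1..c + 1}"
  obtain A where A: "A-lipschitz_on ?I a"
    using lipschitz_of_continuous_derivative[OF a[unfolded has_real_derivative_iff_has_vector_derivative]]
    by blast
  obtain L where L: "L-lipschitz_on ?I F"
    using locally_lipschitz_bounded_lipschitz[OF F] by blast
  have "bounded (a ` ?I)" "bounded (F ` ?I)"
    by (auto intro!: compact_imp_bounded compact_continuous_image lipschitz_on_continuous_on[OF A]
        lipschitz_on_continuous_on[OF L])
  then obtain B C where BC: "\<forall>t\<in>?I. norm (a t) \<le> B" "\<forall>t\<in>?I. norm (F t) \<le> C"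
    unfolding bounded_iff ball_simps by blast
  then have B: "\<bar>a t\<bar> \<le> B" and C: "norm (F t) \<le> C" if "t \<in> ?I" for t
    using that by simp_all
  have "0 \<le> B" "0 \<le> C" using order_trans[OF abs_ge_zero B[of c]] order_trans[OF norm_ge_zero C[of c]] by auto
  have "(B * L + A * C)-lipschitz_on ?I (\<lambda>t. a t *\<^sub>R F t)"
  proof (rule lipschitz_onI)
    fix x y assume x: "x \<in> ?I" and y: "y \<in> ?I"
    have "a x *\<^sub>R F x - a y *\<^sub>R F y = a x *\<^sub>R (F x - F y) + (a x - a y) *\<^sub>R F y"
      by (simp add: algebra_simps)
    then have "norm (a x *\<^sub>R F x - a y *\<^sub>R F y) \<le> \<bar>a x\<bar> * norm (F x - F y) + \<bar>a x - a y\<bar> * norm (F y)"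
      using norm_triangle_ineq[of "a x *\<^sub>R (F x - F y)" "(a x - a y) *\<^sub>R F y"] by simp
    also have "\<dots> \<le> B * (L * \<bar>x - y\<bar>) + (A * \<bar>x - y\<bar>) * C"
      using lipschitz_onD[OF A x y] lipschitz_onD[OF L x y] B[OF x] C[OF y] \<open>0 \<le> B\<close>
        lipschitz_on_nonneg[OF A]
      by (intro add_mono mult_mono) (auto simp: dist_norm)
    finally show "dist (a x *\<^sub>R F x) (a y *\<^sub>R F y) \<le> (B * L + A * C) * dist x y"
      by (simp add: dist_norm algebra_simps)
  qed (use \<open>0 \<le> B\<close> \<open>0 \<le> C\<close> lipschitz_on_nonneg[OF A] lipschitz_on_nonneg[OF L] in simp)
  then show "\<exists>L. L-lipschitz_on ?I (\<lambda>t. a t *\<^sub>R F t)" by blast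
qed

text \<open>
  Integration by parts: if \<open>\<Psi>\<close> is an antiderivative of \<open>\<eta>'' (F - F k)\<close>, then
  \<open>\<eta>' (F - F k) - \<Psi>\<close> has derivative \<open>\<eta>' F'\<close> wherever \<open>F\<close> is differentiable.  The correction \<open>\<Psi>\<close> is small because
  \<open>\<eta>''\<close> concentrates at \<open>k\<close>, where \<open>F - F k\<close> vanishes linearly: \<open>L \<integral> \<eta>'' (\<tau>) \<bar>\<tau> - k\<bar> d\<tau>\<close> over either half-line is \<open>L d\<close>.
\<close>

lemma kruzhkov_flux_exists:
  fixes F :: "real \<Rightarrow> real ^ 'n"
  assumes F: "locally_lipschitz F" and d: "d > 0" and lip: "L-lipschitz_on {- M..M} F"
    and k: "\<bar>k\<bar> \<le> M"
  obtains \<Phi> where "entropy_flux F (kruzhkov_entropy d k) \<Phi>"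
    "\<And>t. \<bar>t\<bar> \<le> M \<Longrightarrow> norm (\<Phi> t - kruzhkov_sign d k t *\<^sub>R (F t - F k)) \<le> L * d"
proof -
  have d0: "d \<noteq> 0" using d by simp
  let ?S = "kruzhkov_sign d k" and ?S' = "\<lambda>t. d\<^sup>2 / (smooth_abs d (t - k)) ^ 3"
  have contF: "continuous_on UNIV F" by (rule continuous_locally_lipschitz[OF F])
  have contg: "continuous_on UNIV (\<lambda>t. ?S' t *\<^sub>R (F t - F k))"
    by (intro continuous_intros continuous_kruzhkov_sign_derivative contF d0)
  then obtain \<Psi> where \<Psi>: "\<And>t. (\<Psi> has_vector_derivative ?S' t *\<^sub>R (F t - F k)) (at t)"
    using einterval_antiderivative[of "- \<infinity>" \<infinity> "\<lambda>t. ?S' t *\<^sub>R (F t - F k)"]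
    by (auto simp: continuous_on_eq_continuous_at)
  define \<Phi> where "\<Phi> t = ?S t *\<^sub>R (F t - F k) - (\<Psi> t - \<Psi> k)" for t
  have "locally_lipschitz (\<lambda>t. F t - F k)"
  proof (rule locally_lipschitzI)
    fix a :: real
    obtain L where "L-lipschitz_on {a - 1..a + 1} F"
      using locally_lipschitz_bounded_lipschitz[OF F, of "{a - 1..a + 1}"] by auto
    then show "\<exists>L. L-lipschitz_on {a - 1..a + 1} (\<lambda>t. F t - F k)"
      by (auto simp: lipschitz_on_def dist_norm intro!: exI[of _ L])
  qed
  then have lipS: "locally_lipschitz (\<lambda>t. ?S t *\<^sub>R (F t - F k))"
    by (rule locally_lipschitz_scaleR[OF kruzhkov_sign_derivative[OF d0]
          continuous_kruzhkov_sign_derivative[OF d0]])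
  have "locally_lipschitz \<Phi>"
  proof (rule locally_lipschitzI)
    fix a :: real
    obtain A where A: "A-lipschitz_on {a - 1..a + 1} (\<lambda>t. ?S t *\<^sub>R (F t - F k))"
      using locally_lipschitz_bounded_lipschitz[OF lipS, of "{a - 1..a + 1}"] by auto
    obtain B where B: "B-lipschitz_on {a - 1..a + 1} \<Psi>"
      using lipschitz_of_continuous_derivative[OF \<Psi> contg] by blast
    have "(A + (B + 0))-lipschitz_on {a - 1..a + 1} \<Phi>"
      unfolding \<Phi>_def by (intro lipschitz_intros A B)
    then show "\<exists>L. L-lipschitz_on {a - 1..a + 1} \<Phi>" by blast
  qed
  moreover have "AE t in lebesgue. \<exists>D. ((\<lambda>r. F r $ i) has_real_derivative D) (at t) \<and>
      ((\<lambda>r. \<Phi> r $ i) has_real_derivative deriv (kruzhkov_entropy d k) t * D) (at t)" for i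
    using locally_lipschitz_AE_derivative[OF F, of i]
  proof (rule AE_mp, intro AE_I2 impI)
    fix t assume "\<exists>D. ((\<lambda>r. F r $ i) has_real_derivative D) (at t)"
    then obtain D where D: "((\<lambda>r. F r $ i) has_real_derivative D) (at t)" by blast
    have "((\<lambda>r. \<Psi> r $ i) has_vector_derivative (?S' t *\<^sub>R (F t - F k)) $ i) (at t)"
      by (rule bounded_linear.has_vector_derivative[OF bounded_linear_vec_nth \<Psi>])
    then have P: "((\<lambda>r. \<Psi> r $ i) has_real_derivative ?S' t * (F t $ i - F k $ i)) (at t)"
      by (simp add: has_real_derivative_iff_has_vector_derivative)
    have "((\<lambda>r. \<Phi> r $ i) has_real_derivative ?S t * D) (at t)"
      unfolding \<Phi>_def using kruzhkov_sign_derivative[OF d0, of k t] D P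
      by (auto intro!: derivative_eq_intros)
    with D show "\<exists>D. ((\<lambda>r. F r $ i) has_real_derivative D) (at t) \<and>
      ((\<lambda>r. \<Phi> r $ i) has_real_derivative deriv (kruzhkov_entropy d k) t * D) (at t)"
      by (auto simp: deriv_kruzhkov_entropy[OF d0])
  qed
  ultimately have "entropy_flux F (kruzhkov_entropy d k) \<Phi>"
    unfolding entropy_flux_def by blast
  moreover have "norm (\<Phi> t - ?S t *\<^sub>R (F t - F k)) \<le> L * d" if t: "\<bar>t\<bar> \<le> M" for t
  proof -
    have L0: "0 \<le> L" by (rule lipschitz_on_nonneg[OF lip])
    \<comment> \<open>For \<open>\<sigma> = 1\<close> (right of \<open>k\<close>) and \<open>\<sigma> = - 1\<close> (left of \<open>k\<close>), \<open>P \<sigma>\<close> is an antiderivative of the bound \<open>L \<eta>'' (\<tau>) \<bar>\<tau> - k\<bar>\<close>.\<close>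
    define P where "P \<sigma> t = - \<sigma> * L * d\<^sup>2 / smooth_abs d (t - k)" for \<sigma> t :: real
    have cont\<Psi>: "continuous_on {a..b} \<Psi>" for a b
      by (meson \<Psi> continuous_at_imp_continuous_on has_vector_derivative_continuous)
    have P': "(P \<sigma> has_vector_derivative \<sigma> * L * d\<^sup>2 * (t - k) / smooth_abs d (t - k) ^ 3) (at t)" for \<sigma> t
      using smooth_abs_pos[OF d0, of "t - k"]
        kruzhkov_entropy_derivative[OF d0, of k t, unfolded kruzhkov_entropy_def kruzhkov_sign_def]
      unfolding P_def has_real_derivative_iff_has_vector_derivative[symmetric]
      by (auto intro!: derivative_eq_intros simp: field_simps power2_eq_square power3_eq_cube)
    have contP: "continuous_on {a..b} (P \<sigma>)" for a b \<sigma>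
      by (meson P' continuous_at_imp_continuous_on has_vector_derivative_continuous)
    have bnd: "norm (?S' x *\<^sub>R (F x - F k)) \<le> \<sigma> * L * d\<^sup>2 * (x - k) / smooth_abs d (x - k) ^ 3"
      if "\<bar>x\<bar> \<le> M" "\<sigma> * (x - k) = \<bar>x - k\<bar>" for x \<sigma>
    proof -
      have "norm (F x - F k) \<le> L * \<bar>x - k\<bar>"
        using lipschitz_onD[OF lip, of x k] that k by (auto simp: dist_norm abs_le_iff)
      then have "?S' x * norm (F x - F k) \<le> ?S' x * (L * \<bar>x - k\<bar>)"
        by (intro mult_left_mono) (auto simp: smooth_abs_pos[OF d0] less_imp_le)
      also have "\<dots> = \<sigma> * L * d\<^sup>2 * (x - k) / smooth_abs d (x - k) ^ 3"
        unfolding that(2)[symmetric] by simp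
      finally show ?thesis
        using smooth_abs_pos[OF d0, of "x - k"] by simp
    qed
    have Pk: "P \<sigma> k = - \<sigma> * L * d" for \<sigma>
      using d by (simp add: P_def smooth_abs_def power2_eq_square)
    have Pn: "0 \<le> L * d\<^sup>2 / smooth_abs d (t - k)"
      using L0 smooth_abs_pos[OF d0] by (simp add: less_imp_le)
    have "norm (\<Psi> t - \<Psi> k) \<le> L * d"
    proof (cases t k rule: linorder_cases)
      case less
      have "norm (\<Psi> k - \<Psi> t) \<le> P (- 1) k - P (- 1) t"
        by (rule differentiable_bound_general[OF less cont\<Psi> contP \<Psi> P' bnd])
          (use t k less in auto)
      also have "\<dots> \<le> L * d" using Pn Pk[of "- 1"] by (simp add: P_def)
      finally show ?thesis by (simp add: norm_minus_commute)
    next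
      case greater
      have "norm (\<Psi> t - \<Psi> k) \<le> P 1 t - P 1 k"
        by (rule differentiable_bound_general[OF greater cont\<Psi> contP \<Psi> P' bnd])
          (use t k greater in auto)
      also have "\<dots> \<le> L * d" using Pn Pk[of 1] by (simp add: P_def)
      finally show ?thesis .
    qed (use L0 d in simp)
    then show ?thesis by (simp add: \<Phi>_def norm_minus_commute)
  qed
  ultimately show thesis by (rule that)
qed

section \<open>The entropy inequality tested with a bump\<close>

text \<open>
  Up to the sign and the constant, the part of the fractional Laplacian that comes from jumps of length
  at least \<open>r\<close>.
\<close>

definition jump :: "real \<Rightarrow> real \<Rightarrow> ('a::euclidean_space \<Rightarrow> real) \<Rightarrow> 'a \<Rightarrow> real" where
  "jump s r u x = (LINT z|lborel. (u (x + z) - u x) * far_kernel s r z)"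

text \<open>
  The complementary part, from jumps of length at most \<open>r\<close>, applied to the bump instead of the solution;
  the kernel is even, so the compensating gradient term does not change the operator.
\<close>

definition near_op :: "real \<Rightarrow> real \<Rightarrow> real \<Rightarrow> 'a::euclidean_space \<Rightarrow> real" where
  "near_op s r e w = (LINT z|lborel. indicator {z. norm z \<le> r} z *
     ((mollifier e (w + z) - mollifier e w - mollifier_grad e w \<bullet> z) / norm z powr (real DIM('a) + s)))"

lemma measurable_mollifier [measurable]: "mollifier e \<in> borel_measurable borel"
  by (rule borel_measurable_continuous_onI[OF continuous_mollifier])

lemma measurable_mollifier_grad [measurable]: "mollifier_grad e \<in> borel_measurable borel"
  by (rule borel_measurable_continuous_onI[OF continuous_mollifier_grad])

lemma measurable_far_kernel [measurable]: "far_kernel s r \<in> borel_measurable borel"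
  unfolding far_kernel_def[abs_def] by measurable

lemma measurable_jump [measurable]:
  assumes [measurable]: "u \<in> borel_measurable borel"
  shows "jump s r u \<in> borel_measurable borel"
  unfolding jump_def[abs_def] by measurable

lemma measurable_near_op [measurable]: "near_op s r e \<in> borel_measurable borel"
  unfolding near_op_def[abs_def] by measurable

lemma far_kernel_nonneg: "0 \<le> far_kernel s r z"
  by (simp add: far_kernel_def)

lemma integrable_jump:
  assumes "integrable lborel u" "0 < s" "0 < r"
  shows "integrable lborel (jump s r u)"
  unfolding jump_def[abs_def]
  by (rule jump_accretive(1)[OF assms(1) integrable_far_kernel[OF assms(2,3)] far_kernel_nonneg])

text \<open>
  The Taylor bound controls the integrand by \<open>M\<close> times the near kernel, and the integrand vanishes when \<open>w\<close>
  is farther than \<open>r\<close> from the support of the bump.  The constant \<open>M\<close> does not depend on \<open>r\<close>.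
\<close>

lemma near_op_bound:
  assumes "0 \<le> e" "s < 2"
  obtains M where "0 \<le> M"
    "\<And>r w. 0 < r \<Longrightarrow> r \<le> 1 \<Longrightarrow> \<bar>near_op s r e (w::'a::euclidean_space)\<bar>
        \<le> M * (LINT z|lborel. near_kernel s r (z::'a)) * indicator (cball 0 (e + 1)) w"
proof -
  obtain M where M: "0 \<le> M" "\<And>w z :: 'a. \<bar>mollifier e (w + z) - mollifier e w - mollifier_grad e w \<bullet> z\<bar> \<le> M * (norm z)\<^sup>2"
    using mollifier_taylor[OF assms(1)] by blast
  have "\<bar>near_op s r e w\<bar> \<le> M * (LINT z|lborel. near_kernel s r (z::'a)) * indicator (cball 0 (e + 1)) w"
    if r: "0 < r" "r \<le> 1" for r and w :: 'a
  proof (cases "w \<in> cball 0 (e + 1)")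
    case True
    let ?g = "\<lambda>z::'a. indicator {z. norm z \<le> r} z *
     ((mollifier e (w + z) - mollifier e w - mollifier_grad e w \<bullet> z) / norm z powr (real DIM('a) + s))"
    have bnd: "norm (?g z) \<le> M * near_kernel s r z" for z
    proof (cases "z = 0 \<or> \<not> norm z \<le> r")
      case False
      have "norm (?g z) = \<bar>mollifier e (w + z) - mollifier e w - mollifier_grad e w \<bullet> z\<bar> / norm z powr (real DIM('a) + s)"
        using False by simp
      also have "\<dots> \<le> M * (norm z)\<^sup>2 / norm z powr (real DIM('a) + s)"
        by (intro divide_right_mono M) simp
      also have "\<dots> = M * near_kernel s r z"
        using False by (simp add: near_kernel_def powr_diff)
      finally show ?thesis .
    qed (auto simp: near_kernel_def)
    have int: "integrable lborel (\<lambda>z::'a. M * near_kernel s r z)"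
      by (intro integrable_mult_right integrable_near_kernel assms(2) r(1))
    have "integrable lborel ?g"
      by (rule Bochner_Integration.integrable_bound[OF int])
        (measurable, intro AE_I2 order_trans[OF bnd], simp)
    then have "norm (near_op s r e w) \<le> (LINT z|lborel. norm (?g z))"
      unfolding near_op_def by (intro integral_norm_bound)
    also have "\<dots> \<le> (LINT z::'a|lborel. M * near_kernel s r z)"
      using \<open>integrable lborel ?g\<close> int bnd by (intro integral_mono integrable_norm)
    finally show ?thesis using True by simp
  next
    case False
    then have w: "norm w > e + 1" by simp
    have "indicator {z. norm z \<le> r} z *
     ((mollifier e (w + z) - mollifier e w - mollifier_grad e w \<bullet> z) / norm z powr (real DIM('a) + s)) = 0" for z :: 'a
    proof (cases "norm z \<le> r")
      case True
      have "norm w \<le> norm (w + z) + norm z" using norm_triangle_ineq4[of "w + z" z] by simp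
      then have "e \<le> norm (w + z)" "e \<le> norm w" using w r True by auto
      then have "mollifier e (w + z) = 0" "mollifier e w = 0" "mollifier_grad e w = 0"
        using assms(1) by (simp_all add: mollifier_eq_0_iff mollifier_grad_eq_0)
      then show ?thesis by simp
    qed simp
    then have "near_op s r e w = (LINT z::'a|lborel. 0)"
      unfolding near_op_def by presburger
    then show ?thesis using False by simp
  qed
  with M(1) show thesis using that by blast
qed

lemma integrable_near_op:
  assumes "0 \<le> e" "s < 2" "0 < r" "r \<le> 1"
  shows "integrable lborel (near_op s r e :: 'a::euclidean_space \<Rightarrow> real)"
proof -
  obtain M where "0 \<le> M" and M: "\<And>r w. 0 < r \<Longrightarrow> r \<le> 1 \<Longrightarrow> \<bar>near_op s r e (w::'a)\<bar>
        \<le> M * (LINT z|lborel. near_kernel s r (z::'a)) * indicator (cball 0 (e + 1)) w"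
    using near_op_bound[OF assms(1,2), where 'a = 'a] by blast
  show ?thesis
  proof (rule Bochner_Integration.integrable_bound)
    show "integrable lborel (\<lambda>w. M * (LINT z|lborel. near_kernel s r (z::'a)) * indicator (cball 0 (e + 1)) w :: real)"
      by (intro integrable_mult_right integrable_real_indicator emeasure_lborel_cball_finite) auto
    show "AE w in lborel. norm (near_op s r e (w::'a))
        \<le> norm (M * (LINT z|lborel. near_kernel s r (z::'a)) * indicator (cball 0 (e + 1)) w)"
      using M[OF assms(3,4)] by (intro AE_I2) (metis abs_ge_self order_trans real_norm_def)
  qed simp
qed

text \<open>
  For a merely Lebesgue measurable \<open>u\<close> the function \<open>(x, z) \<mapsto> u (x + z)\<close> need not be measurable for the
  product \<sigma>-algebra, which Fubini requires.  All integrals are therefore moved to Borel representatives;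
  this lemma is the transfer step.
\<close>

lemma lebesgue_integral_cong_borel:
  fixes h g :: "'a::euclidean_space \<Rightarrow> real"
  assumes g: "g \<in> borel_measurable borel" and ae: "AE x in lborel. h x = g x"
  shows "(LINT x|lebesgue. h x) = (LINT x|lborel. g x)"
proof -
  have g': "g \<in> borel_measurable lebesgue" using g by (simp add: measurable_completion)
  have ae': "AE x in lebesgue. g x = h x"
    by (rule AE_completion) (use ae in \<open>auto elim: AE_mp\<close>)
  have "(LINT x|lebesgue. h x) = (LINT x|lebesgue. g x)"
    by (rule integral_cong_AE[OF borel_measurable_AE[OF g' ae'] g']) (use ae' in \<open>auto elim: AE_mp\<close>)
  also have "\<dots> = (LINT x|lborel. g x)" using g by (intro integral_completion) simp
  finally show ?thesis .
qed

lemma AE_lborel_shift: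
  fixes P :: "'a::euclidean_space \<Rightarrow> bool"
  assumes "AE x in lborel. P x"
  shows "AE z in lborel. P (x + z)"
proof -
  obtain N where N: "{x \<in> space lborel. \<not> P x} \<subseteq> N" "emeasure lborel N = 0" "N \<in> sets lborel"
    using assms by (rule AE_E)
  have "emeasure lborel ((+) x -` N) = emeasure (distr lborel borel ((+) x)) N"
    using N by (subst emeasure_distr) auto
  then have "emeasure lborel ((+) x -` N) = 0" using N(2) by (simp add: lborel_distr_plus)
  moreover have "(+) x -` N \<in> sets lborel"
    using measurable_sets[of "(+) x" borel borel N] N by simp
  ultimately show ?thesis
    using N(1) by (intro AE_I[of _ _ "(+) x -` N"]) auto
qed

text \<open>
  The definition of entropy solutions, rewritten for Borel representatives and the translates of the bump.
  The factors that do not depend on \<open>z\<close> have been taken out of the inner integrals.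
\<close>

lemma entropy_inequality_mollifier:
  fixes u f u0 f0 :: "real ^ 'n \<Rightarrow> real" and F :: "real \<Rightarrow> real ^ 'n"
  assumes sol: "entropy_solution s b F f u" and b: "continuous_on UNIV b"
    and [measurable]: "u0 \<in> borel_measurable borel" "f0 \<in> borel_measurable borel"
    and u: "AE x in lborel. u x = u0 x" and f: "AE x in lborel. f x = f0 x"
    and r: "0 < r" and e: "0 \<le> e"
    and \<eta>: "convex_on UNIV \<eta>" "C_k 2 \<eta>" "continuous_on UNIV \<eta>" "continuous_on UNIV (deriv \<eta>)"
    and \<Phi>: "entropy_flux F \<eta> \<Phi>"
  shows "0 \<le> (LINT x|lborel. (f0 x - b (u0 x)) * deriv \<eta> (u0 x) * mollifier e (x - y)
        + \<Phi> (u0 x) \<bullet> mollifier_grad e (x - y))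
    + frac_const CARD('n) s * (LINT x|lborel. deriv \<eta> (u0 x) * (jump s r u0 x * mollifier e (x - y)))
    + frac_const CARD('n) s * (LINT x|lborel. \<eta> (u0 x) * near_op s r e (x - y))"
proof -
  let ?\<phi> = "\<lambda>x. mollifier e (x - y)"
  have [measurable]: "b \<in> borel_measurable borel" "\<eta> \<in> borel_measurable borel"
    "deriv \<eta> \<in> borel_measurable borel" "\<Phi> \<in> borel_measurable borel"
    using b \<eta>(3,4) \<Phi> continuous_locally_lipschitz[of \<Phi>]
    by (auto intro!: borel_measurable_continuous_onI simp: entropy_flux_def)
  have "test_function ?\<phi>" "\<forall>x. ?\<phi> x \<ge> 0"
    by (auto simp: test_function_mollifier_shift[OF e] mollifier_nonneg)
  then have "0 \<le> (LINT x|lebesgue. (f x - b (u x)) * deriv \<eta> (u x) * ?\<phi> x + \<Phi> (u x) \<bullet> grad ?\<phi> x)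
        + frac_const CARD('n) s *
          (LINT x|lebesgue. (LINT z:{z. norm z \<ge> r}|lebesgue.
             deriv \<eta> (u x) * ((u (x + z) - u x) / norm z powr (real CARD('n) + s)) * ?\<phi> x))
        + frac_const CARD('n) s *
          (LINT x|lebesgue. (LINT z:{z. norm z \<le> r}|lebesgue.
             \<eta> (u x) * ((?\<phi> (x + z) - ?\<phi> x - grad ?\<phi> x \<bullet> z) / norm z powr (real CARD('n) + s))))"
    using sol r \<eta>(1,2) \<Phi> unfolding entropy_solution_def by blast
  also have "(LINT x|lebesgue. (f x - b (u x)) * deriv \<eta> (u x) * ?\<phi> x + \<Phi> (u x) \<bullet> grad ?\<phi> x)
      = (LINT x|lborel. (f0 x - b (u0 x)) * deriv \<eta> (u0 x) * ?\<phi> x + \<Phi> (u0 x) \<bullet> mollifier_grad e (x - y))"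
  proof (rule lebesgue_integral_cong_borel)
    show "AE x in lborel. (f x - b (u x)) * deriv \<eta> (u x) * ?\<phi> x + \<Phi> (u x) \<bullet> grad ?\<phi> x
        = (f0 x - b (u0 x)) * deriv \<eta> (u0 x) * ?\<phi> x + \<Phi> (u0 x) \<bullet> mollifier_grad e (x - y)"
      using u f by eventually_elim (simp add: grad_mollifier_shift)
  qed measurable
  also have "(LINT x|lebesgue. (LINT z:{z. norm z \<ge> r}|lebesgue.
             deriv \<eta> (u x) * ((u (x + z) - u x) / norm z powr (real CARD('n) + s)) * ?\<phi> x))
      = (LINT x|lborel. deriv \<eta> (u0 x) * (jump s r u0 x * ?\<phi> x))"
  proof (rule lebesgue_integral_cong_borel)
    show "AE x in lborel. (LINT z:{z. norm z \<ge> r}|lebesgue.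
             deriv \<eta> (u x) * ((u (x + z) - u x) / norm z powr (real CARD('n) + s)) * ?\<phi> x)
        = deriv \<eta> (u0 x) * (jump s r u0 x * ?\<phi> x)"
      using u
    proof eventually_elim
      case (elim x)
      have "(LINT z:{z. norm z \<ge> r}|lebesgue.
             deriv \<eta> (u x) * ((u (x + z) - u x) / norm z powr (real CARD('n) + s)) * ?\<phi> x)
          = (LINT z|lborel. deriv \<eta> (u0 x) * ?\<phi> x * ((u0 (x + z) - u0 x) * far_kernel s r z))"
        unfolding set_lebesgue_integral_def
      proof (rule lebesgue_integral_cong_borel)
        show "AE z in lborel. indicat_real {z. norm z \<ge> r} z *\<^sub>R
            (deriv \<eta> (u x) * ((u (x + z) - u x) / norm z powr (real CARD('n) + s)) * ?\<phi> x)
          = deriv \<eta> (u0 x) * ?\<phi> x * ((u0 (x + z) - u0 x) * far_kernel s r z)"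
          using AE_lborel_shift[OF u, of x]
        proof eventually_elim
          case (elim z)
          have "norm z powr (- (real CARD('n) + s)) = 1 / norm z powr (real CARD('n) + s)"
            by (rule powr_minus_divide)
          then show ?case
            unfolding far_kernel_def using elim \<open>u x = u0 x\<close> by simp
        qed
      qed measurable
      also have "\<dots> = deriv \<eta> (u0 x) * (jump s r u0 x * ?\<phi> x)"
        unfolding jump_def by (subst integral_mult_right_zero) simp
      finally show ?case .
    qed
  qed measurable
  also have "(LINT x|lebesgue. (LINT z:{z. norm z \<le> r}|lebesgue.
             \<eta> (u x) * ((?\<phi> (x + z) - ?\<phi> x - grad ?\<phi> x \<bullet> z) / norm z powr (real CARD('n) + s))))
      = (LINT x|lborel. \<eta> (u0 x) * near_op s r e (x - y))"
  proof (rule lebesgue_integral_cong_borel)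
    show "AE x in lborel. (LINT z:{z. norm z \<le> r}|lebesgue.
             \<eta> (u x) * ((?\<phi> (x + z) - ?\<phi> x - grad ?\<phi> x \<bullet> z) / norm z powr (real CARD('n) + s)))
        = \<eta> (u0 x) * near_op s r e (x - y)"
      using u
    proof eventually_elim
      case (elim x)
      have "(LINT z:{z. norm z \<le> r}|lebesgue.
             \<eta> (u x) * ((?\<phi> (x + z) - ?\<phi> x - grad ?\<phi> x \<bullet> z) / norm z powr (real CARD('n) + s)))
          = (LINT z|lborel. \<eta> (u0 x) * (indicator {z. norm z \<le> r} z *
     ((mollifier e ((x - y) + z) - mollifier e (x - y) - mollifier_grad e (x - y) \<bullet> z)
       / norm z powr (real CARD('n) + s))))"
        unfolding set_lebesgue_integral_def
        by (rule lebesgue_integral_cong_borel)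
          (auto simp: elim grad_mollifier_shift algebra_simps intro!: AE_I2)
      also have "\<dots> = \<eta> (u0 x) * near_op s r e (x - y)"
        unfolding near_op_def by (subst integral_mult_right_zero) simp
      finally show ?case .
    qed
  qed measurable
  finally show ?thesis .
qed

section \<open>The Kruzhkov inequality\<close>

text \<open>
  Dominated convergence in the three integrals along the entropies with parameter \<open>1 / (n + 1)\<close>.  Their
  derivatives converge to \<open>sgn (t - k)\<close> also at \<open>t = k\<close>, where both sides are zero.
\<close>

lemma kruzhkov_inequality:
  fixes u f u0 f0 :: "real ^ 'n \<Rightarrow> real" and F :: "real \<Rightarrow> real ^ 'n"
  assumes sol: "entropy_solution s b F f u" and s: "0 < s" "s < 2"
    and b: "continuous_on UNIV b" and F: "locally_lipschitz F"
    and u: "AE x in lborel. u x = u0 x" and f: "AE x in lborel. f x = f0 x"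
    and int: "integrable lborel u0" "integrable lborel f0" "integrable lborel (\<lambda>x. b (u0 x))"
    and M: "\<And>x. \<bar>u0 x\<bar> \<le> M" and k: "\<bar>k\<bar> \<le> M" and r: "0 < r" "r \<le> 1" and e: "0 < e"
  shows "0 \<le> (LINT x|lborel. sgn (u0 x - k) * (f0 x - b (u0 x)) * mollifier e (x - y)
        + sgn (u0 x - k) * ((F (u0 x) - F k) \<bullet> mollifier_grad e (x - y)))
    + frac_const CARD('n) s * (LINT x|lborel. sgn (u0 x - k) * (jump s r u0 x * mollifier e (x - y)))
    + frac_const CARD('n) s * (LINT x|lborel. \<bar>u0 x - k\<bar> * near_op s r e (x - y))"
proof -
  let ?d = "\<lambda>n. 1 / real (Suc n)" and ?c = "frac_const CARD('n) s"
  let ?\<rho> = "\<lambda>x. mollifier e (x - y)" and ?G = "\<lambda>x. mollifier_grad e (x - y)"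
  have [measurable]: "u0 \<in> borel_measurable borel" "f0 \<in> borel_measurable borel"
    "b \<in> borel_measurable borel" "F \<in> borel_measurable borel"
    using int b continuous_locally_lipschitz[OF F] by (auto intro: borel_measurable_continuous_onI)
  have [measurable]: "kruzhkov_sign (?d n) k \<in> borel_measurable borel"
    "kruzhkov_entropy (?d n) k \<in> borel_measurable borel" for n
    by (auto intro!: borel_measurable_continuous_onI continuous_kruzhkov_sign continuous_kruzhkov_entropy)
  have "0 \<le> M" using k by linarith
  obtain L where L: "L-lipschitz_on {- M..M} F"
    using locally_lipschitz_bounded_lipschitz[OF F] by blast
  have L0: "0 \<le> L" by (rule lipschitz_on_nonneg[OF L])
  have Fk: "norm (F t - F k) \<le> L * (2 * M)" if "\<bar>t\<bar> \<le> M" for t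
  proof -
    have "norm (F t - F k) \<le> L * \<bar>t - k\<bar>"
      using lipschitz_onD[OF L, of t k] that k by (auto simp: dist_norm abs_le_iff)
    also have "\<dots> \<le> L * (2 * M)" using L0 that k by (intro mult_left_mono) auto
    finally show ?thesis .
  qed
  obtain B where B: "0 \<le> B" "\<And>x::real ^ 'n. mollifier e x \<le> B"
    using mollifier_bounded by blast
  have "\<exists>\<Phi>. entropy_flux F (kruzhkov_entropy (?d n) k) \<Phi> \<and>
      (\<forall>t. \<bar>t\<bar> \<le> M \<longrightarrow> norm (\<Phi> t - kruzhkov_sign (?d n) k t *\<^sub>R (F t - F k)) \<le> L * ?d n)" for n
    using kruzhkov_flux_exists[OF F _ L k, of "?d n"] by (metis of_nat_0_less_iff zero_less_Suc zero_less_divide_1_iff)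
  then obtain \<Phi> where \<Phi>: "\<And>n. entropy_flux F (kruzhkov_entropy (?d n) k) (\<Phi> n)"
    "\<And>n t. \<bar>t\<bar> \<le> M \<Longrightarrow> norm (\<Phi> n t - kruzhkov_sign (?d n) k t *\<^sub>R (F t - F k)) \<le> L * ?d n"
    by metis
  have [measurable]: "\<Phi> n \<in> borel_measurable borel" for n
    using \<Phi>(1)[of n] by (intro borel_measurable_continuous_onI continuous_locally_lipschitz)
      (simp add: entropy_flux_def)
  have \<Phi>_lim: "(\<lambda>n. \<Phi> n t) \<longlonglongrightarrow> sgn (t - k) *\<^sub>R (F t - F k)" if "\<bar>t\<bar> \<le> M" for t
  proof -
    have "(\<lambda>n. L * ?d n) \<longlonglongrightarrow> L * 0" by (intro tendsto_intros LIMSEQ_Suc[OF lim_1_over_n])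
    then have "(\<lambda>n. L * ?d n) \<longlonglongrightarrow> 0" by simp
    then have "(\<lambda>n. \<Phi> n t - kruzhkov_sign (?d n) k t *\<^sub>R (F t - F k)) \<longlonglongrightarrow> 0"
      by (rule Lim_null_comparison[OF always_eventually, rotated]) (use \<Phi>(2) that in blast)
    moreover have "(\<lambda>n. kruzhkov_sign (?d n) k t *\<^sub>R (F t - F k)) \<longlonglongrightarrow> sgn (t - k) *\<^sub>R (F t - F k)"
      by (intro tendsto_intros kruzhkov_sign_tendsto)
    ultimately show ?thesis using tendsto_add by fastforce
  qed
  have \<Phi>_bound: "norm (\<Phi> n t) \<le> L * (2 * M) + L" if "\<bar>t\<bar> \<le> M" for n t
  proof -
    have "norm (\<Phi> n t) \<le> norm (\<Phi> n t - kruzhkov_sign (?d n) k t *\<^sub>R (F t - F k))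
        + norm (kruzhkov_sign (?d n) k t *\<^sub>R (F t - F k))"
      by (metis diff_add_cancel norm_triangle_ineq)
    also have "\<dots> \<le> L * ?d n + 1 * (L * (2 * M))"
      unfolding norm_scaleR
      by (intro add_mono \<Phi>(2) that mult_mono abs_kruzhkov_sign_le Fk) auto
    also have "L * ?d n \<le> L * 1" using L0 by (intro mult_left_mono) auto
    finally show ?thesis by simp
  qed
  have nonneg: "0 \<le> (LINT x|lborel. (f0 x - b (u0 x)) * kruzhkov_sign (?d n) k (u0 x) * ?\<rho> x + \<Phi> n (u0 x) \<bullet> ?G x)
    + ?c * (LINT x|lborel. kruzhkov_sign (?d n) k (u0 x) * (jump s r u0 x * ?\<rho> x))
    + ?c * (LINT x|lborel. kruzhkov_entropy (?d n) k (u0 x) * near_op s r e (x - y))" for n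
  proof -
    have d: "?d n \<noteq> 0" by simp
    show ?thesis
      using entropy_inequality_mollifier[OF sol b _ _ u f r(1) less_imp_le[OF e] convex_kruzhkov_entropy[OF d]
          C_2_kruzhkov_entropy[OF d] continuous_kruzhkov_entropy _ \<Phi>(1), of y]
      unfolding deriv_kruzhkov_entropy[OF d] using continuous_kruzhkov_sign[OF d] by simp
  qed
  have 1: "(\<lambda>n. LINT x|lborel. (f0 x - b (u0 x)) * kruzhkov_sign (?d n) k (u0 x) * ?\<rho> x + \<Phi> n (u0 x) \<bullet> ?G x)
      \<longlonglongrightarrow> (LINT x|lborel. (f0 x - b (u0 x)) * sgn (u0 x - k) * ?\<rho> x + (sgn (u0 x - k) *\<^sub>R (F (u0 x) - F k)) \<bullet> ?G x)"
  proof (rule integral_dominated_convergence)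
    show "integrable lborel (\<lambda>x. \<bar>f0 x - b (u0 x)\<bar> * B + (L * (2 * M) + L) * norm (?G x))"
      using int integrable_shift_diff_iff[of "mollifier_grad e" y] integrable_mollifier_grad[OF less_imp_le[OF e]]
      by (auto intro!: integrable_norm)
    show "AE x in lborel. (\<lambda>n. (f0 x - b (u0 x)) * kruzhkov_sign (?d n) k (u0 x) * ?\<rho> x + \<Phi> n (u0 x) \<bullet> ?G x)
        \<longlonglongrightarrow> (f0 x - b (u0 x)) * sgn (u0 x - k) * ?\<rho> x + (sgn (u0 x - k) *\<^sub>R (F (u0 x) - F k)) \<bullet> ?G x"
      by (intro AE_I2 tendsto_intros kruzhkov_sign_tendsto \<Phi>_lim M)
    show "AE x in lborel. norm ((f0 x - b (u0 x)) * kruzhkov_sign (?d n) k (u0 x) * ?\<rho> x + \<Phi> n (u0 x) \<bullet> ?G x)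
        \<le> \<bar>f0 x - b (u0 x)\<bar> * B + (L * (2 * M) + L) * norm (?G x)" for n
    proof (rule AE_I2)
      fix x
      have "norm ((f0 x - b (u0 x)) * kruzhkov_sign (?d n) k (u0 x) * ?\<rho> x)
          = \<bar>f0 x - b (u0 x)\<bar> * (\<bar>kruzhkov_sign (?d n) k (u0 x)\<bar> * ?\<rho> x)"
        by (simp add: abs_mult mollifier_nonneg)
      also have "\<dots> \<le> \<bar>f0 x - b (u0 x)\<bar> * (1 * B)"
        by (intro mult_left_mono mult_mono abs_kruzhkov_sign_le B) (auto simp: mollifier_nonneg)
      finally have "norm ((f0 x - b (u0 x)) * kruzhkov_sign (?d n) k (u0 x) * ?\<rho> x) \<le> \<bar>f0 x - b (u0 x)\<bar> * B"
        by simp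
      moreover have "norm (\<Phi> n (u0 x) \<bullet> ?G x) \<le> (L * (2 * M) + L) * norm (?G x)"
        by (rule order_trans[OF Cauchy_Schwarz_ineq2[folded real_norm_def]])
          (intro mult_right_mono \<Phi>_bound M norm_ge_zero)
      ultimately show "norm ((f0 x - b (u0 x)) * kruzhkov_sign (?d n) k (u0 x) * ?\<rho> x + \<Phi> n (u0 x) \<bullet> ?G x)
        \<le> \<bar>f0 x - b (u0 x)\<bar> * B + (L * (2 * M) + L) * norm (?G x)"
        by (intro order_trans[OF norm_triangle_ineq add_mono])
    qed
  qed measurable
  have 2: "(\<lambda>n. LINT x|lborel. kruzhkov_sign (?d n) k (u0 x) * (jump s r u0 x * ?\<rho> x))
      \<longlonglongrightarrow> (LINT x|lborel. sgn (u0 x - k) * (jump s r u0 x * ?\<rho> x))"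
  proof (rule integral_dominated_convergence)
    show "integrable lborel (\<lambda>x. \<bar>jump s r u0 x\<bar> * B)"
      using integrable_jump[OF int(1) s(1) r(1)] by simp
    show "AE x in lborel. (\<lambda>n. kruzhkov_sign (?d n) k (u0 x) * (jump s r u0 x * ?\<rho> x))
        \<longlonglongrightarrow> sgn (u0 x - k) * (jump s r u0 x * ?\<rho> x)"
      by (intro AE_I2 tendsto_intros kruzhkov_sign_tendsto)
    show "AE x in lborel. norm (kruzhkov_sign (?d n) k (u0 x) * (jump s r u0 x * ?\<rho> x)) \<le> \<bar>jump s r u0 x\<bar> * B" for n
    proof (rule AE_I2)
      fix x
      have "norm (kruzhkov_sign (?d n) k (u0 x) * (jump s r u0 x * ?\<rho> x))
          = \<bar>kruzhkov_sign (?d n) k (u0 x)\<bar> * (\<bar>jump s r u0 x\<bar> * ?\<rho> x)"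
        by (simp add: abs_mult mollifier_nonneg)
      also have "\<dots> \<le> 1 * (\<bar>jump s r u0 x\<bar> * B)"
        by (intro mult_mono abs_kruzhkov_sign_le B order_refl) (auto simp: mollifier_nonneg B)
      finally show "norm (kruzhkov_sign (?d n) k (u0 x) * (jump s r u0 x * ?\<rho> x)) \<le> \<bar>jump s r u0 x\<bar> * B" by simp
    qed
  qed measurable
  have 3: "(\<lambda>n. LINT x|lborel. kruzhkov_entropy (?d n) k (u0 x) * near_op s r e (x - y))
      \<longlonglongrightarrow> (LINT x|lborel. \<bar>u0 x - k\<bar> * near_op s r e (x - y))"
  proof (rule integral_dominated_convergence)
    show "integrable lborel (\<lambda>x. (2 * M + 1) * \<bar>near_op s r e (x - y)\<bar>)"
      using integrable_shift_diff_iff[of "near_op s r e" y]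
        integrable_near_op[OF less_imp_le[OF e] s(2) r, where 'a = "real ^ 'n"] by simp
    show "AE x in lborel. (\<lambda>n. kruzhkov_entropy (?d n) k (u0 x) * near_op s r e (x - y))
        \<longlonglongrightarrow> \<bar>u0 x - k\<bar> * near_op s r e (x - y)"
      by (intro AE_I2 tendsto_intros kruzhkov_entropy_tendsto)
    show "AE x in lborel. norm (kruzhkov_entropy (?d n) k (u0 x) * near_op s r e (x - y))
        \<le> (2 * M + 1) * \<bar>near_op s r e (x - y)\<bar>" for n
    proof (rule AE_I2)
      fix x
      have "?d n \<le> 1" by simp
      moreover have "\<bar>?d n\<bar> = ?d n" by simp
      ultimately have "\<bar>u0 x - k\<bar> + \<bar>?d n\<bar> \<le> 2 * M + 1" using M[of x] k by linarith
      then have "kruzhkov_entropy (?d n) k (u0 x) \<le> 2 * M + 1"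
        unfolding kruzhkov_entropy_def by (rule order_trans[OF smooth_abs_le])
      moreover have "0 \<le> kruzhkov_entropy (?d n) k (u0 x)"
        unfolding kruzhkov_entropy_def by (rule order_trans[OF abs_ge_zero abs_le_smooth_abs])
      ultimately show "norm (kruzhkov_entropy (?d n) k (u0 x) * near_op s r e (x - y))
        \<le> (2 * M + 1) * \<bar>near_op s r e (x - y)\<bar>"
        by (auto simp: abs_mult intro!: mult_right_mono)
    qed
  qed measurable
  have "0 \<le> (LINT x|lborel. (f0 x - b (u0 x)) * sgn (u0 x - k) * ?\<rho> x + (sgn (u0 x - k) *\<^sub>R (F (u0 x) - F k)) \<bullet> ?G x)
    + ?c * (LINT x|lborel. sgn (u0 x - k) * (jump s r u0 x * ?\<rho> x))
    + ?c * (LINT x|lborel. \<bar>u0 x - k\<bar> * near_op s r e (x - y))"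
    by (rule LIMSEQ_le_const[OF tendsto_add[OF tendsto_add[OF 1 tendsto_mult_left[OF 2]] tendsto_mult_left[OF 3]]])
      (use nonneg in blast)
  then show ?thesis by (simp add: mult_ac)
qed

section \<open>Doubling the variables\<close>

text \<open>
  The integrand of the Kruzhkov inequality for \<open>u\<close>, with the constant \<open>k = v y\<close> and the bump centred at \<open>y\<close>.
\<close>

definition doubled_integrand ::
  "real \<Rightarrow> (real \<Rightarrow> real) \<Rightarrow> (real \<Rightarrow> real ^ 'n) \<Rightarrow> real \<Rightarrow> real \<Rightarrow> (real ^ 'n \<Rightarrow> real) \<Rightarrow> (real ^ 'n \<Rightarrow> real)
    \<Rightarrow> (real ^ 'n \<Rightarrow> real) \<Rightarrow> real ^ 'n \<Rightarrow> real ^ 'n \<Rightarrow> real" where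
  "doubled_integrand s b F r e f u v x y =
     (sgn (u x - v y) * (f x - b (u x)) * mollifier e (x - y)
        + sgn (u x - v y) * ((F (u x) - F (v y)) \<bullet> mollifier_grad e (x - y)))
     + frac_const CARD('n) s * (sgn (u x - v y) * (jump s r u x * mollifier e (x - y)))
     + frac_const CARD('n) s * (\<bar>u x - v y\<bar> * near_op s r e (x - y))"

lemma integrable_pair_bound:
  fixes h g :: "'a::euclidean_space \<times> 'a \<Rightarrow> real"
  assumes "integrable (lborel \<Otimes>\<^sub>M lborel) g" "h \<in> borel_measurable (lborel \<Otimes>\<^sub>M lborel)"
    "\<And>x y. \<bar>h (x, y)\<bar> \<le> g (x, y)"
  shows "integrable (lborel \<Otimes>\<^sub>M lborel) h"
  by (rule Bochner_Integration.integrable_bound[OF assms(1,2)])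
    (use assms(3) in \<open>auto intro!: AE_I2 order_trans[OF _ abs_ge_self]\<close>)

lemma integrable_sum_diff:
  fixes a a' m :: "'a::euclidean_space \<Rightarrow> real"
  assumes "integrable lborel a" "integrable lborel a'" "integrable lborel m"
  shows "integrable (lborel \<Otimes>\<^sub>M lborel) (\<lambda>(x, y). (\<bar>a x\<bar> + \<bar>a' y\<bar>) * m (x - y))"
  using Bochner_Integration.integrable_add[OF integrable_product_fst_diff[of "\<lambda>x. \<bar>a x\<bar>" m]
      integrable_product_snd_diff[of "\<lambda>x. \<bar>a' x\<bar>" m]] assms
  by (simp add: split_def distrib_right)

lemma abs_sgn_mult_le: "\<bar>sgn a * c\<bar> \<le> \<bar>c\<bar>" for a c :: real
  by (simp add: abs_mult abs_sgn_eq)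

text \<open>
  Every term is dominated by a function of \<open>x\<close> or of \<open>y\<close> from \<open>L\<^sup>1\<close> times an integrable function of \<open>x - y\<close>;
  for the flux term this uses that \<open>F\<close> is Lipschitz on the common range of \<open>u\<close> and \<open>v\<close>.
\<close>

lemma doubled_integrand_integrable:
  fixes u v f :: "real ^ 'n \<Rightarrow> real" and F :: "real \<Rightarrow> real ^ 'n"
  assumes s: "0 < s" "s < 2" and b: "continuous_on UNIV b" and F: "locally_lipschitz F"
    and int: "integrable lborel u" "integrable lborel f" "integrable lborel (\<lambda>x. b (u x))" "integrable lborel v"
    and M: "\<And>x. \<bar>u x\<bar> \<le> M" "\<And>x. \<bar>v x\<bar> \<le> M" and r: "0 < r" "r \<le> 1" and e: "0 < e"
  shows "integrable (lborel \<Otimes>\<^sub>M lborel)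
      (\<lambda>(x, y). sgn (u x - v y) * (f x - b (u x)) * mollifier e (x - y)
        + sgn (u x - v y) * ((F (u x) - F (v y)) \<bullet> mollifier_grad e (x - y)))" (is "integrable _ ?h1")
    "integrable (lborel \<Otimes>\<^sub>M lborel) (\<lambda>(x, y). sgn (u x - v y) * (jump s r u x * mollifier e (x - y)))"
      (is "integrable _ ?h2")
    "integrable (lborel \<Otimes>\<^sub>M lborel) (\<lambda>(x, y). \<bar>u x - v y\<bar> * near_op s r e (x - y))"
      (is "integrable _ ?h3")
proof -
  have [measurable]: "u \<in> borel_measurable borel" "v \<in> borel_measurable borel" "f \<in> borel_measurable borel"
    "b \<in> borel_measurable borel" "F \<in> borel_measurable borel"
    using int b continuous_locally_lipschitz[OF F] by (auto intro: borel_measurable_continuous_onI)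
  obtain L where L: "L-lipschitz_on {- M..M} F"
    using locally_lipschitz_bounded_lipschitz[OF F] by blast
  have L0: "0 \<le> L" by (rule lipschitz_on_nonneg[OF L])
  have e0: "0 \<le> e" using e by simp
  have \<rho>: "integrable lborel (mollifier e :: real ^ 'n \<Rightarrow> real)"
    by (rule integrable_mollifier[OF e0])
  have G: "integrable lborel (\<lambda>x. L * norm (mollifier_grad e (x :: real ^ 'n)))"
    by (intro integrable_mult_right integrable_norm integrable_mollifier_grad[OF e0])
  have fb: "integrable lborel (\<lambda>x. \<bar>f x - b (u x)\<bar>)" using int by simp
  have near: "integrable lborel (\<lambda>w :: real ^ 'n. \<bar>near_op s r e w\<bar>)"
    by (intro integrable_abs integrable_near_op e0 s r)
  have Fuv: "norm (F (u x) - F (v y)) \<le> L * (\<bar>u x\<bar> + \<bar>v y\<bar>)" for x y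
  proof -
    have "norm (F (u x) - F (v y)) \<le> L * \<bar>u x - v y\<bar>"
      using lipschitz_onD[OF L, of "u x" "v y"] M[of x] M(2)[of y] by (auto simp: dist_norm abs_le_iff)
    also have "\<dots> \<le> L * (\<bar>u x\<bar> + \<bar>v y\<bar>)" using L0 by (intro mult_left_mono) auto
    finally show ?thesis .
  qed
  have "integrable (lborel \<Otimes>\<^sub>M lborel) (\<lambda>(x, y). sgn (u x - v y) * (f x - b (u x)) * mollifier e (x - y))"
    by (rule integrable_pair_bound[OF integrable_product_fst_diff[OF fb \<rho>]])
      (measurable, auto simp: abs_mult abs_sgn_eq mollifier_nonneg)
  moreover have "integrable (lborel \<Otimes>\<^sub>M lborel)
      (\<lambda>(x, y). sgn (u x - v y) * ((F (u x) - F (v y)) \<bullet> mollifier_grad e (x - y)))"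
  proof (rule integrable_pair_bound[OF integrable_sum_diff[OF int(1,4) G]])
    fix x y
    have "\<bar>sgn (u x - v y) * ((F (u x) - F (v y)) \<bullet> mollifier_grad e (x - y))\<bar>
        \<le> norm (F (u x) - F (v y)) * norm (mollifier_grad e (x - y))"
      by (rule order_trans[OF abs_sgn_mult_le Cauchy_Schwarz_ineq2])
    also have "\<dots> \<le> L * (\<bar>u x\<bar> + \<bar>v y\<bar>) * norm (mollifier_grad e (x - y))"
      by (intro mult_right_mono Fuv norm_ge_zero)
    finally show "\<bar>case (x, y) of (x, y) \<Rightarrow> sgn (u x - v y) * ((F (u x) - F (v y)) \<bullet> mollifier_grad e (x - y))\<bar>
        \<le> (case (x, y) of (x, y) \<Rightarrow> (\<bar>u x\<bar> + \<bar>v y\<bar>) * (L * norm (mollifier_grad e (x - y))))"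
      by (simp add: mult_ac)
  qed measurable
  ultimately show "integrable (lborel \<Otimes>\<^sub>M lborel) ?h1"
    using Bochner_Integration.integrable_add by (fastforce simp: split_def)
  have "integrable lborel (\<lambda>x. \<bar>jump s r u x\<bar>)"
    by (intro integrable_abs integrable_jump int s r)
  from integrable_product_fst_diff[OF this \<rho>] show "integrable (lborel \<Otimes>\<^sub>M lborel) ?h2"
    by (rule integrable_pair_bound) (measurable, auto simp: abs_mult abs_sgn_eq mollifier_nonneg)
  show "integrable (lborel \<Otimes>\<^sub>M lborel) ?h3"
  proof (rule integrable_pair_bound[OF integrable_sum_diff[OF int(1,4) near]])
    fix x y
    show "\<bar>case (x, y) of (x, y) \<Rightarrow> \<bar>u x - v y\<bar> * near_op s r e (x - y)\<bar>
      \<le> (case (x, y) of (x, y) \<Rightarrow> (\<bar>u x\<bar> + \<bar>v y\<bar>) * \<bar>near_op s r e (x - y)\<bar>)"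
      by (auto simp: abs_mult intro!: mult_right_mono)
  qed measurable
qed

lemma doubled_integral_nonneg:
  fixes u v f u1 f1 :: "real ^ 'n \<Rightarrow> real" and F :: "real \<Rightarrow> real ^ 'n"
  assumes sol: "entropy_solution s b F f1 u1"
    and u: "AE x in lborel. u1 x = u x" and f: "AE x in lborel. f1 x = f x"
    and s: "0 < s" "s < 2" and b: "continuous_on UNIV b" and F: "locally_lipschitz F"
    and int: "integrable lborel u" "integrable lborel f" "integrable lborel (\<lambda>x. b (u x))" "integrable lborel v"
    and M: "\<And>x. \<bar>u x\<bar> \<le> M" "\<And>x. \<bar>v x\<bar> \<le> M" and r: "0 < r" "r \<le> 1" and e: "0 < e"
  shows "integrable (lborel \<Otimes>\<^sub>M lborel) (\<lambda>(x, y). doubled_integrand s b F r e f u v x y)" (is ?int)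
    and "0 \<le> integral\<^sup>L (lborel \<Otimes>\<^sub>M lborel) (\<lambda>(x, y). doubled_integrand s b F r e f u v x y)" (is ?pos)
proof -
  note I = doubled_integrand_integrable[OF s b F int M r e]
  show H: ?int
    using Bochner_Integration.integrable_add[OF Bochner_Integration.integrable_add[OF I(1)
          integrable_mult_right[OF I(2), of "frac_const CARD('n) s"]]
        integrable_mult_right[OF I(3), of "frac_const CARD('n) s"]]
    by (simp add: doubled_integrand_def[abs_def] split_def)
  have "integral\<^sup>L (lborel \<Otimes>\<^sub>M lborel) (\<lambda>(x, y). doubled_integrand s b F r e f u v x y)
      = (LINT y|lborel. LINT x|lborel. doubled_integrand s b F r e f u v x y)"
    by (rule lborel_pair.integral_snd[OF H, symmetric])
  moreover have "AE y in lborel. 0 \<le> (LINT x|lborel. doubled_integrand s b F r e f u v x y)"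
    using lborel_pair.AE_integrable_snd[OF I(1)] lborel_pair.AE_integrable_snd[OF I(2)]
      lborel_pair.AE_integrable_snd[OF I(3)]
  proof eventually_elim
    case (elim y)
    have "0 \<le> (LINT x|lborel. sgn (u x - v y) * (f x - b (u x)) * mollifier e (x - y)
        + sgn (u x - v y) * ((F (u x) - F (v y)) \<bullet> mollifier_grad e (x - y)))
      + frac_const CARD('n) s * (LINT x|lborel. sgn (u x - v y) * (jump s r u x * mollifier e (x - y)))
      + frac_const CARD('n) s * (LINT x|lborel. \<bar>u x - v y\<bar> * near_op s r e (x - y))"
      by (rule kruzhkov_inequality[OF sol s b F u f int(1-3) M(1) M(2) r e])
    also have "\<dots> = (LINT x|lborel. doubled_integrand s b F r e f u v x y)"
      unfolding doubled_integrand_def using elim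
      by (subst Bochner_Integration.integral_add, simp, simp,
          subst Bochner_Integration.integral_add, simp, simp) simp
    finally show ?case .
  qed
  ultimately show ?pos by (simp add: integral_nonneg_AE)
qed

lemma
  fixes h :: "'a::euclidean_space \<Rightarrow> 'a \<Rightarrow> real"
  assumes h: "integrable (lborel \<Otimes>\<^sub>M lborel) (case_prod h)"
  shows integrable_sheared: "integrable (lborel \<Otimes>\<^sub>M lborel) (\<lambda>(x, w). h x (x - w))"
    and integral_sheared: "integral\<^sup>L (lborel \<Otimes>\<^sub>M lborel) (\<lambda>(x, y). h x y) = (LINT w|lborel. LINT x|lborel. h x (x - w))"
proof -
  have [measurable]: "case_prod h \<in> borel_measurable (borel \<Otimes>\<^sub>M borel)"
    using borel_measurable_integrable[OF h] by simp
  have [measurable]: "(\<lambda>y. h x y) \<in> borel_measurable borel" for x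
    using measurable_compose[of "\<lambda>y. (x, y)" borel "borel \<Otimes>\<^sub>M borel" "case_prod h"] by simp
  have "(\<lambda>p. case_prod h (fst p, fst p - snd p)) \<in> borel_measurable (borel \<Otimes>\<^sub>M borel)"
    by measurable
  then have meas: "(\<lambda>(x, w). h x (x - w)) \<in> borel_measurable (lborel \<Otimes>\<^sub>M lborel)"
    by (simp add: split_def)
  show int: "integrable (lborel \<Otimes>\<^sub>M lborel) (\<lambda>(x, w). h x (x - w))"
  proof (rule lborel_pair.Fubini_integrable[OF meas])
    have "integrable lborel (\<lambda>x. LINT y|lborel. \<bar>h x y\<bar>)"
      using lborel_pair.integrable_fst[of "\<lambda>x y. \<bar>h x y\<bar>"] integrable_abs[OF h] by (simp add: split_def)
    then show "integrable lborel (\<lambda>x. LINT w|lborel. norm (case (x, w) of (x, w) \<Rightarrow> h x (x - w)))"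
      using integral_reflect[of "\<lambda>y. \<bar>h x y\<bar>" x for x] by simp
    show "AE x in lborel. integrable lborel (\<lambda>w. case (x, w) of (x, w) \<Rightarrow> h x (x - w))"
      using lborel_pair.AE_integrable_fst[OF h]
      by eventually_elim (simp add: integrable_reflect_iff)
  qed
  have "integral\<^sup>L (lborel \<Otimes>\<^sub>M lborel) (\<lambda>(x, y). h x y) = (LINT x|lborel. LINT y|lborel. h x y)"
    by (rule lborel_pair.integral_fst[OF h, symmetric])
  also have "\<dots> = (LINT x|lborel. LINT w|lborel. h x (x - w))"
    by (simp add: integral_reflect)
  also have "\<dots> = (LINT w|lborel. LINT x|lborel. h x (x - w))"
    by (rule lborel_pair.Fubini_integral[OF int, symmetric])
  finally show "integral\<^sup>L (lborel \<Otimes>\<^sub>M lborel) (\<lambda>(x, y). h x y) = (LINT w|lborel. LINT x|lborel. h x (x - w))" .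
qed

text \<open>
  In the coordinates \<open>(x, w)\<close> with \<open>y = x - w\<close> the difference of the jumps of \<open>u\<close> at \<open>x\<close> and of \<open>v\<close> at \<open>y\<close> is
  the jump of the single function \<open>d x = u x - v (x - w)\<close>, and accretivity applies for each \<open>w\<close>.
\<close>

lemma doubled_jump_nonpos:
  fixes u v :: "'a::euclidean_space \<Rightarrow> real"
  assumes int: "integrable lborel u" "integrable lborel v"
    and M: "\<And>x. \<bar>u x\<bar> \<le> M" "\<And>x. \<bar>v x\<bar> \<le> M" and s: "0 < s" and r: "0 < r"
    and h: "integrable (lborel \<Otimes>\<^sub>M lborel)
      (\<lambda>(x, y). sgn (u x - v y) * (jump s r u x - jump s r v y) * mollifier e (x - y))"
  shows "integral\<^sup>L (lborel \<Otimes>\<^sub>M lborel) (\<lambda>(x, y).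
      sgn (u x - v y) * (jump s r u x - jump s r v y) * mollifier e (x - y)) \<le> 0"
proof -
  have [measurable]: "u \<in> borel_measurable borel" "v \<in> borel_measurable borel" using int by auto
  have K: "integrable lborel (far_kernel s r :: 'a \<Rightarrow> real)" by (rule integrable_far_kernel[OF s r])
  have jint: "integrable lborel (\<lambda>z. (g (x + z) - g x) * far_kernel s r z)"
    if [measurable]: "g \<in> borel_measurable borel" and "\<And>x. \<bar>g x\<bar> \<le> M" for g :: "'a \<Rightarrow> real" and x
  proof (rule Bochner_Integration.integrable_bound[OF integrable_mult_right[OF K, of "2 * M"]])
    show "AE z in lborel. norm ((g (x + z) - g x) * far_kernel s r z) \<le> norm (2 * M * far_kernel s r z)"
    proof (rule AE_I2)
      fix z
      have "\<bar>g (x + z) - g x\<bar> \<le> \<bar>2 * M\<bar>" using that(2)[of x] that(2)[of "x + z"] by linarith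
      then show "norm ((g (x + z) - g x) * far_kernel s r z) \<le> norm (2 * M * far_kernel s r z)"
        unfolding real_norm_def abs_mult[of "2 * M"] abs_mult[of "g (x + z) - g x"]
        by (rule mult_right_mono) simp
    qed
  qed measurable
  have "(LINT x|lborel. sgn (u x - v (x - w)) * (jump s r u x - jump s r v (x - w)) * mollifier e (x - (x - w))) \<le> 0" for w
  proof -
    define d where "d x = u x - v (x - w)" for x
    have d: "integrable lborel d"
      unfolding d_def using int integrable_shift_diff_iff[of v w] by simp
    have "jump s r d x = jump s r u x - jump s r v (x - w)" for x
    proof -
      have "jump s r u x - jump s r v (x - w)
          = (LINT z|lborel. (u (x + z) - u x) * far_kernel s r z - (v (x - w + z) - v (x - w)) * far_kernel s r z)"
        unfolding jump_def by (intro Bochner_Integration.integral_diff[symmetric] jint M) measurable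
      then show ?thesis by (simp add: jump_def d_def algebra_simps)
    qed
    then have "(LINT x|lborel. sgn (u x - v (x - w)) * (jump s r u x - jump s r v (x - w)) * mollifier e (x - (x - w)))
        = (LINT x|lborel. sgn (d x) * jump s r d x) * mollifier e w"
      by (simp add: d_def)
    also have "\<dots> \<le> 0"
      using jump_accretive(2)[OF d K far_kernel_nonneg]
      by (intro mult_nonpos_nonneg mollifier_nonneg) (simp add: jump_def)
    finally show ?thesis .
  qed
  then show ?thesis
    unfolding integral_sheared[OF h]
    using integral_nonneg_AE[where M = lborel and f = "\<lambda>w. - (LINT x|lborel.
        sgn (u x - v (x - w)) * (jump s r u x - jump s r v (x - w)) * mollifier e (x - (x - w)))"] by simp
qed

section \<open>Comparison and contraction\<close>

lemma frac_const_nonneg: "0 < s \<Longrightarrow> s < 2 \<Longrightarrow> 0 \<le> frac_const N s"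
  unfolding frac_const_def
  by (intro divide_nonneg_nonneg mult_nonneg_nonneg less_imp_le[OF Gamma_real_pos]) auto

lemma sgn_mult_mono_diff:
  fixes b :: "real \<Rightarrow> real"
  assumes "mono b"
  shows "sgn (p - q) * (b p - b q) = \<bar>b p - b q\<bar>"
  using monoD[OF assms, of p q] monoD[OF assms, of q p] by (cases p q rule: linorder_cases) auto

text \<open>
  The inequalities for the two solutions are added.  The flux terms cancel because the gradient of the even
  bump is odd, the long jumps are nonpositive, and the short jumps disappear as \<open>r\<close> tends to zero.
\<close>

lemma doubled_comparison:
  fixes u v f g u1 f1 v1 g1 :: "real ^ 'n \<Rightarrow> real" and F :: "real \<Rightarrow> real ^ 'n"
  assumes sol: "entropy_solution s b F f1 u1" "entropy_solution s b F g1 v1"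
    and u: "AE x in lborel. u1 x = u x" and f: "AE x in lborel. f1 x = f x"
    and v: "AE x in lborel. v1 x = v x" and g: "AE x in lborel. g1 x = g x"
    and s: "0 < s" "s < 2" and b: "continuous_on UNIV b" "mono b" and F: "locally_lipschitz F"
    and intu: "integrable lborel u" "integrable lborel f" "integrable lborel (\<lambda>x. b (u x))"
    and intv: "integrable lborel v" "integrable lborel g" "integrable lborel (\<lambda>x. b (v x))"
    and M: "\<And>x. \<bar>u x\<bar> \<le> M" "\<And>x. \<bar>v x\<bar> \<le> M" and e: "0 < e"
  shows "integrable (lborel \<Otimes>\<^sub>M lborel)
      (\<lambda>(x, y). (\<bar>f x - g y\<bar> - \<bar>b (u x) - b (v y)\<bar>) * mollifier e (x - y))" (is "integrable _ ?D")
    and "0 \<le> integral\<^sup>L (lborel \<Otimes>\<^sub>M lborel)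
      (\<lambda>(x, y). (\<bar>f x - g y\<bar> - \<bar>b (u x) - b (v y)\<bar>) * mollifier e (x - y))"
proof -
  let ?M = "lborel \<Otimes>\<^sub>M lborel :: ((real ^ 'n) \<times> (real ^ 'n)) measure"
  let ?c = "frac_const CARD('n) s"
  have [measurable]: "u \<in> borel_measurable borel" "v \<in> borel_measurable borel" "f \<in> borel_measurable borel"
    "g \<in> borel_measurable borel" "b \<in> borel_measurable borel"
    using intu intv b by (auto intro: borel_measurable_continuous_onI)
  have e0: "0 \<le> e" using e by simp
  have c0: "0 \<le> ?c" by (rule frac_const_nonneg[OF s])
  have \<rho>: "integrable lborel (mollifier e :: real ^ 'n \<Rightarrow> real)" by (rule integrable_mollifier[OF e0])
  have diff: "integrable ?M (\<lambda>(x, y). \<bar>a x - a' y\<bar> * mollifier e (x - y))"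
    if [measurable]: "integrable lborel a" "integrable lborel a'" for a a' :: "real ^ 'n \<Rightarrow> real"
  proof (rule integrable_pair_bound[OF integrable_sum_diff[OF that \<rho>]])
    fix x y
    show "\<bar>case (x, y) of (x, y) \<Rightarrow> \<bar>a x - a' y\<bar> * mollifier e (x - y)\<bar>
      \<le> (case (x, y) of (x, y) \<Rightarrow> (\<bar>a x\<bar> + \<bar>a' y\<bar>) * mollifier e (x - y))"
      by (auto simp: abs_mult mollifier_nonneg intro!: mult_right_mono)
  qed measurable
  show intD: "integrable ?M ?D"
    using Bochner_Integration.integrable_diff[OF diff[OF intu(2) intv(2)] diff[OF intu(3) intv(3)]]
    by (simp add: split_def left_diff_distrib)
  obtain C where C: "0 \<le> C" "\<And>r w. 0 < r \<Longrightarrow> r \<le> 1 \<Longrightarrow> \<bar>near_op s r e (w :: real ^ 'n)\<bar>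
        \<le> C * (LINT z|lborel. near_kernel s r (z :: real ^ 'n)) * indicator (cball 0 (e + 1)) w"
    using near_op_bound[OF e0 s(2), where 'a = "real ^ 'n"] by blast
  let ?\<omega> = "\<lambda>r. LINT z|lborel. near_kernel s r (z :: real ^ 'n)"
  let ?B = "\<lambda>(x, y). (\<bar>u x\<bar> + \<bar>v y\<bar>) * indicator (cball 0 (e + 1)) (x - y) :: real"
  have intB: "integrable ?M ?B"
    by (intro integrable_sum_diff intu intv integrable_real_indicator emeasure_lborel_cball_finite) auto
  have step: "0 \<le> integral\<^sup>L ?M ?D + ?c * (2 * (C * ?\<omega> r) * integral\<^sup>L ?M ?B)"
    if r: "0 < r" "r \<le> 1" for r
  proof -
    let ?Hu = "\<lambda>(x, y). doubled_integrand s b F r e f u v x y"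
    let ?Hv = "\<lambda>(x, y). doubled_integrand s b F r e g v u y x"
    let ?J = "\<lambda>(x, y). sgn (u x - v y) * (jump s r u x - jump s r v y) * mollifier e (x - y)"
    let ?N = "\<lambda>(x, y). \<bar>u x - v y\<bar> * (near_op s r e (x - y) + near_op s r e (y - x))"
    note Hu = doubled_integral_nonneg[OF sol(1) u f s b(1) F intu intv(1) M r e]
    \<comment> \<open>In the inequality for \<open>v\<close> the roles of the two variables are exchanged.\<close>
    note Hv = doubled_integral_nonneg[OF sol(2) v g s b(1) F intv intu(1) M(2,1) r e]
    have iHv: "integrable ?M ?Hv"
      using lborel_pair.integrable_product_swap[OF Hv(1)] by (simp add: split_def)
    have pHv: "0 \<le> integral\<^sup>L ?M ?Hv"
      using Hv(2) lborel_pair.integral_product_swap[OF borel_measurable_integrable[OF Hv(1)]]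
      by (simp add: split_def)
    note Iu = doubled_integrand_integrable[OF s b(1) F intu intv(1) M r e]
    note Iv = doubled_integrand_integrable[OF s b(1) F intv intu(1) M(2,1) r e]
    have sg: "sgn (v y - u x) = - sgn (u x - v y)" for x y
      by (metis minus_diff_eq sgn_minus)
    have \<rho>': "mollifier e (y - x) = mollifier e (x - y)"
      "mollifier_grad e (y - x) = - mollifier_grad e (x - y)" for x y :: "real ^ 'n"
      using mollifier_minus[of e "x - y"] mollifier_grad_minus[of e "x - y"] by simp_all
    have iJ: "integrable ?M ?J"
    proof -
      have eq: "?J = (\<lambda>p. (case p of (x, y) \<Rightarrow> sgn (u x - v y) * (jump s r u x * mollifier e (x - y)))
          + (case p of (x, y) \<Rightarrow> case (y, x) of (x, y) \<Rightarrow> sgn (v x - u y) * (jump s r v x * mollifier e (x - y))))"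
      proof
        fix p :: "(real ^ 'n) \<times> (real ^ 'n)"
        obtain x y where p: "p = (x, y)" by (cases p)
        show "?J p = (case p of (x, y) \<Rightarrow> sgn (u x - v y) * (jump s r u x * mollifier e (x - y)))
          + (case p of (x, y) \<Rightarrow> case (y, x) of (x, y) \<Rightarrow> sgn (v x - u y) * (jump s r v x * mollifier e (x - y)))"
          unfolding p prod.case sg \<rho>'(1)[of y x] by (simp add: algebra_simps)
      qed
      show ?thesis
        unfolding eq
        by (rule Bochner_Integration.integrable_add[OF Iu(2) lborel_pair.integrable_product_swap[OF Iv(2)]])
    qed
    have abs_vu: "\<bar>v y - u x\<bar> = \<bar>u x - v y\<bar>" for x y by (rule abs_minus_commute)
    have iN: "integrable ?M ?N"
      using Bochner_Integration.integrable_add[OF Iu(3) lborel_pair.integrable_product_swap[OF Iv(3)]]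
      by (simp add: split_def abs_vu distrib_left)
    have pt: "?Hu p + ?Hv p \<le> ?D p + ?c * ?J p + ?c * ?N p" for p
    proof -
      obtain x y where p: "p = (x, y)" by (cases p)
      have flux: "(F (v y) - F (u x)) \<bullet> - mollifier_grad e (x - y) = (F (u x) - F (v y)) \<bullet> mollifier_grad e (x - y)"
        by (simp add: inner_diff_left)
      have expand: "((\<sigma> * (a - a') * R + \<sigma> * q) + c * (\<sigma> * (j * R)) + c * (A * n))
          + ((- \<sigma> * (g' - b') * R + - \<sigma> * q) + c * (- \<sigma> * (j' * R)) + c * (A * n'))
          = \<sigma> * ((a - g') - (a' - b')) * R + c * (\<sigma> * (j - j') * R) + c * (A * (n + n'))"
        for \<sigma> a a' R q c j A n g' b' j' n' :: real
        by (simp add: algebra_simps)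
      have "?Hu p + ?Hv p = sgn (u x - v y) * ((f x - g y) - (b (u x) - b (v y))) * mollifier e (x - y)
          + ?c * ?J p + ?c * ?N p"
        unfolding p prod.case doubled_integrand_def sg \<rho>'(1)[of y x] \<rho>'(2)[of y x] flux
          abs_minus_commute[of "v y" "u x"] by (rule expand)
      moreover have "sgn (u x - v y) * ((f x - g y) - (b (u x) - b (v y))) \<le> \<bar>f x - g y\<bar> - \<bar>b (u x) - b (v y)\<bar>"
        using abs_ge_self[of "sgn (u x - v y) * (f x - g y)"] abs_sgn_mult_le[of "u x - v y" "f x - g y"]
          sgn_mult_mono_diff[OF b(2), of "u x" "v y"]
        by (simp add: right_diff_distrib)
      ultimately show ?thesis
        unfolding p by (simp add: mult_right_mono mollifier_nonneg)
    qed
    have "0 \<le> integral\<^sup>L ?M ?Hu + integral\<^sup>L ?M ?Hv"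
      using Hu(2) pHv by simp
    also have "\<dots> = integral\<^sup>L ?M (\<lambda>p. ?Hu p + ?Hv p)"
      by (rule Bochner_Integration.integral_add[OF Hu(1) iHv, symmetric])
    also have "\<dots> \<le> integral\<^sup>L ?M (\<lambda>p. ?D p + ?c * ?J p + ?c * ?N p)"
      by (intro integral_mono pt Bochner_Integration.integrable_add integrable_mult_right intD iJ iN Hu(1) iHv)
    also have "\<dots> = integral\<^sup>L ?M ?D + ?c * integral\<^sup>L ?M ?J + ?c * integral\<^sup>L ?M ?N"
      using intD iJ iN by (simp add: Bochner_Integration.integral_add)
    also have "\<dots> \<le> integral\<^sup>L ?M ?D + ?c * 0 + ?c * (2 * (C * ?\<omega> r) * integral\<^sup>L ?M ?B)"
    proof (intro add_mono mult_left_mono c0 order_refl)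
      show "integral\<^sup>L ?M ?J \<le> 0"
        by (rule doubled_jump_nonpos[OF intu(1) intv(1) M s(1) r(1) iJ])
      have "integral\<^sup>L ?M ?N \<le> integral\<^sup>L ?M (\<lambda>p. 2 * (C * ?\<omega> r) * ?B p)"
      proof (rule integral_mono[OF iN])
        show "integrable ?M (\<lambda>p. 2 * (C * ?\<omega> r) * ?B p)" by (intro integrable_mult_right intB)
        fix p :: "(real ^ 'n) \<times> (real ^ 'n)"
        obtain x y where p: "p = (x, y)" by (cases p)
        let ?i = "indicator (cball 0 (e + 1)) (x - y) :: real"
        have "indicator (cball 0 (e + 1)) (y - x) = ?i"
          by (simp add: indicator_def norm_minus_commute)
        then have "near_op s r e (x - y) + near_op s r e (y - x) \<le> 2 * (C * ?\<omega> r) * ?i"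
          using C(2)[OF r, of "x - y"] C(2)[OF r, of "y - x"] by (simp add: abs_le_iff)
        moreover have "0 \<le> 2 * (C * ?\<omega> r) * ?i"
          using order_trans[OF abs_ge_zero C(2)[OF r, of "x - y"]] by simp
        ultimately have "\<bar>u x - v y\<bar> * (near_op s r e (x - y) + near_op s r e (y - x))
            \<le> (\<bar>u x\<bar> + \<bar>v y\<bar>) * (2 * (C * ?\<omega> r) * ?i)"
          by (meson abs_ge_zero abs_triangle_ineq4 mult_left_mono mult_right_mono order_trans)
        then show "?N p \<le> 2 * (C * ?\<omega> r) * ?B p" unfolding p by (simp add: mult_ac)
      qed
      then show "integral\<^sup>L ?M ?N \<le> 2 * (C * ?\<omega> r) * integral\<^sup>L ?M ?B" by simp
    qed
    finally show ?thesis by simp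
  qed
  have "(\<lambda>n. integral\<^sup>L ?M ?D + ?c * (2 * (C * ?\<omega> (1 / real (Suc n))) * integral\<^sup>L ?M ?B))
      \<longlonglongrightarrow> integral\<^sup>L ?M ?D + ?c * (2 * (C * 0) * integral\<^sup>L ?M ?B)"
    by (intro tendsto_intros near_kernel_mass_tendsto_0 s)
  then have lim: "(\<lambda>n. integral\<^sup>L ?M ?D + ?c * (2 * (C * ?\<omega> (1 / real (Suc n))) * integral\<^sup>L ?M ?B))
      \<longlonglongrightarrow> integral\<^sup>L ?M ?D" by simp
  have "0 \<le> integral\<^sup>L ?M ?D + ?c * (2 * (C * ?\<omega> (1 / real (Suc n))) * integral\<^sup>L ?M ?B)" for n
    by (rule step) auto
  then show "0 \<le> integral\<^sup>L ?M ?D" by (intro LIMSEQ_le_const[OF lim]) blast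
qed

lemma L1_dist_triangle:
  fixes a a' :: "'a::euclidean_space \<Rightarrow> real"
  assumes "integrable lborel a" "integrable lborel a'"
    and d: "(LINT x|lborel. \<bar>a' x - a' (x - w)\<bar>) \<le> e"
  shows "integrable lborel (\<lambda>x. \<bar>a x - a' (x - w)\<bar>)"
    and "\<bar>(LINT x|lborel. \<bar>a x - a' (x - w)\<bar>) - (LINT x|lborel. \<bar>a x - a' x\<bar>)\<bar> \<le> e"
proof -
  have [measurable]: "a' \<in> borel_measurable borel" using assms by simp
  have sh: "integrable lborel (\<lambda>x. a' (x - w))"
    using assms integrable_shift_diff_iff[of a' w] by simp
  then show 1: "integrable lborel (\<lambda>x. \<bar>a x - a' (x - w)\<bar>)" using assms by simp
  have 2: "integrable lborel (\<lambda>x. \<bar>a x - a' x\<bar>)" using assms by simp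
  have 3: "integrable lborel (\<lambda>x. \<bar>a' x - a' (x - w)\<bar>)" using assms sh by simp
  have "(LINT x|lborel. \<bar>a x - a' (x - w)\<bar>) \<le> (LINT x|lborel. \<bar>a x - a' x\<bar> + \<bar>a' x - a' (x - w)\<bar>)"
    using 1 2 3 by (intro integral_mono) auto
  moreover have "(LINT x|lborel. \<bar>a x - a' x\<bar>) \<le> (LINT x|lborel. \<bar>a x - a' (x - w)\<bar> + \<bar>a' x - a' (x - w)\<bar>)"
    using 1 2 3 by (intro integral_mono) auto
  ultimately show "\<bar>(LINT x|lborel. \<bar>a x - a' (x - w)\<bar>) - (LINT x|lborel. \<bar>a x - a' x\<bar>)\<bar> \<le> e"
    using 1 2 3 d by (simp add: abs_le_iff)
qed

text \<open>
  After shearing, the doubled inequality is an average over \<open>\<bar>w\<bar> < e\<close> of the difference of the \<open>L\<^sup>1\<close> distances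
  between \<open>f, g\<close> and between \<open>b (u), b (v)\<close>, the second function being shifted by \<open>w\<close>.  For small \<open>e\<close> each distance changes
  by at most \<open>t / 2\<close> under such a shift.
\<close>

lemma borel_L1_contraction:
  fixes u v f g u1 f1 v1 g1 :: "real ^ 'n \<Rightarrow> real" and F :: "real \<Rightarrow> real ^ 'n"
  assumes sol: "entropy_solution s b F f1 u1" "entropy_solution s b F g1 v1"
    and u: "AE x in lborel. u1 x = u x" and f: "AE x in lborel. f1 x = f x"
    and v: "AE x in lborel. v1 x = v x" and g: "AE x in lborel. g1 x = g x"
    and s: "0 < s" "s < 2" and b: "continuous_on UNIV b" "mono b" and F: "locally_lipschitz F"
    and intu: "integrable lborel u" "integrable lborel f" "integrable lborel (\<lambda>x. b (u x))"
    and intv: "integrable lborel v" "integrable lborel g" "integrable lborel (\<lambda>x. b (v x))"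
    and M: "\<And>x. \<bar>u x\<bar> \<le> M" "\<And>x. \<bar>v x\<bar> \<le> M"
  shows "(LINT x|lborel. \<bar>b (u x) - b (v x)\<bar>) \<le> (LINT x|lborel. \<bar>f x - g x\<bar>)"
proof (rule field_le_epsilon)
  fix t :: real assume "0 < t"
  then have t: "0 < t / 2" by simp
  obtain d1 where d1: "0 < d1" "\<And>w. norm w \<le> d1 \<Longrightarrow> (LINT x|lborel. \<bar>g x - g (x - w)\<bar>) \<le> t / 2"
    using L1_translation_continuous[OF intv(2) t] by blast
  obtain d2 where d2: "0 < d2" "\<And>w. norm w \<le> d2 \<Longrightarrow> (LINT x|lborel. \<bar>b (v x) - b (v (x - w))\<bar>) \<le> t / 2"
    using L1_translation_continuous[OF intv(3) t] by blast
  define e where "e = min d1 d2"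
  have e: "0 < e" using d1 d2 by (simp add: e_def)
  let ?\<Delta> = "(LINT x|lborel. \<bar>f x - g x\<bar>) - (LINT x|lborel. \<bar>b (u x) - b (v x)\<bar>) + t"
  note D = doubled_comparison[OF sol u f v g s b F intu intv M e]
  have inner: "(LINT x|lborel. (\<bar>f x - g (x - w)\<bar> - \<bar>b (u x) - b (v (x - w))\<bar>) * mollifier e (x - (x - w)))
      \<le> ?\<Delta> * mollifier e w" for w
  proof (cases "e \<le> norm w")
    case False
    then have w: "norm w \<le> d1" "norm w \<le> d2" by (auto simp: e_def)
    note tg = L1_dist_triangle[OF intu(2) intv(2) d1(2)[OF w(1)]]
      and tb = L1_dist_triangle[OF intu(3) intv(3) d2(2)[OF w(2)]]
    have "(LINT x|lborel. (\<bar>f x - g (x - w)\<bar> - \<bar>b (u x) - b (v (x - w))\<bar>) * mollifier e (x - (x - w)))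
        = ((LINT x|lborel. \<bar>f x - g (x - w)\<bar>) - (LINT x|lborel. \<bar>b (u x) - b (v (x - w))\<bar>)) * mollifier e w"
      using tg(1) tb(1) by simp
    also have "\<dots> \<le> ?\<Delta> * mollifier e w"
      using tg(2) tb(2) by (intro mult_right_mono mollifier_nonneg) linarith
    finally show ?thesis .
  next
    case True
    then have "mollifier e w = 0" using e by (simp add: mollifier_eq_0_iff)
    then show ?thesis by simp
  qed
  have "0 \<le> (LINT w|lborel. LINT x|lborel.
      (\<bar>f x - g (x - w)\<bar> - \<bar>b (u x) - b (v (x - w))\<bar>) * mollifier e (x - (x - w)))"
    using D(2) unfolding integral_sheared[OF D(1)] .
  also have "\<dots> \<le> (LINT w|lborel. ?\<Delta> * mollifier e (w :: real ^ 'n))"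
  proof (rule integral_mono[OF _ _ inner])
    show "integrable lborel (\<lambda>w. LINT x|lborel.
        (\<bar>f x - g (x - w)\<bar> - \<bar>b (u x) - b (v (x - w))\<bar>) * mollifier e (x - (x - w)))"
      by (rule lborel_pair.integrable_snd[OF integrable_sheared[OF D(1)]])
    show "integrable lborel (\<lambda>w :: real ^ 'n. ?\<Delta> * mollifier e w)"
      by (intro integrable_mult_right integrable_mollifier less_imp_le[OF e])
  qed
  also have "\<dots> = ?\<Delta> * (LINT w|lborel. mollifier e (w :: real ^ 'n))" by simp
  finally have "0 \<le> ?\<Delta>"
    using integral_mollifier_pos[OF e, where 'a = "real ^ 'n"] by (simp add: zero_le_mult_iff)
  then show "(LINT x|lborel. \<bar>b (u x) - b (v x)\<bar>) \<le> (LINT x|lborel. \<bar>f x - g x\<bar>) + t" by simp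
qed

lemma borel_representative:
  fixes h :: "'a::euclidean_space \<Rightarrow> real"
  assumes "h \<in> borel_measurable lebesgue"
  obtains h' where "h' \<in> borel_measurable borel" "AE x in lborel. h x = h' x"
  using completion_ex_borel_measurable_real[OF assms] by auto

lemma bounded_borel_representative:
  fixes h :: "'a::euclidean_space \<Rightarrow> real"
  assumes "L_infty h"
  obtains h' M where "h' \<in> borel_measurable borel" "AE x in lborel. h x = h' x" "\<And>x. \<bar>h' x\<bar> \<le> M"
proof -
  obtain M where M: "AE x in lborel. \<bar>h x\<bar> \<le> M"
    using assms by (auto simp: L_infty_def AE_completion_iff)
  obtain h' where h': "h' \<in> borel_measurable borel" "AE x in lborel. h x = h' x"
    using borel_representative assms unfolding L_infty_def by blast
  \<comment> \<open>Truncation turns the bound almost everywhere into a bound everywhere.\<close>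
  let ?k = "\<lambda>x. max (- \<bar>M\<bar>) (min \<bar>M\<bar> (h' x))"
  have [measurable]: "h' \<in> borel_measurable borel" by (rule h')
  have "?k \<in> borel_measurable borel" by measurable
  moreover have "AE x in lborel. h x = ?k x" using h'(2) M by eventually_elim auto
  moreover have "\<bar>?k x\<bar> \<le> \<bar>M\<bar>" for x by auto
  ultimately show thesis by (rule that)
qed

lemma integrable_representative:
  fixes h h' :: "'a::euclidean_space \<Rightarrow> real"
  assumes "L_one h" "h' \<in> borel_measurable borel" "AE x in lborel. h x = h' x"
  shows "integrable lborel h'"
proof -
  have "integrable lebesgue h'"
    using assms(1) unfolding L_one_def
  proof (rule integrable_cong_AE_imp)
    show "h' \<in> borel_measurable lebesgue" using assms(2) by (simp add: measurable_completion)
    show "AE x in lebesgue. h x = h' x"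
      by (rule AE_completion, use assms(3) in eventually_elim) simp
  qed
  then show ?thesis using assms(2) by (simp add: integrable_completion)
qed

theorem theorem3p4:
  fixes s lam :: real
    and b :: "real \<Rightarrow> real"
    and F :: "real \<Rightarrow> real ^ 'n"
    and f f' u u' :: "real ^ 'n \<Rightarrow> real"
  assumes "0 < s" and "s \<le> 1"
    and "\<exists>L. L-lipschitz_on UNIV b" and "mono b" and "b 0 = 0"
    and "lam > 0" and "\<And>r. b r * r \<ge> lam * \<bar>r\<bar>\<^sup>2"
    and "locally_lipschitz F" and "F 0 = 0"
    and "L_one f" and "L_infty f" and "L_one f'" and "L_infty f'"
    and "entropy_solution s b F f u" and "entropy_solution s b F f' u'"
    and "L_one (\<lambda>x. b (u x))" and "L_one (\<lambda>x. b (u' x))"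
  shows "(LINT x|lebesgue. \<bar>b (u x) - b (u' x)\<bar>) \<le> (LINT x|lebesgue. \<bar>f x - f' x\<bar>)"
proof -
  have contb: "continuous_on UNIV b" using assms(3) lipschitz_on_continuous_on by blast
  then have [measurable]: "b \<in> borel_measurable borel" by (rule borel_measurable_continuous_onI)
  \<comment> \<open>With \<open>b (u) \<in> L\<^sup>1\<close> this puts the solutions into \<open>L\<^sup>1\<close>.\<close>
  have coercive: "lam * \<bar>r\<bar> \<le> \<bar>b r\<bar>" for r
  proof (cases "r = 0")
    case False
    have "lam * \<bar>r\<bar> * \<bar>r\<bar> \<le> \<bar>b r\<bar> * \<bar>r\<bar>"
      using assms(7)[of r] abs_ge_self[of "b r * r"] by (simp add: power2_eq_square abs_mult)
    then show ?thesis using False by simp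
  qed simp
  have data: "\<exists>h0. h0 \<in> borel_measurable borel \<and> (AE x in lborel. h x = h0 x) \<and> integrable lborel h0"
    if L1: "L_one h" for h :: "real ^ 'n \<Rightarrow> real"
  proof -
    obtain h0 where h0: "h0 \<in> borel_measurable borel" "AE x in lborel. h x = h0 x"
      using borel_representative[of h] borel_measurable_integrable[OF L1[unfolded L_one_def]] by blast
    then show ?thesis using integrable_representative[OF L1] by blast
  qed
  have solution: "\<exists>w0 M. w0 \<in> borel_measurable borel \<and> (AE x in lborel. w x = w0 x) \<and> (\<forall>x. \<bar>w0 x\<bar> \<le> M) \<and>
      integrable lborel w0 \<and> integrable lborel (\<lambda>x. b (w0 x))"
    if w: "L_infty w" "L_one (\<lambda>x. b (w x))" for w :: "real ^ 'n \<Rightarrow> real"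
  proof -
    obtain w0 M where w0: "w0 \<in> borel_measurable borel" "AE x in lborel. w x = w0 x" "\<And>x. \<bar>w0 x\<bar> \<le> M"
      using bounded_borel_representative[OF w(1)] by blast
    have [measurable]: "w0 \<in> borel_measurable borel" by (rule w0)
    have bw: "integrable lborel (\<lambda>x. b (w0 x))"
      by (rule integrable_representative[OF w(2)]) (measurable, use w0(2) in eventually_elim, simp)
    have "integrable lborel w0"
    proof (rule Bochner_Integration.integrable_bound)
      show "integrable lborel (\<lambda>x. inverse lam * b (w0 x))" using bw by simp
      show "AE x in lborel. norm (w0 x) \<le> norm (inverse lam * b (w0 x))"
        using coercive assms(6) by (intro AE_I2) (simp add: abs_mult field_simps)
    qed measurable
    then show ?thesis using w0 bw by blast
  qed
  have Linf: "L_infty u" "L_infty u'"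
    using assms(14,15) by (auto simp: entropy_solution_def)
  obtain u0 M where u: "u0 \<in> borel_measurable borel" "AE x in lborel. u x = u0 x" "\<And>x. \<bar>u0 x\<bar> \<le> M"
    "integrable lborel u0" "integrable lborel (\<lambda>x. b (u0 x))"
    using solution[OF Linf(1) assms(16)] by blast
  obtain v0 M' where v: "v0 \<in> borel_measurable borel" "AE x in lborel. u' x = v0 x" "\<And>x. \<bar>v0 x\<bar> \<le> M'"
    "integrable lborel v0" "integrable lborel (\<lambda>x. b (v0 x))"
    using solution[OF Linf(2) assms(17)] by blast
  obtain f0 where f: "f0 \<in> borel_measurable borel" "AE x in lborel. f x = f0 x" "integrable lborel f0"
    using data[OF assms(10)] by blast
  obtain g0 where g: "g0 \<in> borel_measurable borel" "AE x in lborel. f' x = g0 x" "integrable lborel g0"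
    using data[OF assms(12)] by blast
  have [measurable]: "u0 \<in> borel_measurable borel" "v0 \<in> borel_measurable borel"
    "f0 \<in> borel_measurable borel" "g0 \<in> borel_measurable borel"
    by (fact u v f g)+
  have "\<bar>u0 x\<bar> \<le> max M M'" "\<bar>v0 x\<bar> \<le> max M M'" for x
    using u(3)[of x] v(3)[of x] by auto
  then have "(LINT x|lborel. \<bar>b (u0 x) - b (v0 x)\<bar>) \<le> (LINT x|lborel. \<bar>f0 x - g0 x\<bar>)"
    using assms(1,2)
    by (intro borel_L1_contraction[OF assms(14,15) u(2) f(2) v(2) g(2) _ _ contb assms(4,8)
          u(4) f(3) u(5) v(4) g(3) v(5)]) auto
  moreover have "(LINT x|lebesgue. \<bar>b (u x) - b (u' x)\<bar>) = (LINT x|lborel. \<bar>b (u0 x) - b (v0 x)\<bar>)"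
    by (rule lebesgue_integral_cong_borel, measurable, use u(2) v(2) in eventually_elim) simp
  moreover have "(LINT x|lebesgue. \<bar>f x - f' x\<bar>) = (LINT x|lborel. \<bar>f0 x - g0 x\<bar>)"
    by (rule lebesgue_integral_cong_borel, measurable, use f(2) g(2) in eventually_elim) simp
  ultimately show ?thesis by simp
qed

end
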